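(* Let $c>0$, let $\Theta_c(z)=e^{icz}$, and let $\Theta$ be an inner function in the upper half-plane such that for some $\alpha\in\mathbb{C}$, $|\alpha|=1$, the Clark measure $\sigma^{\alpha}_{\Theta_c\Theta}$ of the inner function $\Theta_c\Theta$ is purely atomic (with $c_\alpha=0$ in the Herglotz representation). Let $\{x_n\}_{n\in\mathbb{Z}}$ be the set of its atoms and let $\{k^{\Theta_c\Theta}_{x_n}\}_{n\in\mathbb{Z}}$ be the corresponding orthogonal basis of $K^2_{\Theta_c\Theta}$. Then for every integer $m\ge1$ and every $f\in K^2_\Theta$, $$ f(x)=\sum_{n\in\mathbb{Z}} f(x_n)\,e^{-\frac{ic(x-x_n)}{2}}\,\operatorname{sinc}\left(\frac{c(x-x_n)}{2m}\right)^m\frac{k^{\Theta_c\Theta}_{x_n}(x)}{\|k^{\Theta_c\Theta}_{x_n}\|^2},\qquad x\in\mathbb{R}, $$ where the identity is understood for boundary functions on $\mathbb{R}$ (almost everywhere, with the series converging in $L^2(\mathbb{R})$). In particular, one can reconstruct $f\in K^2_\Theta$ from its samples $\{f(x_n)\}$ using an expansion with respect to functions of arbitrary polynomial decay (for every $N$, $m$ can be chosen so that each function multiplying $f(x_n)$ in the series is $O(|x|^{-N})$ as $|x|\to\infty$). Further, $$ \|f\|^2=\sum_{n\in\mathbb{Z}}\frac{|f(x_n)|^2}{\|k^{\Theta_c\Theta}_{x_n}\|^2},\qquad f\in K^2_\Theta . $$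
   Context: $\mathbb{C}^+=\{z\in\mathbb{C}:\operatorname{Im} z>0\}$. $H^2$ is the Hardy space of $\mathbb{C}^+$, identified through boundary values with a closed subspace of $L^2(\mathbb{R})$, with inner product $\langle f,g\rangle=\int_{\mathbb{R}}f\overline{g}\,dx$ and norm $\|\cdot\|$. An inner function is a bounded analytic function on $\mathbb{C}^+$ with boundary values of modulus one almost everywhere on $\mathbb{R}$. For an inner function $U$, the model space is $K^2_U=H^2\cap(UH^2)^\perp$, with reproducing kernel $$k^U_z(w)=\frac{i}{2\pi}\,\frac{1-\overline{U(z)}\,U(w)}{w-\overline z};$$ at a real point $z=x$ the same formula is used (with $U(x)$ the boundary value) whenever $k^U_x\in K^2_U$, which happens exactly when the modulus of the angular derivative of $U$ at $x$ is finite, and then $f(x)=\langle f,k^U_x\rangle$ for $f\in K^2_U$. Note $K^2_\Theta\subseteq K^2_{\Theta_c\Theta}$, so $f(x_n)=\langle f,k^{\Theta_c\Theta}_{x_n}\rangle$ makes sense for $f\in K^2_\Theta$. Clark measures: for an inner function $U$ and $|\alpha|=1$, the function $(\alpha+U)/(\alpha-U)$ has positive real part in $\mathbb{C}^+$, and the Clark measure $\sigma^\alpha_U$ is the non-negative measure on $\mathbb{R}$ determined (together with a constant $c_\alpha\ge0$) by the Herglotz representation $$\operatorname{Re}\frac{\alpha+U(z)}{\alpha-U(z)}=c_\alpha\operatorname{Im}z+\frac{\operatorname{Im}z}{\pi}\int_{\mathbb{R}}\frac{d\sigma^\alpha_U(x)}{|x-z|^2},\qquad z\in\mathbb{C}^+.$$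 Clark's theorem (a known fact): if $c_\alpha=0$ and $\sigma^\alpha_U=\sum_n a_n\delta_{x_n}$ is purely atomic, then $\{k^U_{x_n}\}$ is an orthogonal basis of $K^2_U$. $\operatorname{sinc}t=\frac{\sin t}{t}$, with $\operatorname{sinc}0=1$. *)

theory Defs
  imports "HOL-Complex_Analysis.Complex_Analysis" "HOL-Probability.Sinc_Integral"
begin

definition upper_half_plane :: "complex set" where
  "upper_half_plane = {z. 0 < Im z}"

text \<open>Boundary values on the real line are non-tangential limits: limits within every
  Stolz angle with vertex \<open>x\<close>.\<close>

definition nt_limit :: "(complex \<Rightarrow> complex) \<Rightarrow> real \<Rightarrow> complex \<Rightarrow> bool" where
  "nt_limit F x l \<longleftrightarrow>
     (\<forall>\<kappa>>0. (F \<longlongrightarrow> l) (at (complex_of_real x) within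
        {z \<in> upper_half_plane. \<bar>Re z - x\<bar> \<le> \<kappa> * Im z}))"

text \<open>The extension of a function on the upper half-plane by its boundary values, wherever
  they exist; only values on the closed half-plane are meaningful.\<close>

definition hp_ext :: "(complex \<Rightarrow> complex) \<Rightarrow> complex \<Rightarrow> complex" where
  "hp_ext F z = (if z \<in> upper_half_plane then F z else (THE l. nt_limit F (Re z) l))"

definition inner_function :: "(complex \<Rightarrow> complex) \<Rightarrow> bool" where
  "inner_function U \<longleftrightarrow>
     U holomorphic_on upper_half_plane \<and> bounded (U ` upper_half_plane) \<and>
     (AE x in lebesgue. \<exists>l. nt_limit U x l \<and> norm l = 1)"

text \<open>Elements of \<open>L\<^sup>2\<close> of the real line are represented by functions; equality in that space
  is equality almost everywhere.\<close>

definition L2 :: "(real \<Rightarrow> complex) set" where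
  "L2 = {f \<in> borel_measurable lebesgue. integrable lebesgue (\<lambda>x. (norm (f x))\<^sup>2)}"

definition l2_inner :: "(real \<Rightarrow> complex) \<Rightarrow> (real \<Rightarrow> complex) \<Rightarrow> complex" where
  "l2_inner f g = (\<integral>x. f x * cnj (g x) \<partial>lebesgue)"

definition l2_norm :: "(real \<Rightarrow> complex) \<Rightarrow> real" where
  "l2_norm f = sqrt (\<integral>x. (norm (f x))\<^sup>2 \<partial>lebesgue)"

text \<open>Unconditional convergence in \<open>L\<^sup>2\<close>. The sum is determined up to equality almost
  everywhere.\<close>

definition has_l2_sum :: "('i \<Rightarrow> real \<Rightarrow> complex) \<Rightarrow> (real \<Rightarrow> complex) \<Rightarrow> bool" where
  "has_l2_sum g f \<longleftrightarrow> (\<forall>i. g i \<in> L2) \<and> f \<in> L2 \<and>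
     ((\<lambda>S. l2_norm (\<lambda>x. f x - (\<Sum>i\<in>S. g i x))) \<longlongrightarrow> 0) (finite_subsets_at_top UNIV)"

definition hardy_analytic :: "(complex \<Rightarrow> complex) set" where
  "hardy_analytic = {F. F holomorphic_on upper_half_plane \<and>
     (SUP y\<in>{0<..}. \<integral>\<^sup>+x. ennreal ((norm (F (Complex x y)))\<^sup>2) \<partial>lebesgue) < \<infinity>}"

text \<open>\<open>F\<close> is an element of the Hardy space as an analytic function, and \<open>f\<close> is the same
  element as a boundary function on the real line.\<close>

definition hardy_boundary :: "(complex \<Rightarrow> complex) \<Rightarrow> (real \<Rightarrow> complex) \<Rightarrow> bool" where
  "hardy_boundary F f \<longleftrightarrow>
     F \<in> hardy_analytic \<and> f \<in> L2 \<and> (AE x in lebesgue. nt_limit F x (f x))"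

definition H2 :: "(real \<Rightarrow> complex) set" where
  "H2 = {f. \<exists>F. hardy_boundary F f}"

definition model_space :: "(complex \<Rightarrow> complex) \<Rightarrow> (real \<Rightarrow> complex) set" where
  "model_space U =
     {f \<in> H2. \<forall>g\<in>H2. l2_inner f (\<lambda>x. hp_ext U (complex_of_real x) * g x) = 0}"

definition model_kernel :: "(complex \<Rightarrow> complex) \<Rightarrow> complex \<Rightarrow> complex \<Rightarrow> complex" where
  "model_kernel U z w =
     \<i> / (2 * complex_of_real pi) * ((1 - cnj (hp_ext U z) * hp_ext U w) / (w - cnj z))"

definition boundary_kernel :: "(complex \<Rightarrow> complex) \<Rightarrow> real \<Rightarrow> real \<Rightarrow> complex" where
  "boundary_kernel U t = (\<lambda>x. model_kernel U (complex_of_real t) (complex_of_real x))"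

text \<open>\<open>\<sigma>\<close> is the Clark measure of \<open>U\<close> at \<open>\<alpha>\<close>, and \<open>k\<close> is the coefficient of the linear
  term in the Herglotz representation.\<close>

definition clark_measure ::
    "(complex \<Rightarrow> complex) \<Rightarrow> complex \<Rightarrow> real \<Rightarrow> real measure \<Rightarrow> bool" where
  "clark_measure U \<alpha> k \<sigma> \<longleftrightarrow> sets \<sigma> = sets borel \<and> 0 \<le> k \<and>
     (\<forall>z\<in>upper_half_plane.
        integrable \<sigma> (\<lambda>x. 1 / (norm (complex_of_real x - z))\<^sup>2) \<and>
        Re ((\<alpha> + U z) / (\<alpha> - U z)) =
          k * Im z + Im z / pi * (\<integral>x. 1 / (norm (complex_of_real x - z))\<^sup>2 \<partial>\<sigma>))"

definition atoms :: "real measure \<Rightarrow> real set" where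
  "atoms \<sigma> = {t. emeasure \<sigma> {t} \<noteq> 0}"

definition purely_atomic :: "real measure \<Rightarrow> bool" where
  "purely_atomic \<sigma> \<longleftrightarrow>
     (\<forall>B\<in>sets \<sigma>. emeasure \<sigma> B = (\<Sum>\<^sub>\<infinity>t\<in>B \<inter> atoms \<sigma>. emeasure \<sigma> {t}))"

definition exp_inner :: "real \<Rightarrow> complex \<Rightarrow> complex" where
  "exp_inner c z = exp (\<i> * complex_of_real c * z)"

text \<open>The function multiplying the sample at the node \<open>t\<close> in the sampling series.\<close>

definition sampling_function ::
    "(complex \<Rightarrow> complex) \<Rightarrow> real \<Rightarrow> nat \<Rightarrow> real \<Rightarrow> real \<Rightarrow> complex" where
  "sampling_function U c m t x =
     exp (- (\<i> * complex_of_real (c * (x - t)) / 2)) *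
     complex_of_real (sinc (c * (x - t) / (2 * real m)) ^ m) *
     (boundary_kernel U t x / complex_of_real ((l2_norm (boundary_kernel U t))\<^sup>2))"

end

theory Submission
  imports Defs "HOL-Real_Asymp.Real_Asymp"
begin

text \<open>Write \<open>U\<close> for the product of \<open>exp (i c z)\<close> and \<open>\<Theta>\<close>, \<open>k\<^sub>z\<close> for its model kernel at \<open>z\<close>, and
  \<open>a\<^sub>n\<close> for the Clark mass of the node \<open>x\<^sub>n\<close>. Two ideas carry the theorem.

  The first is Clark's theorem: the kernels \<open>k\<^sub>n\<close> at the nodes are orthogonal, \<open>\<parallel>k\<^sub>n\<parallel>\<^sup>2 = 1 / a\<^sub>n\<close>, and
  they satisfy Parseval's identity. At an atom \<open>t\<close> the function \<open>U\<close> has the non-tangential limit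
  \<open>\<alpha>\<close> and a finite angular derivative, because the Herglotz integral of the Clark measure blows up
  there like a multiple of the mass of \<open>t\<close> divided by the distance (\<open>W_atom\<close>, \<open>U_quotient_limit\<close>). Hence
  the kernels \<open>k\<^sub>z\<close> stay bounded as \<open>z\<close> tends to \<open>t\<close> in a Stolz angle, and they converge weakly to
  \<open>k\<^sub>t\<close> (\<open>kernel_weak_limit\<close>); the reproducing property at \<open>t\<close> and orthogonality are limits of the
  identity \<open>\<langle>k\<^sub>z, k\<^sub>\<zeta>\<rangle> = k\<^sub>z \<zeta>\<close>. For a kernel \<open>k\<^sub>z\<close> Parseval's identity is the Herglotz formula itself
  (\<open>kernel_parseval\<close>). So if \<open>F z = \<langle>f, k\<^sub>z\<rangle>\<close>, the expansion of \<open>f\<close> converges to \<open>F z\<close> at every point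
  of the half-plane, and since the Poisson integral is a contraction of \<open>L\<^sup>2\<close>, Fatou's lemma turns
  this into Parseval's identity for \<open>f\<close> (\<open>reproduced_parseval\<close>).

  The second idea is that \<open>f\<close> in the model space of \<open>\<Theta>\<close> leaves room for modulations: for
  \<open>0 \<le> \<tau> \<le> c\<close> the function \<open>exp (i \<tau> t) f t\<close> is still reproduced by the kernels of \<open>U\<close>
  (\<open>modulation_reproduced\<close>), so it has an orthogonal expansion of its own. Undoing the modulation
  gives an expansion of \<open>f\<close> in the functions \<open>exp (- i \<tau> (t - x\<^sub>n)) k\<^sub>n t\<close>, whose error over a finite
  set of nodes does not depend on \<open>\<tau>\<close>, as only the moduli of the samples enter. The factor
  multiplying \<open>k\<^sub>n\<close> in the sampling function is an average of \<open>exp (- i \<tau> (t - x\<^sub>n))\<close> over \<open>\<tau>\<close> between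
  \<open>0\<close> and \<open>c\<close>: it is the \<open>m\<close>-th power of the mean of \<open>exp (- i s c (t - x\<^sub>n) / m)\<close> over \<open>s\<close> between \<open>0\<close> and \<open>1\<close>.
  Balls in \<open>L\<^sup>2\<close> are convex, so the averaged expansion has an error at most as large, and this error is
  the tail of Parseval's series (\<open>averaged_approximation\<close>, \<open>sampling_approximation\<close>).

  The facts about the Hardy space that enter are Cauchy's formula for boundary functions
  (\<open>hardy_cauchy\<close>) and its consequence, Poisson's formula.\<close>

section \<open>Square-integrable functions\<close>

lemma L2_iff_nn_integral:
  "f \<in> L2 \<longleftrightarrow> f \<in> borel_measurable lebesgue \<and>
     (\<integral>\<^sup>+x. ennreal ((norm (f x))\<^sup>2) \<partial>lebesgue) < \<infinity>"
  by (auto simp: L2_def integrable_iff_bounded)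

lemma L2_measurable: "f \<in> L2 \<Longrightarrow> f \<in> borel_measurable lebesgue"
  and L2_integrable: "f \<in> L2 \<Longrightarrow> integrable lebesgue (\<lambda>x. (norm (f x))\<^sup>2)"
  by (simp_all add: L2_def)

lemma l2_norm_squared: "(l2_norm f)\<^sup>2 = (\<integral>x. (norm (f x))\<^sup>2 \<partial>lebesgue)"
  by (simp add: l2_norm_def)

lemma l2_norm_nonneg: "0 \<le> l2_norm f"
  by (simp add: l2_norm_def)

lemma nn_integral_L2:
  "f \<in> L2 \<Longrightarrow> (\<integral>\<^sup>+x. ennreal ((norm (f x))\<^sup>2) \<partial>lebesgue) = ennreal ((l2_norm f)\<^sup>2)"
  by (simp add: l2_norm_squared nn_integral_eq_integral L2_integrable)

lemma L2_mult_bounded: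
  assumes "f \<in> L2" "b \<in> borel_measurable lebesgue" "AE x in lebesgue. norm (b x) \<le> C"
  shows "(\<lambda>x. b x * f x) \<in> L2"
proof -
  have [measurable]: "f \<in> borel_measurable lebesgue" "b \<in> borel_measurable lebesgue"
    using assms L2_measurable by auto
  have "integrable lebesgue (\<lambda>x. C\<^sup>2 * (norm (f x))\<^sup>2)"
    using L2_integrable[OF assms(1)] by simp
  moreover have "AE x in lebesgue. norm ((norm (b x * f x))\<^sup>2) \<le> norm (C\<^sup>2 * (norm (f x))\<^sup>2)"
    using assms(3)
    by eventually_elim (auto simp: norm_mult power_mult_distrib intro!: mult_right_mono power_mono)
  ultimately have "integrable lebesgue (\<lambda>x. (norm (b x * f x))\<^sup>2)"
    using Bochner_Integration.integrable_bound[of lebesgue "\<lambda>x. C\<^sup>2 * (norm (f x))\<^sup>2" "\<lambda>x. (norm (b x * f x))\<^sup>2"]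
    by simp
  then show ?thesis by (simp add: L2_def)
qed

lemma L2_cmult: "f \<in> L2 \<Longrightarrow> (\<lambda>x. c * f x) \<in> L2"
  by (rule L2_mult_bounded[where C = "norm c"]) auto

lemma norm_add_squared_le: "(norm (a + b))\<^sup>2 \<le> 2 * (norm a)\<^sup>2 + 2 * (norm (b::complex))\<^sup>2"
proof -
  have "(norm (a + b))\<^sup>2 \<le> (norm a + norm b)\<^sup>2"
    by (simp add: norm_triangle_ineq power_mono)
  also have "\<dots> \<le> 2 * (norm a)\<^sup>2 + 2 * (norm b)\<^sup>2"
    using zero_le_power2[of "norm a - norm b"] unfolding power2_sum power2_diff by linarith
  finally show ?thesis .
qed

lemma L2_add:
  assumes "f \<in> L2" "g \<in> L2"
  shows "(\<lambda>x. f x + g x) \<in> L2"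
proof -
  have [measurable]: "f \<in> borel_measurable lebesgue" "g \<in> borel_measurable lebesgue"
    using assms L2_measurable by auto
  have "integrable lebesgue (\<lambda>x. 2 * (norm (f x))\<^sup>2 + 2 * (norm (g x))\<^sup>2)"
    using assms[THEN L2_integrable] by simp
  then have "integrable lebesgue (\<lambda>x. (norm (f x + g x))\<^sup>2)"
    by (rule Bochner_Integration.integrable_bound) (auto intro!: AE_I2 norm_add_squared_le)
  then show ?thesis by (simp add: L2_def)
qed

lemma L2_diff:
  assumes "f \<in> L2" "g \<in> L2"
  shows "(\<lambda>x. f x - g x) \<in> L2"
  using L2_add[OF assms(1) L2_cmult[OF assms(2), of "-1"]] by simp

lemma L2_zero: "(\<lambda>x. 0) \<in> L2"
  by (simp add: L2_def)

lemma L2_sum: "(\<And>i. i \<in> S \<Longrightarrow> g i \<in> L2) \<Longrightarrow> (\<lambda>x. \<Sum>i\<in>S. g i x) \<in> L2"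
  by (induction S rule: infinite_finite_induct) (auto intro: L2_add simp: L2_zero)

lemma integrable_L2_mult:
  assumes "f \<in> L2" "g \<in> L2"
  shows "integrable lebesgue (\<lambda>x. f x * cnj (g x))"
    and "integrable lebesgue (\<lambda>x. norm (f x) * norm (g x))"
proof -
  have [measurable]: "f \<in> borel_measurable lebesgue" "g \<in> borel_measurable lebesgue"
    using assms L2_measurable by auto
  have int: "integrable lebesgue (\<lambda>x. (norm (f x))\<^sup>2 + (norm (g x))\<^sup>2)"
    using assms[THEN L2_integrable] by simp
  have le: "norm (f x) * norm (g x) \<le> (norm (f x))\<^sup>2 + (norm (g x))\<^sup>2" for x
    using zero_le_power2[of "norm (f x) - norm (g x)"] unfolding power2_diff
    using zero_le_power2[of "norm (f x)"] zero_le_power2[of "norm (g x)"] by linarith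
  have cm: "(\<lambda>x. cnj (g x)) \<in> borel_measurable lebesgue"
    by (rule borel_measurable_continuous_on[OF continuous_on_cnj[OF continuous_on_id]]) measurable
  show "integrable lebesgue (\<lambda>x. f x * cnj (g x))"
    by (rule Bochner_Integration.integrable_bound[OF int]) (use le cm in \<open>auto simp: norm_mult\<close>)
  show "integrable lebesgue (\<lambda>x. norm (f x) * norm (g x))"
    by (rule Bochner_Integration.integrable_bound[OF int]) (use le in \<open>auto simp: norm_mult\<close>)
qed

lemma l2_inner_add:
  "f \<in> L2 \<Longrightarrow> f' \<in> L2 \<Longrightarrow> g \<in> L2 \<Longrightarrow>
     l2_inner (\<lambda>x. f x + f' x) g = l2_inner f g + l2_inner f' g"
  by (simp add: l2_inner_def integrable_L2_mult distrib_right)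

lemma l2_inner_diff:
  "f \<in> L2 \<Longrightarrow> f' \<in> L2 \<Longrightarrow> g \<in> L2 \<Longrightarrow>
     l2_inner (\<lambda>x. f x - f' x) g = l2_inner f g - l2_inner f' g"
  by (simp add: l2_inner_def integrable_L2_mult left_diff_distrib)

lemma l2_inner_cmult: "l2_inner (\<lambda>x. c * f x) g = c * l2_inner f g"
  by (simp add: l2_inner_def mult.assoc)

lemma l2_inner_cnj: "cnj (l2_inner f g) = l2_inner g f"
  by (simp add: l2_inner_def flip: Bochner_Integration.integral_cnj) (simp add: mult.commute)

lemma l2_inner_sum:
  assumes "\<And>i. i \<in> S \<Longrightarrow> h i \<in> L2" "g \<in> L2"
  shows "l2_inner (\<lambda>x. \<Sum>i\<in>S. h i x) g = (\<Sum>i\<in>S. l2_inner (h i) g)"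
  using assms
proof (induction S rule: infinite_finite_induct)
  case (insert i S)
  then show ?case by (simp add: l2_inner_add L2_sum)
qed (auto simp: l2_inner_def)

lemma l2_inner_diff_right:
  "f \<in> L2 \<Longrightarrow> g \<in> L2 \<Longrightarrow> g' \<in> L2 \<Longrightarrow>
     l2_inner f (\<lambda>x. g x - g' x) = l2_inner f g - l2_inner f g'"
  by (subst (1 2 3) l2_inner_cnj[symmetric]) (simp add: l2_inner_diff)

lemma l2_inner_self: "l2_inner f f = complex_of_real ((l2_norm f)\<^sup>2)"
proof -
  have "l2_inner f f = (\<integral>x. complex_of_real ((norm (f x))\<^sup>2) \<partial>lebesgue)"
    unfolding l2_inner_def complex_norm_square ..
  then show ?thesis unfolding l2_norm_squared by (simp only: integral_complex_of_real)
qed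

text \<open>The quadratic form \<open>\<integral> (s \<bar>f\<bar> - t \<bar>g\<bar>)\<^sup>2\<close> is nonnegative; taking \<open>s = \<parallel>g\<parallel>\<close> and
  \<open>t = \<parallel>f\<parallel>\<close> gives the bound, unless one of the norms is zero. In that case the form is
  affine in \<open>s\<close> or in \<open>t\<close>, and nonnegativity forces the mixed term to vanish.\<close>

lemma l2_cauchy_schwarz:
  assumes f: "f \<in> L2" and g: "g \<in> L2"
  shows "norm (l2_inner f g) \<le> l2_norm f * l2_norm g"
proof -
  have fg: "integrable lebesgue (\<lambda>x. norm (f x) * norm (g x))" by (rule integrable_L2_mult[OF f g])
  define I where "I = (\<integral>x. norm (f x) * norm (g x) \<partial>lebesgue)"
  have quad: "0 \<le> (l2_norm f)\<^sup>2 * s\<^sup>2 - 2 * s * I * t + (l2_norm g)\<^sup>2 * t\<^sup>2" for s t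
  proof -
    have "(l2_norm f)\<^sup>2 * s\<^sup>2 - 2 * s * I * t + (l2_norm g)\<^sup>2 * t\<^sup>2 =
       (\<integral>x. s\<^sup>2 * (norm (f x))\<^sup>2 - 2 * s * t * (norm (f x) * norm (g x)) + t\<^sup>2 * (norm (g x))\<^sup>2 \<partial>lebesgue)"
      using fg L2_integrable[OF f] L2_integrable[OF g]
      by (simp add: l2_norm_squared I_def mult_ac)
    also have "\<dots> = (\<integral>x. (s * norm (f x) - t * norm (g x))\<^sup>2 \<partial>lebesgue)"
      by (intro Bochner_Integration.integral_cong refl) (simp add: power2_eq_square algebra_simps)
    finally show ?thesis by simp
  qed
  have "I \<le> l2_norm f * l2_norm g"
  proof (cases "l2_norm f = 0 \<or> l2_norm g = 0")
    case True
    have "I \<le> 0"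
    proof (rule ccontr)
      assume "\<not> I \<le> 0"
      then have pos: "I > 0" by simp
      show False
      proof (cases "l2_norm f = 0")
        case True
        define s where "s = ((l2_norm g)\<^sup>2 + 1) / I"
        have "s * I = (l2_norm g)\<^sup>2 + 1" using pos by (simp add: s_def)
        then show False using quad[of s 1] True zero_le_power2[of "l2_norm g"] by simp
      next
        case False
        then have g0: "l2_norm g = 0" using True by simp
        define s where "s = ((l2_norm f)\<^sup>2 + 1) / I"
        have "I * s = (l2_norm f)\<^sup>2 + 1" using pos by (simp add: s_def)
        then show False using quad[of 1 s] g0 zero_le_power2[of "l2_norm f"] by simp
      qed
    qed
    then show ?thesis using True by auto
  next
    case False
    then have pos: "l2_norm f * l2_norm g > 0" using l2_norm_nonneg by (metis less_eq_real_def mult_pos_pos)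
    have "0 \<le> 2 * (l2_norm f * l2_norm g) * (l2_norm f * l2_norm g - I)"
      using quad[of "l2_norm g" "l2_norm f"] by (simp add: power2_eq_square algebra_simps)
    then show ?thesis using pos by (simp add: zero_le_mult_iff)
  qed
  moreover have "norm (l2_inner f g) \<le> I"
    unfolding l2_inner_def I_def
    by (rule order_trans[OF integral_norm_bound]) (simp add: norm_mult)
  ultimately show ?thesis by linarith
qed

lemma L2_fatou:
  fixes h :: "nat \<Rightarrow> real \<Rightarrow> complex"
  assumes h: "\<And>j. h j \<in> L2" and C: "\<And>j. (l2_norm (h j))\<^sup>2 \<le> C"
    and lim: "AE x in lebesgue. (\<lambda>j. h j x) \<longlonglongrightarrow> g x"
  shows "g \<in> L2" "(l2_norm g)\<^sup>2 \<le> C"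
proof -
  have [measurable]: "\<And>j. h j \<in> borel_measurable lebesgue" using h L2_measurable by blast
  have "(\<lambda>x. lim (\<lambda>j. h j x)) \<in> borel_measurable lebesgue" by measurable
  moreover have "AE x in lebesgue. lim (\<lambda>j. h j x) = g x"
    using lim by eventually_elim (rule limI)
  ultimately have g: "g \<in> borel_measurable lebesgue" by (rule borel_measurable_AE)
  have C0: "0 \<le> C" using C[of 0] zero_le_power2 order_trans by blast
  have "(\<integral>\<^sup>+x. ennreal ((norm (g x))\<^sup>2) \<partial>lebesgue) =
      (\<integral>\<^sup>+x. liminf (\<lambda>j. ennreal ((norm (h j x))\<^sup>2)) \<partial>lebesgue)"
  proof (rule nn_integral_cong_AE, use lim in eventually_elim)
    case (elim x)
    then have "(\<lambda>j. ennreal ((norm (h j x))\<^sup>2)) \<longlonglongrightarrow> ennreal ((norm (g x))\<^sup>2)"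
      by (intro tendsto_intros) auto
    then show ?case using lim_imp_Liminf by force
  qed
  also have "\<dots> \<le> liminf (\<lambda>j. \<integral>\<^sup>+x. ennreal ((norm (h j x))\<^sup>2) \<partial>lebesgue)"
    by (rule nn_integral_liminf) measurable
  also have "\<dots> \<le> liminf (\<lambda>j::nat. ennreal C)"
    using C by (intro Liminf_mono always_eventually) (auto simp: nn_integral_L2 h intro: ennreal_leI)
  also have "\<dots> = ennreal C" by (simp add: Liminf_const)
  finally have le: "(\<integral>\<^sup>+x. ennreal ((norm (g x))\<^sup>2) \<partial>lebesgue) \<le> ennreal C" .
  then show "g \<in> L2" using g by (auto simp: L2_iff_nn_integral intro: le_less_trans)
  then show "(l2_norm g)\<^sup>2 \<le> C" using le C0 by (simp add: nn_integral_L2)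
qed

text \<open>Bounded sequences of \<open>L\<^sup>2\<close> that converge almost everywhere converge weakly. Where
  \<open>\<bar>h\<^sub>j - g\<bar> \<le> R \<bar>\<phi>\<bar>\<close> the product \<open>\<bar>h\<^sub>j - g\<bar> \<bar>\<phi>\<bar>\<close> is dominated by
  \<open>R \<bar>\<phi>\<bar>\<^sup>2\<close>; elsewhere it is at most \<open>\<bar>h\<^sub>j - g\<bar>\<^sup>2 / R\<close>, whose integral is small when \<open>R\<close>
  is large.\<close>

lemma L2_weak_limit:
  fixes h :: "nat \<Rightarrow> real \<Rightarrow> complex"
  assumes h: "\<And>j. h j \<in> L2" and C: "\<And>j. (l2_norm (h j))\<^sup>2 \<le> C"
    and lim: "AE x in lebesgue. (\<lambda>j. h j x) \<longlonglongrightarrow> g x"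
    and \<phi>: "\<phi> \<in> L2"
  shows "(\<lambda>j. l2_inner (h j) \<phi>) \<longlonglongrightarrow> l2_inner g \<phi>"
proof -
  have g: "g \<in> L2" and gC: "(l2_norm g)\<^sup>2 \<le> C" using L2_fatou[OF h C lim] by auto
  define d where "d = (\<lambda>j x. h j x - g x)"
  have d: "d j \<in> L2" for j unfolding d_def by (intro L2_diff h g)
  have dC: "(l2_norm (d j))\<^sup>2 \<le> 4 * C" for j
  proof -
    have "(l2_norm (d j))\<^sup>2 \<le> (\<integral>x. 2 * (norm (h j x))\<^sup>2 + 2 * (norm (g x))\<^sup>2 \<partial>lebesgue)"
      unfolding l2_norm_squared using L2_integrable[OF d[of j]] L2_integrable[OF h[of j]] L2_integrable[OF g]
      by (intro integral_mono) (use norm_add_squared_le[of "h j _" "- g _"] in \<open>auto simp: d_def\<close>)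
    also have "\<dots> = 2 * (l2_norm (h j))\<^sup>2 + 2 * (l2_norm g)\<^sup>2"
      using L2_integrable[OF h[of j]] L2_integrable[OF g] by (simp add: l2_norm_squared)
    finally show ?thesis using C[of j] gC by simp
  qed
  have C0: "0 \<le> C" using C[of 0] zero_le_power2 order_trans by blast
  have [measurable]: "\<And>j. d j \<in> borel_measurable lebesgue" "\<phi> \<in> borel_measurable lebesgue"
    using d \<phi> L2_measurable by auto
  have cut: "(\<lambda>j. \<integral>x. min (norm (d j x) * norm (\<phi> x)) (R * (norm (\<phi> x))\<^sup>2) \<partial>lebesgue) \<longlonglongrightarrow> 0"
    if R: "R > 0" for R
  proof -
    have "(\<lambda>j. \<integral>x. min (norm (d j x) * norm (\<phi> x)) (R * (norm (\<phi> x))\<^sup>2) \<partial>lebesgue)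
       \<longlonglongrightarrow> (\<integral>x. 0 \<partial>(lebesgue :: real measure))"
    proof (rule integral_dominated_convergence[where M = lebesgue and f = "\<lambda>x. 0"
          and s = "\<lambda>j x. min (norm (d j x) * norm (\<phi> x)) (R * (norm (\<phi> x))\<^sup>2)"
          and w = "\<lambda>x. R * (norm (\<phi> x))\<^sup>2"])
      show "AE x in lebesgue. (\<lambda>j. min (norm (d j x) * norm (\<phi> x)) (R * (norm (\<phi> x))\<^sup>2)) \<longlonglongrightarrow> 0"
        using lim
      proof eventually_elim
        case (elim x)
        then have "(\<lambda>j. norm (d j x) * norm (\<phi> x)) \<longlonglongrightarrow> norm (g x - g x) * norm (\<phi> x)"
          unfolding d_def by (intro tendsto_intros)
        then have "(\<lambda>j. min (norm (d j x) * norm (\<phi> x)) (R * (norm (\<phi> x))\<^sup>2))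
          \<longlonglongrightarrow> min 0 (R * (norm (\<phi> x))\<^sup>2)"
          by (intro tendsto_min) auto
        then show ?case using R by (simp add: min_def)
      qed
      show "AE x in lebesgue. norm (min (norm (d j x) * norm (\<phi> x)) (R * (norm (\<phi> x))\<^sup>2))
         \<le> R * (norm (\<phi> x))\<^sup>2" for j
        using R by (auto simp: min_def)
    qed (use L2_integrable[OF \<phi>] in auto)
    then show ?thesis by simp
  qed
  have bound: "norm (l2_inner (d j) \<phi>) \<le>
     (\<integral>x. min (norm (d j x) * norm (\<phi> x)) (R * (norm (\<phi> x))\<^sup>2) \<partial>lebesgue) + 4 * C / R"
    if R: "R > 0" for R j
  proof -
    have le: "a * b \<le> min (a * b) (R * b\<^sup>2) + a\<^sup>2 / R" if "0 \<le> a" "0 \<le> b" for a b :: real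
    proof (cases "a \<le> R * b")
      case True
      then have "a * b \<le> R * b\<^sup>2" using that mult_right_mono[OF True that(2)] by (simp add: power2_eq_square)
      then show ?thesis using R by simp
    next
      case False
      then have "b \<le> a / R" using R by (simp add: field_simps)
      then have "a * b \<le> a\<^sup>2 / R" using that mult_left_mono[of b "a / R" a] by (simp add: power2_eq_square)
      moreover have "0 \<le> min (a * b) (R * b\<^sup>2)" using that R by simp
      ultimately show ?thesis by linarith
    qed
    have int: "integrable lebesgue (\<lambda>x. min (norm (d j x) * norm (\<phi> x)) (R * (norm (\<phi> x))\<^sup>2))"
      using integrable_L2_mult(2)[OF d \<phi>, of j] L2_integrable[OF \<phi>] by (intro integrable_min) auto
    have "norm (l2_inner (d j) \<phi>) \<le> (\<integral>x. norm (d j x) * norm (\<phi> x) \<partial>lebesgue)"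
      unfolding l2_inner_def by (rule order_trans[OF integral_norm_bound]) (simp add: norm_mult)
    also have "\<dots> \<le> (\<integral>x. min (norm (d j x) * norm (\<phi> x)) (R * (norm (\<phi> x))\<^sup>2)
        + (norm (d j x))\<^sup>2 / R \<partial>lebesgue)"
      using int L2_integrable[OF d[of j]] integrable_L2_mult(2)[OF d \<phi>, of j]
      by (intro integral_mono le) auto
    also have "\<dots> = (\<integral>x. min (norm (d j x) * norm (\<phi> x)) (R * (norm (\<phi> x))\<^sup>2) \<partial>lebesgue)
        + (l2_norm (d j))\<^sup>2 / R"
      using int L2_integrable[OF d[of j]] by (simp add: l2_norm_squared)
    also have "\<dots> \<le> (\<integral>x. min (norm (d j x) * norm (\<phi> x)) (R * (norm (\<phi> x))\<^sup>2) \<partial>lebesgue) + 4 * C / R"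
      using dC[of j] R by (simp add: divide_right_mono)
    finally show ?thesis .
  qed
  have "(\<lambda>j. l2_inner (d j) \<phi>) \<longlonglongrightarrow> 0"
  proof (rule LIMSEQ_I)
    fix e :: real assume e: "e > 0"
    \<comment> \<open>large enough to make the error term \<open>4 C / R\<close> smaller than \<open>e / 2\<close>\<close>
    define R where "R = 8 * C / e + 1"
    have R: "R > 0" using e C0 by (auto simp: R_def add_nonneg_pos)
    have "8 * C < e * R" using e by (simp add: R_def field_simps)
    then have "4 * C / R < e / 2" using R by (simp add: field_simps)
    moreover obtain N where "\<And>j. j \<ge> N \<Longrightarrow>
       norm (\<integral>x. min (norm (d j x) * norm (\<phi> x)) (R * (norm (\<phi> x))\<^sup>2) \<partial>lebesgue) < e / 2"
      using LIMSEQ_D[OF cut[OF R], of "e / 2"] e by auto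
    ultimately have "\<forall>j\<ge>N. norm (l2_inner (d j) \<phi> - 0) < e"
      using bound[OF R] by (smt (verit) real_norm_def diff_zero field_sum_of_halves)
    then show "\<exists>N. \<forall>j\<ge>N. norm (l2_inner (d j) \<phi> - 0) < e" by blast
  qed
  then have "(\<lambda>j. l2_inner (h j) \<phi> - l2_inner g \<phi>) \<longlonglongrightarrow> 0"
    by (simp add: d_def l2_inner_diff h g \<phi>)
  then show ?thesis by (simp add: LIM_zero_iff)
qed

section \<open>Weighted orthogonal families\<close>

text \<open>The members have squared norm \<open>1 / a\<^sub>n\<close>, so that \<open>a\<^sub>n\<close> is the weight in Bessel's inequality;
  for Clark kernels it is the mass of an atom.\<close>

definition orthogonal_family :: "('i \<Rightarrow> real) \<Rightarrow> ('i \<Rightarrow> real \<Rightarrow> complex) \<Rightarrow> bool" where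
  "orthogonal_family a e \<longleftrightarrow> (\<forall>n. 0 < a n \<and> e n \<in> L2) \<and>
     (\<forall>m n. l2_inner (e m) (e n) = (if m = n then 1 / complex_of_real (a n) else 0))"

definition partial_expansion ::
    "('i \<Rightarrow> real) \<Rightarrow> ('i \<Rightarrow> real \<Rightarrow> complex) \<Rightarrow> (real \<Rightarrow> complex) \<Rightarrow> 'i set \<Rightarrow> real \<Rightarrow> complex" where
  "partial_expansion a e f S x = (\<Sum>n\<in>S. complex_of_real (a n) * l2_inner f (e n) * e n x)"

lemma partial_expansion_L2: "orthogonal_family a e \<Longrightarrow> partial_expansion a e f S \<in> L2"
  unfolding partial_expansion_def[abs_def] by (intro L2_sum L2_cmult) (simp add: orthogonal_family_def)

lemma l2_inner_partial_expansion:
  assumes "orthogonal_family a e" "g \<in> L2"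
  shows "l2_inner (partial_expansion a e f S) g =
     (\<Sum>n\<in>S. complex_of_real (a n) * l2_inner f (e n) * l2_inner (e n) g)"
proof -
  have "l2_inner (partial_expansion a e f S) g =
      (\<Sum>n\<in>S. l2_inner (\<lambda>x. complex_of_real (a n) * l2_inner f (e n) * e n x) g)"
    unfolding partial_expansion_def[abs_def] using assms
    by (intro l2_inner_sum L2_cmult) (auto simp: orthogonal_family_def)
  then show ?thesis by (simp add: l2_inner_cmult)
qed

text \<open>Pythagoras: the partial expansion pairs with \<open>f\<close> and with itself to the same number.\<close>

lemma l2_norm_partial_expansion_and_rest:
  assumes e: "orthogonal_family a e" and f: "f \<in> L2" and S: "finite S"
  shows "(l2_norm (partial_expansion a e f S))\<^sup>2 = (\<Sum>n\<in>S. a n * (norm (l2_inner f (e n)))\<^sup>2)"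
    and "(l2_norm (\<lambda>x. f x - partial_expansion a e f S x))\<^sup>2 =
      (l2_norm f)\<^sup>2 - (\<Sum>n\<in>S. a n * (norm (l2_inner f (e n)))\<^sup>2)"
proof -
  let ?p = "partial_expansion a e f S"
  define T where "T = (\<Sum>n\<in>S. a n * (norm (l2_inner f (e n)))\<^sup>2)"
  have en: "e n \<in> L2" for n using e by (simp add: orthogonal_family_def)
  have p: "?p \<in> L2" by (rule partial_expansion_L2[OF e])
  have pf: "l2_inner ?p f = complex_of_real T"
  proof -
    have "l2_inner ?p f = (\<Sum>n\<in>S. complex_of_real (a n * (norm (l2_inner f (e n)))\<^sup>2))"
      unfolding l2_inner_partial_expansion[OF e f]
      by (intro sum.cong refl, subst (2) l2_inner_cnj[symmetric])
        (simp add: complex_norm_square mult_ac del: of_real_power)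
    then show ?thesis by (simp add: T_def)
  qed
  have pp: "l2_inner ?p ?p = complex_of_real T"
  proof -
    have "l2_inner (e n) ?p = cnj (l2_inner f (e n))" if n: "n \<in> S" for n
    proof -
      have "l2_inner ?p (e n) = (\<Sum>m\<in>S. if m = n then l2_inner f (e n) else 0)"
        unfolding l2_inner_partial_expansion[OF e en]
        using e by (intro sum.cong) (auto simp: orthogonal_family_def less_le)
      also have "\<dots> = l2_inner f (e n)" using S n by simp
      finally show ?thesis by (metis l2_inner_cnj)
    qed
    then have "l2_inner ?p ?p = (\<Sum>n\<in>S. complex_of_real (a n * (norm (l2_inner f (e n)))\<^sup>2))"
      unfolding l2_inner_partial_expansion[OF e p]
      by (intro sum.cong refl) (simp add: complex_norm_square mult_ac del: of_real_power)
    then show ?thesis by (simp add: T_def)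
  qed
  show "(l2_norm ?p)\<^sup>2 = (\<Sum>n\<in>S. a n * (norm (l2_inner f (e n)))\<^sup>2)"
    using pp unfolding l2_inner_self of_real_eq_iff T_def .
  have fp: "l2_inner f ?p = complex_of_real T"
    using pf by (metis l2_inner_cnj complex_cnj_complex_of_real)
  have "l2_inner (\<lambda>x. f x - ?p x) (\<lambda>x. f x - ?p x) =
      l2_inner f f - l2_inner f ?p - l2_inner ?p f + l2_inner ?p ?p"
    using f p by (simp add: l2_inner_diff l2_inner_diff_right L2_diff)
  also have "\<dots> = complex_of_real ((l2_norm f)\<^sup>2 - T)"
    by (simp add: pp pf fp l2_inner_self[of f])
  finally show "(l2_norm (\<lambda>x. f x - ?p x))\<^sup>2 = (l2_norm f)\<^sup>2 - (\<Sum>n\<in>S. a n * (norm (l2_inner f (e n)))\<^sup>2)"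
    unfolding l2_inner_self of_real_eq_iff T_def .
qed

lemma bessel:
  assumes "orthogonal_family a e" "f \<in> L2" "finite S"
  shows "(\<Sum>n\<in>S. a n * (norm (l2_inner f (e n)))\<^sup>2) \<le> (l2_norm f)\<^sup>2"
proof -
  have "0 \<le> (l2_norm (\<lambda>x. f x - partial_expansion a e f S x))\<^sup>2"
    by (rule zero_le_power2)
  also have "\<dots> = (l2_norm f)\<^sup>2 - (\<Sum>n\<in>S. a n * (norm (l2_inner f (e n)))\<^sup>2)"
    by (rule l2_norm_partial_expansion_and_rest(2)[OF assms])
  finally show ?thesis
    by (simp only: diff_ge_0_iff_ge)
qed

lemma bessel_summable:
  assumes e: "orthogonal_family a e" and "f \<in> L2"
  shows "(\<lambda>n. a n * (norm (l2_inner f (e n)))\<^sup>2) summable_on UNIV"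
    and "(\<Sum>\<^sub>\<infinity>n. a n * (norm (l2_inner f (e n)))\<^sup>2) \<le> (l2_norm f)\<^sup>2"
proof -
  have nonneg: "0 \<le> a n * (norm (l2_inner f (e n)))\<^sup>2" for n
    using e by (simp add: orthogonal_family_def less_imp_le)
  show *: "(\<lambda>n. a n * (norm (l2_inner f (e n)))\<^sup>2) summable_on UNIV"
    using bessel[OF assms] nonneg
    by (intro nonneg_bdd_above_summable_on bdd_aboveI[where M = "(l2_norm f)\<^sup>2"]) auto
  show "(\<Sum>\<^sub>\<infinity>n. a n * (norm (l2_inner f (e n)))\<^sup>2) \<le> (l2_norm f)\<^sup>2"
    using bessel[OF assms] * by (intro infsum_le_finite_sums) auto
qed

text \<open>If Parseval's identity holds for \<open>g\<close>, then \<open>g\<close> is the sum of its expansion, and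
  pairing with any \<open>f\<close> may be carried out term by term.\<close>

lemma parseval_imp_inner_expansion:
  assumes e: "orthogonal_family a e" and f: "f \<in> L2" and g: "g \<in> L2"
    and parseval: "((\<lambda>n. a n * (norm (l2_inner g (e n)))\<^sup>2) has_sum (l2_norm g)\<^sup>2) UNIV"
  shows "((\<lambda>n. complex_of_real (a n) * l2_inner f (e n) * l2_inner (e n) g) has_sum l2_inner f g) UNIV"
proof -
  let ?T = "\<lambda>S. \<Sum>n\<in>S. a n * (norm (l2_inner g (e n)))\<^sup>2"
  have eq: "l2_inner f g - (\<Sum>n\<in>S. complex_of_real (a n) * l2_inner f (e n) * l2_inner (e n) g) =
      l2_inner f (\<lambda>x. g x - partial_expansion a e g S x)" for S
  proof -
    have "l2_inner f (partial_expansion a e g S) =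
        (\<Sum>n\<in>S. complex_of_real (a n) * l2_inner f (e n) * l2_inner (e n) g)"
      by (subst l2_inner_cnj[symmetric], subst l2_inner_partial_expansion[OF e f])
        (simp add: l2_inner_cnj mult_ac)
    then show ?thesis by (simp add: l2_inner_diff_right f g partial_expansion_L2[OF e])
  qed
  have "((\<lambda>S. l2_norm f * sqrt ((l2_norm g)\<^sup>2 - ?T S)) \<longlongrightarrow>
      l2_norm f * sqrt ((l2_norm g)\<^sup>2 - (l2_norm g)\<^sup>2)) (finite_subsets_at_top UNIV)"
    using parseval unfolding has_sum_def by (intro tendsto_intros)
  then have lim0: "((\<lambda>S. l2_norm f * sqrt ((l2_norm g)\<^sup>2 - ?T S)) \<longlongrightarrow> 0) (finite_subsets_at_top UNIV)"
    by simp
  have "((\<lambda>S. l2_inner f g - (\<Sum>n\<in>S. complex_of_real (a n) * l2_inner f (e n) * l2_inner (e n) g))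
      \<longlongrightarrow> 0) (finite_subsets_at_top UNIV)"
  proof (rule Lim_null_comparison[OF _ lim0])
    show "\<forall>\<^sub>F S in finite_subsets_at_top UNIV.
       norm (l2_inner f g - (\<Sum>n\<in>S. complex_of_real (a n) * l2_inner f (e n) * l2_inner (e n) g))
         \<le> l2_norm f * sqrt ((l2_norm g)\<^sup>2 - ?T S)"
    proof (rule eventually_mono[of finite])
      show "\<forall>\<^sub>F S in finite_subsets_at_top UNIV. finite S"
        by (rule eventually_finite_subsets_at_top_weakI) simp
    next
      fix S :: "'a set" assume S: "finite S"
      have "norm (l2_inner f (\<lambda>x. g x - partial_expansion a e g S x)) \<le>
          l2_norm f * l2_norm (\<lambda>x. g x - partial_expansion a e g S x)"
        by (intro l2_cauchy_schwarz f L2_diff g partial_expansion_L2[OF e])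
      also have "l2_norm (\<lambda>x. g x - partial_expansion a e g S x) = sqrt ((l2_norm g)\<^sup>2 - ?T S)"
        using l2_norm_partial_expansion_and_rest(2)[OF e g S] l2_norm_nonneg
        by (metis real_sqrt_unique)
      finally show "norm (l2_inner f g - (\<Sum>n\<in>S. complex_of_real (a n) * l2_inner f (e n) * l2_inner (e n) g))
         \<le> l2_norm f * sqrt ((l2_norm g)\<^sup>2 - ?T S)"
        unfolding eq .
    qed
  qed
  then have "((\<lambda>S. l2_inner f g - (l2_inner f g -
      (\<Sum>n\<in>S. complex_of_real (a n) * l2_inner f (e n) * l2_inner (e n) g))) \<longlongrightarrow> l2_inner f g - 0)
      (finite_subsets_at_top UNIV)"
    by (intro tendsto_intros)
  then show ?thesis by (simp add: has_sum_def)
qed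

section \<open>The Poisson kernel\<close>

lemma inverse_quadratic_integral:
  fixes a b :: real
  assumes b: "b > 0"
  shows "integrable lebesgue (\<lambda>x. 1 / ((x - a)\<^sup>2 + b\<^sup>2))"
    and "(\<integral>x. 1 / ((x - a)\<^sup>2 + b\<^sup>2) \<partial>lebesgue) = pi / b"
proof -
  have int1: "integrable lebesgue (\<lambda>x::real. inverse (1 + x\<^sup>2))"
    using integrable_inverse_1_plus_square by (simp add: set_integrable_def integrable_completion)
  have val1: "(\<integral>x. inverse (1 + (x::real)\<^sup>2) \<partial>lebesgue) = pi"
    using LBINT_inverse_1_plus_square
    by (simp add: interval_lebesgue_integral_def set_lebesgue_integral_def integral_completion)
  have eq: "1 / ((x - a)\<^sup>2 + b\<^sup>2) = (1 / b\<^sup>2) * inverse (1 + (- a / b + (1 / b) * x)\<^sup>2)" for x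
  proof -
    have "(- a / b + (1 / b) * x)\<^sup>2 = (x - a)\<^sup>2 / b\<^sup>2"
      by (simp add: diff_divide_distrib power_divide[symmetric])
    then show ?thesis using b by (simp add: field_simps)
  qed
  have hb: "has_bochner_integral lebesgue (\<lambda>x. inverse (1 + (- a / b + (1 / b) * x)\<^sup>2)) (pi /\<^sub>R \<bar>1 / b\<bar>)"
    using int1 val1 b
    by (subst has_bochner_integral_lebesgue_real_affine_iff[symmetric]) (auto simp: has_bochner_integral_iff)
  show "integrable lebesgue (\<lambda>x. 1 / ((x - a)\<^sup>2 + b\<^sup>2))"
    unfolding eq using hb by (simp add: has_bochner_integral_iff)
  show "(\<integral>x. 1 / ((x - a)\<^sup>2 + b\<^sup>2) \<partial>lebesgue) = pi / b"
    unfolding eq using hb b by (simp add: has_bochner_integral_iff power2_eq_square)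
qed

definition poisson_kernel :: "complex \<Rightarrow> real \<Rightarrow> real" where
  "poisson_kernel z t = Im z / (pi * ((t - Re z)\<^sup>2 + (Im z)\<^sup>2))"

lemma norm_real_minus_squared: "(norm (complex_of_real t - z))\<^sup>2 = (t - Re z)\<^sup>2 + (Im z)\<^sup>2"
  by (simp add: cmod_power2)

lemma Im_le_norm_real_minus: "\<bar>Im z\<bar> \<le> norm (complex_of_real t - z)"
  using abs_Im_le_cmod[of "complex_of_real t - z"] by simp

lemma poisson_kernel_pos: "Im z > 0 \<Longrightarrow> 0 < poisson_kernel z t"
  by (simp add: poisson_kernel_def add_nonneg_pos)

lemma poisson_kernel_integral:
  assumes "Im z > 0"
  shows "integrable lebesgue (poisson_kernel z)" "(\<integral>t. poisson_kernel z t \<partial>lebesgue) = 1"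
proof -
  have eq: "poisson_kernel z = (\<lambda>t. Im z / pi * (1 / ((t - Re z)\<^sup>2 + (Im z)\<^sup>2)))"
    by (simp add: poisson_kernel_def fun_eq_iff)
  show "integrable lebesgue (poisson_kernel z)" "(\<integral>t. poisson_kernel z t \<partial>lebesgue) = 1"
    unfolding eq using inverse_quadratic_integral[OF assms, of "Re z"] assms
    by (simp_all only: integrable_mult_right integral_mult_right_zero) simp
qed

lemma poisson_kernel_le: assumes "Im z > 0" shows "poisson_kernel z t \<le> 1 / (pi * Im z)"
proof -
  have "poisson_kernel z t \<le> Im z / (pi * (Im z)\<^sup>2)"
    unfolding poisson_kernel_def using assms
    by (intro divide_left_mono mult_left_mono mult_pos_pos add_nonneg_pos) auto
  then show ?thesis using assms by (simp add: power2_eq_square)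
qed

lemma poisson_kernel_measurable [measurable]: "poisson_kernel z \<in> borel_measurable borel"
  unfolding poisson_kernel_def[abs_def] by measurable

lemma poisson_kernel_L2:
  assumes z: "Im z > 0"
  shows "(\<lambda>t. complex_of_real (poisson_kernel z t)) \<in> L2"
proof -
  have [measurable]: "poisson_kernel z \<in> borel_measurable lebesgue"
    using poisson_kernel_measurable by (rule measurable_completion[of _ lborel borel, simplified])
  have "integrable lebesgue (\<lambda>t. (poisson_kernel z t)\<^sup>2)"
  proof (rule Bochner_Integration.integrable_bound)
    show "integrable lebesgue (\<lambda>t. 1 / (pi * Im z) * poisson_kernel z t)"
      using poisson_kernel_integral[OF z] by simp
    show "AE t in lebesgue. norm ((poisson_kernel z t)\<^sup>2) \<le> norm (1 / (pi * Im z) * poisson_kernel z t)"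
    proof (rule AE_I2)
      fix t
      have "poisson_kernel z t * poisson_kernel z t \<le> 1 / (pi * Im z) * poisson_kernel z t"
        using poisson_kernel_le[OF z] poisson_kernel_pos[OF z] by (intro mult_right_mono) (auto intro: less_imp_le)
      then show "norm ((poisson_kernel z t)\<^sup>2) \<le> norm (1 / (pi * Im z) * poisson_kernel z t)"
        unfolding power2_eq_square real_norm_def by (smt (verit) mult_nonneg_nonneg poisson_kernel_pos[OF z])
    qed
  qed simp
  then show ?thesis by (simp add: L2_def)
qed

text \<open>The Poisson integral is an average against a probability density, so Jensen's inequality
  bounds the square of its modulus by the Poisson integral of \<open>\<bar>h\<bar>\<^sup>2\<close>. Integrating along a
  horizontal line with Tonelli's theorem uses that the kernel has mass one in the other variable
  as well.\<close>

lemma poisson_contraction: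
  assumes h: "h \<in> L2" and y: "y > 0"
  shows "(\<integral>\<^sup>+x. ennreal ((norm (l2_inner h (\<lambda>t. complex_of_real (poisson_kernel (Complex x y) t))))\<^sup>2) \<partial>lebesgue)
     \<le> ennreal ((l2_norm h)\<^sup>2)"
proof -
  let ?p = "\<lambda>x t. poisson_kernel (Complex x y) t"
  let ?I = "\<lambda>x. l2_inner h (\<lambda>t. complex_of_real (?p x t))"
  have [measurable]: "h \<in> borel_measurable lebesgue" using h L2_measurable by blast
  obtain q where q[measurable]: "q \<in> borel_measurable lborel"
    and hq: "AE t in lborel. (norm (h t))\<^sup>2 = q t"
    using completion_ex_borel_measurable_real[of "\<lambda>t. (norm (h t))\<^sup>2" lborel] by auto
  have jensen: "ennreal ((norm (?I x))\<^sup>2) \<le> (\<integral>\<^sup>+t. ennreal (?p x t) * ennreal (q t) \<partial>lborel)" for x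
  proof -
    have Im: "Im (Complex x y) > 0" using y by simp
    have pm [measurable]: "?p x \<in> borel_measurable lebesgue"
      using poisson_kernel_measurable by (rule measurable_completion[of _ lborel borel, simplified])
    have pos: "0 < ?p x t" for t by (rule poisson_kernel_pos[OF Im])
    have i1: "integrable lebesgue (\<lambda>t. norm (h t) * ?p x t)"
      using integrable_L2_mult(2)[OF h poisson_kernel_L2[OF Im]] pos by (simp add: less_imp_le)
    have i2: "integrable lebesgue (\<lambda>t. (norm (h t))\<^sup>2 * ?p x t)"
    proof (rule Bochner_Integration.integrable_bound)
      show "integrable lebesgue (\<lambda>t. (norm (h t))\<^sup>2 * (1 / (pi * y)))"
        using L2_integrable[OF h] by simp
      show "AE t in lebesgue. norm ((norm (h t))\<^sup>2 * ?p x t) \<le> norm ((norm (h t))\<^sup>2 * (1 / (pi * y)))"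
        using poisson_kernel_le[OF Im] pos y
        by (intro AE_I2) (auto simp: abs_mult less_imp_le simp del: times_divide_eq_right intro!: mult_left_mono)
    qed simp
    define m where "m = (\<integral>t. norm (h t) * ?p x t \<partial>lebesgue)"
    have "0 \<le> (\<integral>t. (norm (h t) - m)\<^sup>2 * ?p x t \<partial>lebesgue)"
      using pos by (intro integral_nonneg_AE) (auto simp: less_imp_le)
    also have "\<dots> = (\<integral>t. (norm (h t))\<^sup>2 * ?p x t - 2 * m * (norm (h t) * ?p x t) + m\<^sup>2 * ?p x t \<partial>lebesgue)"
      by (simp add: power2_diff algebra_simps)
    also have "\<dots> = (\<integral>t. (norm (h t))\<^sup>2 * ?p x t \<partial>lebesgue) - m\<^sup>2"
      using i1 i2 poisson_kernel_integral[OF Im] by (simp add: m_def power2_eq_square)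
    finally have "m\<^sup>2 \<le> (\<integral>t. (norm (h t))\<^sup>2 * ?p x t \<partial>lebesgue)" by simp
    moreover have "norm (?I x) \<le> m"
      unfolding l2_inner_def m_def
      by (rule order_trans[OF integral_norm_bound]) (use pos in \<open>simp add: norm_mult less_imp_le\<close>)
    ultimately have "(norm (?I x))\<^sup>2 \<le> (\<integral>t. (norm (h t))\<^sup>2 * ?p x t \<partial>lebesgue)"
      by (meson norm_ge_zero order_trans power_mono)
    then have "ennreal ((norm (?I x))\<^sup>2) \<le> ennreal (\<integral>t. (norm (h t))\<^sup>2 * ?p x t \<partial>lebesgue)"
      by (rule ennreal_leI)
    also have "\<dots> = (\<integral>\<^sup>+t. ennreal ((norm (h t))\<^sup>2 * ?p x t) \<partial>lebesgue)"
      using i2 pos by (intro nn_integral_eq_integral[symmetric]) (auto simp: less_imp_le)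
    also have "\<dots> = (\<integral>\<^sup>+t. ennreal ((norm (h t))\<^sup>2 * ?p x t) \<partial>lborel)"
      by (rule nn_integral_completion)
    also have "\<dots> = (\<integral>\<^sup>+t. ennreal (?p x t) * ennreal (q t) \<partial>lborel)"
    proof (rule nn_integral_cong_AE, use hq in eventually_elim)
      case (elim t)
      have "ennreal (?p x t) * ennreal (q t) = ennreal (?p x t * q t)"
        using pos[of t] by (intro ennreal_mult'[symmetric]) simp
      then show ?case by (simp add: elim[symmetric] mult.commute)
    qed
    finally show ?thesis .
  qed
  have swap: "?p x t = poisson_kernel (Complex t y) x" for x t
    by (simp add: poisson_kernel_def power2_commute)
  have pm2 [measurable]: "(\<lambda>(x, t). ?p x t) \<in> borel_measurable (lborel \<Otimes>\<^sub>M lborel)"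
    unfolding poisson_kernel_def complex.sel by measurable
  have mass: "(\<integral>\<^sup>+x. ennreal (?p x t) \<partial>lborel) = 1" for t
  proof -
    have "(\<integral>\<^sup>+x. ennreal (?p x t) \<partial>lborel) = (\<integral>\<^sup>+x. ennreal (poisson_kernel (Complex t y) x) \<partial>lebesgue)"
      unfolding nn_integral_completion by (intro nn_integral_cong arg_cong[where f = ennreal], rule swap)
    also have "\<dots> = 1"
      using poisson_kernel_integral[of "Complex t y"] poisson_kernel_pos[of "Complex t y"] y
      by (subst nn_integral_eq_integral) (auto simp: less_imp_le)
    finally show ?thesis .
  qed
  have "(\<integral>\<^sup>+x. ennreal ((norm (?I x))\<^sup>2) \<partial>lebesgue) = (\<integral>\<^sup>+x. ennreal ((norm (?I x))\<^sup>2) \<partial>lborel)"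
    by (rule nn_integral_completion)
  also have "\<dots> \<le> (\<integral>\<^sup>+x. \<integral>\<^sup>+t. ennreal (?p x t) * ennreal (q t) \<partial>lborel \<partial>lborel)"
    by (intro nn_integral_mono jensen)
  also have "\<dots> = (\<integral>\<^sup>+t. \<integral>\<^sup>+x. ennreal (?p x t) * ennreal (q t) \<partial>lborel \<partial>lborel)"
    using pm2 by (intro lborel_pair.Fubini') measurable
  also have "\<dots> = (\<integral>\<^sup>+t. ennreal (q t) \<partial>lborel)"
  proof (rule nn_integral_cong)
    fix t
    have "(\<lambda>x. ?p x t) = poisson_kernel (Complex t y)" by (rule ext, rule swap)
    then have [measurable]: "(\<lambda>x. ?p x t) \<in> borel_measurable lborel"
      by (simp add: poisson_kernel_measurable)
    show "(\<integral>\<^sup>+x. ennreal (?p x t) * ennreal (q t) \<partial>lborel) = ennreal (q t)"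
      by (subst nn_integral_multc) (simp_all add: mass)
  qed
  also have "\<dots> = (\<integral>\<^sup>+t. ennreal ((norm (h t))\<^sup>2) \<partial>lborel)"
    by (rule nn_integral_cong_AE, use hq in eventually_elim) simp
  also have "\<dots> = (\<integral>\<^sup>+t. ennreal ((norm (h t))\<^sup>2) \<partial>lebesgue)"
    by (rule nn_integral_completion[symmetric])
  also have "\<dots> = ennreal ((l2_norm h)\<^sup>2)" by (rule nn_integral_L2[OF h])
  finally show ?thesis .
qed

lemma l2_inner_cmult_right: "l2_inner f (\<lambda>x. c * g x) = cnj c * l2_inner f g"
  by (subst (1 2) l2_inner_cnj[symmetric]) (simp add: l2_inner_cmult)

section \<open>Non-tangential limits\<close>

lemma uhp_open: "open upper_half_plane"
  and uhp_convex: "convex upper_half_plane"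
  by (auto simp: upper_half_plane_def open_halfspace_Im_gt convex_halfspace_Im_gt)

lemma uhp_iff [simp]: "z \<in> upper_half_plane \<longleftrightarrow> 0 < Im z"
  by (simp add: upper_half_plane_def)

text \<open>Sequences that approach a real point within one Stolz angle. Non-tangential limits are handled
  through them because dominated convergence and weak limits are statements about sequences.\<close>

definition cone_sequence :: "real \<Rightarrow> real \<Rightarrow> (nat \<Rightarrow> complex) \<Rightarrow> bool" where
  "cone_sequence \<kappa> x z \<longleftrightarrow> 0 < \<kappa> \<and> (\<forall>j. 0 < Im (z j) \<and> \<bar>Re (z j) - x\<bar> \<le> \<kappa> * Im (z j)) \<and>
     z \<longlonglongrightarrow> complex_of_real x"

lemma nt_limit_cone_sequence:
  assumes "nt_limit F x l" "cone_sequence \<kappa> x z"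
  shows "(\<lambda>j. F (z j)) \<longlonglongrightarrow> l"
proof -
  let ?S = "{z \<in> upper_half_plane. \<bar>Re z - x\<bar> \<le> \<kappa> * Im z}"
  have "(F \<longlongrightarrow> l) (at (complex_of_real x) within ?S)"
    using assms by (simp add: nt_limit_def cone_sequence_def)
  moreover have "filterlim z (at (complex_of_real x) within ?S) sequentially"
    using assms(2) unfolding filterlim_at cone_sequence_def
    by (intro conjI always_eventually allI) (auto, metis Im_complex_of_real less_irrefl)
  ultimately show ?thesis by (rule filterlim_compose)
qed

lemma nt_limitI:
  assumes "\<And>\<kappa> z. cone_sequence \<kappa> x z \<Longrightarrow> (\<lambda>j. F (z j)) \<longlonglongrightarrow> l"
  shows "nt_limit F x l"
  unfolding nt_limit_def tendsto_at_iff_sequentially o_def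
  using assms by (auto simp: cone_sequence_def)

lemma vertical_cone_sequence:
  "cone_sequence 1 x (\<lambda>j. Complex x (inverse (real (Suc j))))"
proof -
  have "(\<lambda>j. Complex x (inverse (real (Suc j)))) \<longlonglongrightarrow> Complex x 0"
    by (intro tendsto_Complex tendsto_const LIMSEQ_inverse_real_of_nat)
  then show ?thesis by (simp add: cone_sequence_def complex_of_real_def)
qed

lemma nt_limit_unique: "nt_limit F x l \<Longrightarrow> nt_limit F x l' \<Longrightarrow> l = l'"
  by (rule LIMSEQ_unique[of "\<lambda>j. F (Complex x (inverse (real (Suc j))))"])
    (erule nt_limit_cone_sequence[OF _ vertical_cone_sequence])+

lemma hp_ext_uhp [simp]: "0 < Im z \<Longrightarrow> hp_ext F z = F z"
  by (simp add: hp_ext_def)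

lemma hp_ext_of_real: "nt_limit F x l \<Longrightarrow> hp_ext F (complex_of_real x) = l"
  by (simp add: hp_ext_def) (rule the_equality, assumption, erule nt_limit_unique)

lemma nt_limit_cong:
  assumes "nt_limit F x l" "\<And>z. 0 < Im z \<Longrightarrow> F z = G z"
  shows "nt_limit G x l"
  using nt_limit_cone_sequence[OF assms(1)] assms(2)
  by (intro nt_limitI) (auto simp: cone_sequence_def)

lemma nt_limit_continuous: "isCont F (complex_of_real x) \<Longrightarrow> nt_limit F x (F (complex_of_real x))"
  by (rule nt_limitI, rule isCont_tendsto_compose) (auto simp: cone_sequence_def)

lemma nt_limit_mult:
  assumes "nt_limit F x l" "nt_limit G x m"
  shows "nt_limit (\<lambda>z. F z * G z) x (l * m)"
  by (intro nt_limitI tendsto_mult) (auto intro: nt_limit_cone_sequence assms)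

lemma nt_limit_diff:
  assumes "nt_limit F x l" "nt_limit G x m"
  shows "nt_limit (\<lambda>z. F z - G z) x (l - m)"
  by (intro nt_limitI tendsto_diff) (auto intro: nt_limit_cone_sequence assms)

text \<open>Almost everywhere the boundary function is the limit of the continuous functions on the
  horizontal lines at height \<open>1 / (j + 1)\<close>.\<close>

lemma nt_limit_boundary_measurable:
  assumes "F holomorphic_on upper_half_plane" "AE x in lebesgue. nt_limit F x (f x)"
  shows "f \<in> borel_measurable lebesgue"
proof -
  let ?s = "\<lambda>j x. F (Complex x (inverse (real (Suc j))))"
  have cont: "continuous_on UNIV (?s j)" for j
    by (intro continuous_on_compose2[OF holomorphic_on_imp_continuous_on[OF assms(1)]]
        continuous_intros) auto
  have [measurable]: "?s j \<in> borel_measurable lebesgue" for j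
    using borel_measurable_continuous_onI[OF cont[of j]]
    by (rule measurable_completion[of _ lborel borel, simplified])
  have "(\<lambda>x. lim (\<lambda>j. ?s j x)) \<in> borel_measurable lebesgue" by measurable
  moreover have "AE x in lebesgue. lim (\<lambda>j. ?s j x) = f x"
    using assms(2) by eventually_elim (intro limI nt_limit_cone_sequence[OF _ vertical_cone_sequence])
  ultimately show ?thesis by (rule borel_measurable_AE)
qed

section \<open>Cauchy's formula in the Hardy space\<close>

lemma continuous_imp_lebesgue_measurable:
  fixes f :: "real \<Rightarrow> complex"
  shows "continuous_on UNIV f \<Longrightarrow> f \<in> borel_measurable lebesgue"
  by (rule measurable_completion[of _ lborel borel, simplified]) (rule borel_measurable_continuous_onI)

definition cauchy_kernel :: "complex \<Rightarrow> real \<Rightarrow> complex" where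
  "cauchy_kernel \<zeta> t = 1 / (complex_of_real t - \<zeta>)"

lemma real_minus_nonzero: "Im \<zeta> \<noteq> 0 \<Longrightarrow> complex_of_real t - \<zeta> \<noteq> 0"
  by (auto simp: complex_eq_iff)

lemma cauchy_kernel_L2:
  assumes "Im \<zeta> \<noteq> 0"
  shows "cauchy_kernel \<zeta> \<in> L2" "(l2_norm (cauchy_kernel \<zeta>))\<^sup>2 = pi / \<bar>Im \<zeta>\<bar>"
proof -
  have eq: "(norm (cauchy_kernel \<zeta> t))\<^sup>2 = 1 / ((t - Re \<zeta>)\<^sup>2 + \<bar>Im \<zeta>\<bar>\<^sup>2)" for t
    by (simp add: cauchy_kernel_def norm_divide power_divide norm_real_minus_squared)
  have "continuous_on UNIV (cauchy_kernel \<zeta>)"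
    unfolding cauchy_kernel_def[abs_def] using assms by (intro continuous_intros) (auto simp: complex_eq_iff)
  then show "cauchy_kernel \<zeta> \<in> L2"
    using inverse_quadratic_integral[of "\<bar>Im \<zeta>\<bar>" "Re \<zeta>"] assms
    by (simp only: L2_def mem_Collect_eq eq) (auto intro: continuous_imp_lebesgue_measurable)
  show "(l2_norm (cauchy_kernel \<zeta>))\<^sup>2 = pi / \<bar>Im \<zeta>\<bar>"
    unfolding l2_norm_squared eq using inverse_quadratic_integral[of "\<bar>Im \<zeta>\<bar>" "Re \<zeta>"] assms by simp
qed

lemma hardy_slices:
  assumes "F \<in> hardy_analytic"
  obtains M where "0 \<le> M" "\<And>y. 0 < y \<Longrightarrow> (\<lambda>x. F (Complex x y)) \<in> L2"
    "\<And>y. 0 < y \<Longrightarrow> (l2_norm (\<lambda>x. F (Complex x y)))\<^sup>2 \<le> M"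
proof -
  let ?I = "\<lambda>y. \<integral>\<^sup>+x. ennreal ((norm (F (Complex x y)))\<^sup>2) \<partial>lebesgue"
  define s where "s = (SUP y\<in>{0<..}. ?I y)"
  have s: "s < \<infinity>" and hol: "F holomorphic_on upper_half_plane"
    using assms by (auto simp: hardy_analytic_def s_def)
  have le: "?I y \<le> s" if "0 < y" for y unfolding s_def using that by (intro SUP_upper) auto
  have meas: "(\<lambda>x. F (Complex x y)) \<in> borel_measurable lebesgue" if "0 < y" for y
    using that by (intro continuous_imp_lebesgue_measurable
        continuous_on_compose2[OF holomorphic_on_imp_continuous_on[OF hol]] continuous_intros) auto
  have L2: "(\<lambda>x. F (Complex x y)) \<in> L2" if "0 < y" for y
    unfolding L2_iff_nn_integral using meas[OF that] le_less_trans[OF le[OF that] s] by simp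
  have "ennreal ((l2_norm (\<lambda>x. F (Complex x y)))\<^sup>2) \<le> ennreal (enn2real s)" if "0 < y" for y
    using le[OF that] s nn_integral_L2[OF L2[OF that]] by (simp add: less_top)
  then have "(l2_norm (\<lambda>x. F (Complex x y)))\<^sup>2 \<le> enn2real s" if "0 < y" for y
    using that by (simp add: ennreal_le_iff)
  then show thesis using L2 by (intro that[of "enn2real s"]) auto
qed

lemma has_contour_integral_horizontal:
  assumes "a < b"
  shows "(f has_contour_integral I) (linepath (Complex a y) (Complex b y)) \<longleftrightarrow>
     ((\<lambda>x. f (Complex x y)) has_integral I) {a..b}"
proof -
  have eq: "linepath (Complex a y) (Complex b y) =
      ((+) (\<i> * complex_of_real y)) \<circ> linepath (complex_of_real a) (complex_of_real b)"
    by (simp add: linepath_def fun_eq_iff complex_eq_iff algebra_simps)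
  have fe: "f (complex_of_real x + \<i> * complex_of_real y) = f (Complex x y)" for x
    by (simp add: Complex_eq)
  show ?thesis
    unfolding eq has_contour_integral_translate
    by (subst has_contour_integral_linepath_Reals_iff) (use assms in \<open>auto simp: fe o_def\<close>)
qed

text \<open>The value \<open>v\<close> covers both uses of the rectangle: a pole below it, where Cauchy's theorem
  applies, and a pole inside it, where Cauchy's integral formula does.\<close>

lemma rectangle_identity:
  assumes F: "F holomorphic_on upper_half_plane" and y: "0 < y1" "y1 < y2"
    and T: "\<bar>Re \<zeta>\<bar> < T" and \<zeta>: "Im \<zeta> < y1 \<and> v = 0 \<or> y1 < Im \<zeta> \<and> Im \<zeta> < y2 \<and> v = F \<zeta>"
  shows "integral {-T..T} (\<lambda>x. F (Complex x y1) / (Complex x y1 - \<zeta>))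
       - integral {-T..T} (\<lambda>x. F (Complex x y2) / (Complex x y2 - \<zeta>))
       + \<i> * (integral {y1..y2} (\<lambda>y. F (Complex T y) / (Complex T y - \<zeta>))
            - integral {y1..y2} (\<lambda>y. F (Complex (-T) y) / (Complex (-T) y - \<zeta>))) = 2 * pi * \<i> * v"
proof -
  let ?f = "\<lambda>w. F w / (w - \<zeta>)"
  let ?a1 = "Complex (-T) y1" and ?a2 = "Complex T y1" and ?a3 = "Complex T y2" and ?a4 = "Complex (-T) y2"
  have T0: "0 < T" using T by linarith
  have img: "path_image (rectpath ?a1 ?a3) =
     {z. Re z \<in> {-T, T} \<and> Im z \<in> {y1..y2}} \<union> {z. Im z \<in> {y1, y2} \<and> Re z \<in> {-T..T}}"
    using y T0 by (subst path_image_rectpath) auto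
  have off: "w \<noteq> \<zeta>" if "w \<in> path_image (rectpath ?a1 ?a3)" for w
    using that T \<zeta> y unfolding img by auto
  have pos: "0 < Im w" if "w \<in> path_image (rectpath ?a1 ?a3)" for w
    using that y unfolding img by auto
  have cont: "continuous_on (path_image (rectpath ?a1 ?a3)) ?f"
    using off pos by (intro continuous_intros continuous_on_subset[OF holomorphic_on_imp_continuous_on[OF F]]) auto
  have rp: "rectpath ?a1 ?a3 = linepath ?a1 ?a2 +++ linepath ?a2 ?a3 +++ linepath ?a3 ?a4 +++ linepath ?a4 ?a1"
    by (simp add: rectpath_def Let_def)
  have sub: "closed_segment ?a1 ?a2 \<subseteq> path_image (rectpath ?a1 ?a3)"
     "closed_segment ?a2 ?a3 \<subseteq> path_image (rectpath ?a1 ?a3)"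
     "closed_segment ?a3 ?a4 \<subseteq> path_image (rectpath ?a1 ?a3)"
     "closed_segment ?a4 ?a1 \<subseteq> path_image (rectpath ?a1 ?a3)"
    unfolding rp by (auto simp: path_image_join)
  note c = continuous_on_subset[OF cont sub(1)] continuous_on_subset[OF cont sub(2)]
    continuous_on_subset[OF cont sub(3)] continuous_on_subset[OF cont sub(4)]
  note int = c[THEN contour_integrable_continuous_linepath]
  have total: "(?f has_contour_integral 2 * pi * \<i> * v) (rectpath ?a1 ?a3)"
  proof (cases "Im \<zeta> < y1")
    case True
    let ?S = "{w. max 0 (Im \<zeta>) < Im w}"
    have "(?f has_contour_integral 0) (rectpath ?a1 ?a3)"
    proof (rule Cauchy_theorem_convex_simple)
      show "?f holomorphic_on ?S"
        by (intro holomorphic_intros holomorphic_on_subset[OF F]) auto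
      show "convex ?S" by (rule convex_halfspace_Im_gt)
      show "path_image (rectpath ?a1 ?a3) \<subseteq> ?S" unfolding img using True y by auto
    qed auto
    then show ?thesis using \<zeta> True by auto
  next
    case False
    then have \<zeta>': "y1 < Im \<zeta>" "Im \<zeta> < y2" and v: "v = F \<zeta>" using \<zeta> by auto
    have "\<zeta> \<in> box ?a1 ?a3" using \<zeta>' T by (auto simp: in_box_complex_iff)
    then have w: "winding_number (rectpath ?a1 ?a3) \<zeta> = 1" by (rule winding_number_rectpath)
    have "(?f has_contour_integral 2 * pi * \<i> * winding_number (rectpath ?a1 ?a3) \<zeta> * F \<zeta>) (rectpath ?a1 ?a3)"
    proof (rule Cauchy_integral_formula_convex_simple[OF uhp_convex F])
      show "\<zeta> \<in> interior upper_half_plane" using \<zeta>' y uhp_open by (simp add: interior_open)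
      show "path_image (rectpath ?a1 ?a3) \<subseteq> upper_half_plane - {\<zeta>}" using off pos by auto
    qed auto
    then show ?thesis using v w by simp
  qed
  have "contour_integral (rectpath ?a1 ?a3) ?f =
      contour_integral (linepath ?a1 ?a2) ?f + contour_integral (linepath ?a2 ?a3) ?f
      + contour_integral (linepath ?a3 ?a4) ?f + contour_integral (linepath ?a4 ?a1) ?f"
    unfolding rp using int by simp
  also have "contour_integral (linepath ?a3 ?a4) ?f = - contour_integral (linepath ?a4 ?a3) ?f"
    by (rule contour_integral_reverse_linepath[OF c(3)])
  also have "contour_integral (linepath ?a4 ?a1) ?f = - contour_integral (linepath ?a1 ?a4) ?f"
    by (rule contour_integral_reverse_linepath[OF c(4)])
  finally have sum: "2 * pi * \<i> * v =
      contour_integral (linepath ?a1 ?a2) ?f + contour_integral (linepath ?a2 ?a3) ?f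
      - contour_integral (linepath ?a4 ?a3) ?f - contour_integral (linepath ?a1 ?a4) ?f"
    using contour_integral_unique[OF total] by simp
  have int': "?f contour_integrable_on linepath ?a4 ?a3" "?f contour_integrable_on linepath ?a1 ?a4"
    using c(3,4) by (auto intro!: contour_integrable_continuous_linepath simp: closed_segment_commute)
  have h: "contour_integral (linepath (Complex (-T) y) (Complex T y)) ?f =
      integral {-T..T} (\<lambda>x. F (Complex x y) / (Complex x y - \<zeta>))"
    if "?f contour_integrable_on linepath (Complex (-T) y) (Complex T y)" for y
    using has_contour_integral_integral[OF that] T0
    by (subst (asm) has_contour_integral_horizontal) (auto simp: integral_unique)
  have ver: "contour_integral (linepath (Complex t y1) (Complex t y2)) ?f =
      \<i> * integral {y1..y2} (\<lambda>y. F (Complex t y) / (Complex t y - \<zeta>))"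
    if "?f contour_integrable_on linepath (Complex t y1) (Complex t y2)" for t
  proof -
    have "((\<lambda>y. ?f (Complex t y)) has_integral
        - \<i> * contour_integral (linepath (Complex t y1) (Complex t y2)) ?f) {y1..y2}"
      using has_contour_integral_integral[OF that] y
      by (subst (asm) has_contour_integral_linepath_same_Re_iff[where c = t and a = y1 and b = y2]) auto
    from integral_unique[OF this] show ?thesis by simp
  qed
  show ?thesis
    using sum unfolding h[OF int(1)] h[OF int'(1)] ver[OF int(2)] ver[OF int'(2)]
    by (simp add: algebra_simps)
qed

lemma integral_symmetric_interval_tendsto:
  fixes g :: "real \<Rightarrow> complex"
  assumes g: "integrable lebesgue g" and c: "continuous_on UNIV g"
  shows "((\<lambda>T. integral {-T..T} g) \<longlongrightarrow> (\<integral>x. g x \<partial>lebesgue)) at_top"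
proof -
  have "((\<lambda>T. \<integral>x. indicator {-T..T} x *\<^sub>R g x \<partial>lebesgue) \<longlongrightarrow> (\<integral>x. g x \<partial>lebesgue)) at_top"
  proof (rule integral_dominated_convergence_at_top)
    show "AE x in lebesgue. ((\<lambda>T. indicator {-T..T} x *\<^sub>R g x) \<longlongrightarrow> g x) at_top"
    proof (rule AE_I2, rule tendsto_eventually)
      fix x
      show "\<forall>\<^sub>F T in at_top. indicator {-T..T} x *\<^sub>R g x = g x"
        using eventually_ge_at_top[of "\<bar>x\<bar>"] by eventually_elim (auto simp: indicator_def)
    qed
    show "\<forall>\<^sub>F T in at_top. AE x in lebesgue. norm (indicator {-T..T} x *\<^sub>R g x) \<le> norm (g x)"
      by (intro always_eventually allI AE_I2) (simp add: indicator_def)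
    show "(\<lambda>x. indicator {-T..T} x *\<^sub>R g x) \<in> borel_measurable lebesgue" for T
      by (intro borel_measurable_scaleR borel_measurable_indicator borel_measurable_integrable[OF g]) simp
  qed (use g in auto)
  moreover have "(\<integral>x. indicator {-T..T} x *\<^sub>R g x \<partial>lebesgue) = integral {-T..T} g" for T
    using set_lebesgue_integral_eq_integral(2)[OF absolutely_integrable_continuous_real[OF continuous_on_subset[OF c]], of "-T" T]
    by (simp add: set_lebesgue_integral_def)
  ultimately show ?thesis by simp
qed

lemma eventually_large_imp_nn_integral_top:
  assumes "(g :: real \<Rightarrow> ennreal) \<in> borel_measurable lborel" "\<And>t. t \<ge> T \<Longrightarrow> ennreal c \<le> g t" "0 < c"
  shows "(\<integral>\<^sup>+t. g t \<partial>lborel) = \<infinity>"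
proof -
  have "emeasure lborel {T..} = \<infinity>"
  proof (rule ccontr)
    assume "emeasure lborel {T..} \<noteq> \<infinity>"
    then obtain r where r: "emeasure lborel {T..} = ennreal r" "0 \<le> r" by (cases "emeasure lborel {T..}") auto
    have "emeasure lborel {T..T + (r + 1)} \<le> emeasure lborel {T..}" by (intro emeasure_mono) auto
    then show False using r by simp
  qed
  then have "\<infinity> = ennreal c * emeasure lborel {T..}" using assms(3) by (simp add: ennreal_mult_top)
  also have "\<dots> = (\<integral>\<^sup>+t. ennreal c * indicator {T..} t \<partial>lborel)"
    by (simp add: nn_integral_cmult)
  also have "\<dots> \<le> (\<integral>\<^sup>+t. g t \<partial>lborel)"
    using assms(2) by (intro nn_integral_mono) (auto simp: indicator_def)
  finally show ?thesis by (simp add: top_unique)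
qed

lemma slice_product_integrable:
  assumes "F \<in> hardy_analytic" "0 < y" "Im \<zeta> \<noteq> y"
  shows "integrable lebesgue (\<lambda>x. F (Complex x y) / (Complex x y - \<zeta>))"
    and "(\<integral>x. F (Complex x y) / (Complex x y - \<zeta>) \<partial>lebesgue) =
       l2_inner (\<lambda>x. F (Complex x y)) (cauchy_kernel (cnj (\<zeta> - \<i> * y)))"
    and "continuous_on UNIV (\<lambda>x. F (Complex x y) / (Complex x y - \<zeta>))"
proof -
  obtain M where L2: "(\<lambda>x. F (Complex x y)) \<in> L2" using hardy_slices[OF assms(1)] assms(2) by metis
  have eq: "F (Complex x y) / (Complex x y - \<zeta>) =
      F (Complex x y) * cnj (cauchy_kernel (cnj (\<zeta> - \<i> * y)) x)" for x
  proof -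
    have "Complex x y - \<zeta> = complex_of_real x - (\<zeta> - \<i> * y)" by (simp add: complex_eq_iff)
    then show ?thesis by (simp add: cauchy_kernel_def)
  qed
  show "integrable lebesgue (\<lambda>x. F (Complex x y) / (Complex x y - \<zeta>))"
    unfolding eq
    by (rule integrable_L2_mult(1)[OF L2 cauchy_kernel_L2(1)]) (use assms in auto)
  show "(\<integral>x. F (Complex x y) / (Complex x y - \<zeta>) \<partial>lebesgue) =
       l2_inner (\<lambda>x. F (Complex x y)) (cauchy_kernel (cnj (\<zeta> - \<i> * y)))"
    unfolding eq l2_inner_def ..
  have hol: "F holomorphic_on upper_half_plane" using assms by (simp add: hardy_analytic_def)
  have "continuous_on UNIV (\<lambda>x. F (Complex x y))"
    using assms by (intro continuous_on_compose2[OF holomorphic_on_imp_continuous_on[OF hol]] continuous_intros) auto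
  then show "continuous_on UNIV (\<lambda>x. F (Complex x y) / (Complex x y - \<zeta>))"
    using assms by (intro continuous_intros) (auto simp: complex_eq_iff)
qed

text \<open>In the rectangle with corners \<open>\<plusminus>T + i y\<^sub>1\<close> and \<open>\<plusminus>T + i y\<^sub>2\<close> the integral over the vertical
  sides has a limit \<open>L\<close> as \<open>T \<rightarrow> \<infinity>\<close>, because those over the horizontal sides do. Its modulus is bounded
  by a function of \<open>T\<close> that is integrable by Tonelli's theorem and the uniform bound on the horizontal
  means, so \<open>L = 0\<close>.\<close>

lemma slice_difference:
  assumes F: "F \<in> hardy_analytic" and y: "0 < y1" "y1 < y2"
    and \<zeta>: "Im \<zeta> < y1 \<and> v = 0 \<or> y1 < Im \<zeta> \<and> Im \<zeta> < y2 \<and> v = F \<zeta>"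
  shows "(\<integral>x. F (Complex x y1) / (Complex x y1 - \<zeta>) \<partial>lebesgue)
       - (\<integral>x. F (Complex x y2) / (Complex x y2 - \<zeta>) \<partial>lebesgue) = 2 * pi * \<i> * v" (is "?A1 - ?A2 = _")
proof (rule ccontr)
  let ?f = "\<lambda>w. F w / (w - \<zeta>)"
  assume neq: "?A1 - ?A2 \<noteq> 2 * pi * \<i> * v"
  have hol: "F holomorphic_on upper_half_plane" using F by (simp add: hardy_analytic_def)
  obtain M where M: "0 \<le> M" and L2: "\<And>y. 0 < y \<Longrightarrow> (\<lambda>x. F (Complex x y)) \<in> L2"
    and bd: "\<And>y. 0 < y \<Longrightarrow> (l2_norm (\<lambda>x. F (Complex x y)))\<^sup>2 \<le> M"
    using hardy_slices[OF F] by metis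
  define s where "s = (\<lambda>t. integral {y1..y2} (\<lambda>y. ?f (Complex t y)))"
  define L where "L = 2 * pi * \<i> * v - (?A1 - ?A2)"
  have L: "norm L > 0" using neq by (simp add: L_def)
  have "((\<lambda>T. 2 * pi * \<i> * v - (integral {-T..T} (\<lambda>x. ?f (Complex x y1))
      - integral {-T..T} (\<lambda>x. ?f (Complex x y2)))) \<longlongrightarrow> L) at_top"
    unfolding L_def using \<zeta> y
    by (intro tendsto_intros integral_symmetric_interval_tendsto slice_product_integrable F) auto
  then have "((\<lambda>T. \<i> * (s T - s (-T))) \<longlongrightarrow> L) at_top"
  proof (rule Lim_transform_eventually)
    show "\<forall>\<^sub>F T in at_top. 2 * pi * \<i> * v - (integral {-T..T} (\<lambda>x. ?f (Complex x y1))
      - integral {-T..T} (\<lambda>x. ?f (Complex x y2))) = \<i> * (s T - s (-T))"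
      using eventually_gt_at_top[of "\<bar>Re \<zeta>\<bar>"]
      by eventually_elim (use rectangle_identity[OF hol y _ \<zeta>] in \<open>simp add: s_def algebra_simps\<close>)
  qed
  then have "\<forall>\<^sub>F T in at_top. norm L / 2 < norm (\<i> * (s T - s (-T)))"
    using L by (intro order_tendstoD(1)[OF tendsto_norm]) auto
  then obtain T1 where T1: "\<And>T. T \<ge> T1 \<Longrightarrow> norm L / 2 < norm (\<i> * (s T - s (-T)))"
    by (auto simp: eventually_at_top_linorder)
  \<comment> \<open>an integrable majorant of the integrand that has no singularity at \<open>\<zeta>\<close>\<close>
  define H where "H = (\<lambda>t y. (norm (F (Complex t y)))\<^sup>2 + 2 * (1 / ((t - Re \<zeta>)\<^sup>2 + 1\<^sup>2)))"
  have H0: "0 \<le> H t y" for t y by (simp add: H_def)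
  define N where "N = (\<lambda>t. \<integral>\<^sup>+y. ennreal (indicator {y1..y2} y * H t y) \<partial>lborel)"
  have cont2: "continuous_on (UNIV \<times> {y1..y2}) (\<lambda>(t, y). H t y)"
    unfolding H_def case_prod_unfold using y
    by (intro continuous_intros continuous_on_compose2[OF holomorphic_on_imp_continuous_on[OF hol]])
      (auto simp: add_nonneg_eq_0_iff)
  have m2: "(\<lambda>(t, y). indicator {y1..y2} y * H t y) \<in> borel_measurable (lborel \<Otimes>\<^sub>M lborel)"
  proof -
    have "(\<lambda>p. indicator (UNIV \<times> {y1..y2}) p *\<^sub>R (case p of (t, y) \<Rightarrow> H t y)) \<in> borel_measurable (borel :: (real \<times> real) measure)"
      by (intro borel_measurable_continuous_on_indicator cont2 borel_closed closed_Times) auto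
    also have "(\<lambda>p. indicator (UNIV \<times> {y1..y2}) p *\<^sub>R (case p of (t, y) \<Rightarrow> H t y)) =
        (\<lambda>(t, y). indicator {y1..y2} y * H t y)"
      by (auto simp: fun_eq_iff indicator_def)
    finally show ?thesis by (simp add: lborel_prod)
  qed
  have [measurable]: "(\<lambda>p. ennreal (indicator {y1..y2} (snd p) * H (fst p) (snd p)))
      \<in> borel_measurable (lborel \<Otimes>\<^sub>M lborel)"
    using measurable_compose[OF m2 measurable_ennreal] by (simp add: case_prod_unfold)
  have [measurable]: "N \<in> borel_measurable lborel" unfolding N_def by measurable
  have Nfin: "(\<integral>\<^sup>+t. N t \<partial>lborel) < \<infinity>"
  proof -
    have "(\<integral>\<^sup>+t. N t \<partial>lborel) =
        (\<integral>\<^sup>+y. \<integral>\<^sup>+t. ennreal (indicator {y1..y2} y * H t y) \<partial>lborel \<partial>lborel)"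
      unfolding N_def by (intro lborel_pair.Fubini'[symmetric]) (simp add: case_prod_unfold)
    also have "\<dots> \<le> (\<integral>\<^sup>+y. ennreal (M + 2 * pi) * indicator {y1..y2} y \<partial>lborel)"
    proof (rule nn_integral_mono)
      fix y
      show "(\<integral>\<^sup>+t. ennreal (indicator {y1..y2} y * H t y) \<partial>lborel) \<le> ennreal (M + 2 * pi) * indicator {y1..y2} y"
      proof (cases "y \<in> {y1..y2}")
        case True
        then have y0: "0 < y" using y by simp
        have int: "integrable lebesgue (\<lambda>t. H t y)"
          unfolding H_def using L2_integrable[OF L2[OF y0]] inverse_quadratic_integral(1)[of 1 "Re \<zeta>"]
          by (intro Bochner_Integration.integrable_add integrable_mult_right) auto
        have "(\<integral>\<^sup>+t. ennreal (H t y) \<partial>lborel) = (\<integral>\<^sup>+t. ennreal (H t y) \<partial>lebesgue)"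
          by (simp add: nn_integral_completion)
        also have "\<dots> = ennreal (\<integral>t. H t y \<partial>lebesgue)"
          using int H0 by (intro nn_integral_eq_integral) auto
        also have "(\<integral>t. H t y \<partial>lebesgue) = (l2_norm (\<lambda>x. F (Complex x y)))\<^sup>2 + 2 * pi"
          unfolding H_def using L2_integrable[OF L2[OF y0]] inverse_quadratic_integral[of 1 "Re \<zeta>"]
          by (simp only: Bochner_Integration.integral_add integrable_mult_right integral_mult_right_zero
              l2_norm_squared)
        also have "ennreal \<dots> \<le> ennreal (M + 2 * pi)" using bd[OF y0] by (intro ennreal_leI) simp
        finally show ?thesis using True by simp
      qed simp
    qed
    also have "\<dots> < \<infinity>"
      using y by (simp add: nn_integral_cmult ennreal_mult_less_top)
    finally show ?thesis .
  qed
  have sN: "ennreal (norm (s t)) \<le> N t" if t: "1 \<le> \<bar>t - Re \<zeta>\<bar>" for t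
  proof -
    have "Complex t y \<noteq> \<zeta>" for y using t by auto
    then have "continuous_on {y1..y2} (\<lambda>y. ?f (Complex t y))"
      using y by (intro continuous_intros continuous_on_compose2[OF holomorphic_on_imp_continuous_on[OF hol]]) auto
    then have si: "set_integrable lborel {y1..y2} (\<lambda>y. ?f (Complex t y))"
      by (rule borel_integrable_atLeastAtMost')
    have "norm (s t) = norm (\<integral>y. indicator {y1..y2} y *\<^sub>R ?f (Complex t y) \<partial>lborel)"
      using set_borel_integral_eq_integral(2)[OF si] by (simp add: s_def set_lebesgue_integral_def)
    also have "ennreal \<dots> \<le> (\<integral>\<^sup>+y. ennreal (norm (indicator {y1..y2} y *\<^sub>R ?f (Complex t y))) \<partial>lborel)"
      using si unfolding set_integrable_def by (rule integral_norm_bound_ennreal)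
    also have "\<dots> \<le> N t"
      unfolding N_def
    proof (intro nn_integral_mono ennreal_leI)
      fix y
      have "norm (?f (Complex t y)) \<le> H t y"
      proof -
        have r: "1 \<le> (t - Re \<zeta>)\<^sup>2" using t by (metis abs_le_square_iff abs_one one_power2)
        have d: "\<bar>t - Re \<zeta>\<bar> \<le> norm (Complex t y - \<zeta>)"
          using abs_Re_le_cmod[of "Complex t y - \<zeta>"] by simp
        have "norm (?f (Complex t y)) \<le> norm (F (Complex t y)) * (1 / \<bar>t - Re \<zeta>\<bar>)"
          using d t by (auto simp: norm_divide norm_mult norm_inverse divide_inverse intro!: mult_left_mono le_imp_inverse_le)
        also have "\<dots> \<le> (norm (F (Complex t y)))\<^sup>2 + (1 / \<bar>t - Re \<zeta>\<bar>)\<^sup>2"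
          using zero_le_power2[of "norm (F (Complex t y)) - 1 / \<bar>t - Re \<zeta>\<bar>"]
            zero_le_power2[of "norm (F (Complex t y))"] zero_le_power2[of "1 / \<bar>t - Re \<zeta>\<bar>"]
          unfolding power2_diff by linarith
        also have "(1 / \<bar>t - Re \<zeta>\<bar>)\<^sup>2 \<le> 2 * (1 / ((t - Re \<zeta>)\<^sup>2 + 1\<^sup>2))"
        proof -
          have "1 / q \<le> 2 * (1 / (q + 1\<^sup>2))" if "1 \<le> q" for q :: real
            using that by (simp add: divide_simps)
          from this[OF r] show ?thesis by (simp add: power_divide)
        qed
        finally show ?thesis by (simp add: H_def)
      qed
      then show "norm (indicator {y1..y2} y *\<^sub>R ?f (Complex t y)) \<le> indicator {y1..y2} y * H t y"
        by (simp add: indicator_def)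
    qed
    finally show ?thesis .
  qed
  have "(\<integral>\<^sup>+t. N t + N (- t) \<partial>lborel) = \<infinity>"
  proof (rule eventually_large_imp_nn_integral_top[where T = "max T1 (\<bar>Re \<zeta>\<bar> + 1)" and c = "norm L / 2"])
    fix t assume t: "t \<ge> max T1 (\<bar>Re \<zeta>\<bar> + 1)"
    have "norm L / 2 \<le> norm (s t) + norm (s (- t))"
      using T1[of t] t norm_triangle_ineq4[of "s t" "s (- t)"] by (simp add: norm_mult)
    then have "ennreal (norm L / 2) \<le> ennreal (norm (s t)) + ennreal (norm (s (- t)))"
      by (metis ennreal_leI ennreal_plus norm_ge_zero)
    also have "\<dots> \<le> N t + N (- t)"
      using t by (intro add_mono sN) auto
    finally show "ennreal (norm L / 2) \<le> N t + N (- t)" .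
  qed (use L in auto)
  moreover have "(\<integral>\<^sup>+t. N t + N (- t) \<partial>lborel) = (\<integral>\<^sup>+t. N t \<partial>lborel) + (\<integral>\<^sup>+t. N (- t) \<partial>lborel)"
    by (intro nn_integral_add) auto
  moreover have "(\<integral>\<^sup>+t. N (- t) \<partial>lborel) = (\<integral>\<^sup>+t. N t \<partial>lborel)"
    by (subst (2) nn_integral_real_affine[where c = "-1" and t = 0]) auto
  ultimately show False using Nfin by simp
qed

text \<open>The top side of the rectangle is moved to infinity. The horizontal means of \<open>\<bar>F\<bar>\<^sup>2\<close> stay
  bounded while the norm of the Cauchy kernel decays, so its contribution vanishes by the
  Cauchy--Schwarz inequality.\<close>

lemma hardy_cauchy_slice:
  assumes F: "F \<in> hardy_analytic" and y: "0 < y" and \<zeta>: "Im \<zeta> \<noteq> 0"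
  shows "l2_inner (\<lambda>x. F (Complex x y)) (cauchy_kernel (cnj \<zeta>)) =
     (if 0 < Im \<zeta> then 2 * pi * \<i> * F (\<zeta> + \<i> * y) else 0)"
proof -
  let ?\<zeta> = "\<zeta> + \<i> * complex_of_real y"
  define v where "v = (if 0 < Im \<zeta> then F ?\<zeta> else 0)"
  define A where "A = (\<lambda>y. \<integral>x. F (Complex x y) / (Complex x y - ?\<zeta>) \<partial>lebesgue)"
  obtain M where M: "0 \<le> M" and L2: "\<And>y. 0 < y \<Longrightarrow> (\<lambda>x. F (Complex x y)) \<in> L2"
    and bd: "\<And>y. 0 < y \<Longrightarrow> (l2_norm (\<lambda>x. F (Complex x y)))\<^sup>2 \<le> M"
    using hardy_slices[OF F] by metis
  have "((\<lambda>y2. A y2) \<longlongrightarrow> 0) at_top"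
  proof (rule Lim_null_comparison)
    show "((\<lambda>y2. sqrt M * sqrt (pi / (y2 - Im ?\<zeta>))) \<longlongrightarrow> 0) at_top" by real_asymp
    show "\<forall>\<^sub>F y2 in at_top. norm (A y2) \<le> sqrt M * sqrt (pi / (y2 - Im ?\<zeta>))"
      using eventually_gt_at_top[of "max 0 (Im ?\<zeta>)"]
    proof eventually_elim
      case (elim y2)
      let ?c = "cauchy_kernel (cnj (?\<zeta> - \<i> * y2))"
      have Im: "\<bar>Im (cnj (?\<zeta> - \<i> * y2))\<bar> = y2 - Im ?\<zeta>" using elim by simp
      have "norm (A y2) \<le> l2_norm (\<lambda>x. F (Complex x y2)) * l2_norm ?c"
        unfolding A_def using elim
        by (subst slice_product_integrable(2)[OF F]) (auto intro!: l2_cauchy_schwarz L2 cauchy_kernel_L2)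
      also have "\<dots> \<le> sqrt M * sqrt (pi / (y2 - Im ?\<zeta>))"
      proof (intro mult_mono)
        show "l2_norm (\<lambda>x. F (Complex x y2)) \<le> sqrt M"
          using bd[of y2] elim by (intro real_le_rsqrt) auto
        have "(l2_norm ?c)\<^sup>2 = pi / (y2 - Im ?\<zeta>)"
          using cauchy_kernel_L2(2)[of "cnj (?\<zeta> - \<i> * y2)"] Im elim by simp
        then show "l2_norm ?c \<le> sqrt (pi / (y2 - Im ?\<zeta>))" by (intro real_le_rsqrt) simp
      qed (use M l2_norm_nonneg in auto)
      finally show ?case .
    qed
  qed
  then have "((\<lambda>y2. A y - A y2) \<longlongrightarrow> A y - 0) at_top" by (intro tendsto_intros)
  moreover have "((\<lambda>y2. A y - A y2) \<longlongrightarrow> 2 * pi * \<i> * v) at_top"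
  proof (rule tendsto_eventually)
    show "\<forall>\<^sub>F y2 in at_top. A y - A y2 = 2 * pi * \<i> * v"
      using eventually_gt_at_top[of "max y (Im ?\<zeta>)"]
      by eventually_elim (unfold A_def, rule slice_difference[OF F y], use \<zeta> in \<open>auto simp: v_def\<close>)
  qed
  ultimately have "A y = 2 * pi * \<i> * v" using tendsto_unique[of at_top] by force
  moreover have "A y = l2_inner (\<lambda>x. F (Complex x y)) (cauchy_kernel (cnj \<zeta>))"
    unfolding A_def using \<zeta> by (subst slice_product_integrable(2)[OF F y]) auto
  ultimately show ?thesis by (simp add: v_def)
qed

text \<open>The horizontal slices of \<open>F\<close> are bounded in \<open>L\<^sup>2\<close> and converge to \<open>f\<close> almost everywhere, hence
  weakly, so Cauchy's formula passes from the slices to the boundary.\<close>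

lemma hardy_cauchy:
  assumes Ff: "hardy_boundary F f" and \<zeta>: "Im \<zeta> \<noteq> 0"
  shows "l2_inner f (cauchy_kernel (cnj \<zeta>)) = (if 0 < Im \<zeta> then 2 * pi * \<i> * F \<zeta> else 0)"
proof -
  have F: "F \<in> hardy_analytic" and f: "f \<in> L2" and lim: "AE x in lebesgue. nt_limit F x (f x)"
    using Ff by (auto simp: hardy_boundary_def)
  have hol: "F holomorphic_on upper_half_plane" using F by (simp add: hardy_analytic_def)
  obtain M where M: "0 \<le> M" and L2: "\<And>y. 0 < y \<Longrightarrow> (\<lambda>x. F (Complex x y)) \<in> L2"
    and bd: "\<And>y. 0 < y \<Longrightarrow> (l2_norm (\<lambda>x. F (Complex x y)))\<^sup>2 \<le> M"
    using hardy_slices[OF F] by metis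
  define \<epsilon> where "\<epsilon> = (\<lambda>j. inverse (real (Suc j)))"
  have \<epsilon>: "0 < \<epsilon> j" for j by (simp add: \<epsilon>_def)
  have "(\<lambda>j. l2_inner (\<lambda>x. F (Complex x (\<epsilon> j))) (cauchy_kernel (cnj \<zeta>))) \<longlonglongrightarrow>
      l2_inner f (cauchy_kernel (cnj \<zeta>))"
  proof (rule L2_weak_limit)
    show "AE x in lebesgue. (\<lambda>j. F (Complex x (\<epsilon> j))) \<longlonglongrightarrow> f x"
      using lim unfolding \<epsilon>_def
      by eventually_elim (rule nt_limit_cone_sequence[OF _ vertical_cone_sequence])
    show "cauchy_kernel (cnj \<zeta>) \<in> L2" using \<zeta> by (intro cauchy_kernel_L2) simp
  qed (use L2 bd \<epsilon> in auto)
  moreover have "(\<lambda>j. l2_inner (\<lambda>x. F (Complex x (\<epsilon> j))) (cauchy_kernel (cnj \<zeta>))) \<longlonglongrightarrow>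
      (if 0 < Im \<zeta> then 2 * pi * \<i> * F \<zeta> else 0)"
  proof (cases "0 < Im \<zeta>")
    case True
    have "isCont F \<zeta>"
      using hol True uhp_open by (metis continuous_on_eq_continuous_at holomorphic_on_imp_continuous_on uhp_iff)
    moreover have "(\<lambda>j. \<zeta> + \<i> * complex_of_real (\<epsilon> j)) \<longlonglongrightarrow> \<zeta> + \<i> * complex_of_real 0"
      unfolding \<epsilon>_def by (intro tendsto_intros LIMSEQ_inverse_real_of_nat)
    ultimately have "(\<lambda>j. F (\<zeta> + \<i> * complex_of_real (\<epsilon> j))) \<longlonglongrightarrow> F \<zeta>"
      by (intro isCont_tendsto_compose[of _ F]) auto
    then have "(\<lambda>j. 2 * pi * \<i> * F (\<zeta> + \<i> * complex_of_real (\<epsilon> j))) \<longlonglongrightarrow> 2 * pi * \<i> * F \<zeta>"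
      by (intro tendsto_intros)
    then show ?thesis using True by (simp add: hardy_cauchy_slice[OF F \<epsilon> \<zeta>])
  next
    case False
    then show ?thesis by (simp add: hardy_cauchy_slice[OF F \<epsilon> \<zeta>])
  qed
  ultimately show ?thesis by (rule LIMSEQ_unique)
qed

text \<open>The Poisson kernel at \<open>z\<close> is a multiple of the difference of the Cauchy kernels at \<open>z\<close> and at its
  conjugate. One of them reproduces \<open>F z\<close>; the other is orthogonal to \<open>f\<close>.\<close>

lemma hardy_poisson:
  assumes Ff: "hardy_boundary F f" and z: "0 < Im z"
  shows "l2_inner f (\<lambda>t. complex_of_real (poisson_kernel z t)) = F z"
proof -
  have f: "f \<in> L2" using Ff by (simp add: hardy_boundary_def)
  have "l2_inner f (\<lambda>t. complex_of_real (poisson_kernel z t)) =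
      l2_inner f (\<lambda>t. 1 / (2 * pi * \<i>) * (cauchy_kernel z t - cauchy_kernel (cnj z) t))"
  proof -
    have "complex_of_real (poisson_kernel z t) = 1 / (2 * pi * \<i>) * (cauchy_kernel z t - cauchy_kernel (cnj z) t)" for t
    proof -
      have n: "complex_of_real t - z \<noteq> 0" "complex_of_real t - cnj z \<noteq> 0"
        using z by (auto simp: complex_eq_iff)
      have "cauchy_kernel z t - cauchy_kernel (cnj z) t =
          (z - cnj z) / ((complex_of_real t - z) * (complex_of_real t - cnj z))"
        using n by (simp add: cauchy_kernel_def field_simps)
      also have "(complex_of_real t - z) * (complex_of_real t - cnj z) =
          complex_of_real ((t - Re z)\<^sup>2 + (Im z)\<^sup>2)"
        by (simp add: complex_eq_iff power2_eq_square algebra_simps)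
      also have "z - cnj z = 2 * \<i> * complex_of_real (Im z)" by (simp add: complex_eq_iff)
      finally show ?thesis by (simp add: poisson_kernel_def)
    qed
    then show ?thesis by simp
  qed
  also have "\<dots> = cnj (1 / (2 * pi * \<i>)) * (l2_inner f (cauchy_kernel z) - l2_inner f (cauchy_kernel (cnj z)))"
    unfolding l2_inner_cmult_right using z by (subst l2_inner_diff_right) (auto simp: f cauchy_kernel_L2(1))
  also have "\<dots> = F z"
    using hardy_cauchy[OF Ff, of z] hardy_cauchy[OF Ff, of "cnj z"] z by simp
  finally show ?thesis .
qed

section \<open>Kernels of the model space\<close>

lemma hardy_boundary_cong:
  assumes "hardy_boundary F f" "\<And>w. 0 < Im w \<Longrightarrow> F w = G w"
  shows "hardy_boundary G f"
proof -
  have "F holomorphic_on upper_half_plane"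
    using assms(1) by (simp add: hardy_boundary_def hardy_analytic_def)
  then have "G holomorphic_on upper_half_plane"
    by (rule holomorphic_transform) (simp add: assms(2))
  moreover have "(SUP y\<in>{0<..}. \<integral>\<^sup>+x. ennreal ((norm (G (Complex x y)))\<^sup>2) \<partial>lebesgue) =
      (SUP y\<in>{0<..}. \<integral>\<^sup>+x. ennreal ((norm (F (Complex x y)))\<^sup>2) \<partial>lebesgue)"
    using assms(2) by (intro SUP_cong) auto
  moreover have "AE x in lebesgue. nt_limit G x (f x)"
    using assms(1) by (auto simp: hardy_boundary_def elim!: eventually_mono intro: nt_limit_cong[OF _ assms(2)])
  ultimately show ?thesis
    using assms(1) by (simp add: hardy_boundary_def hardy_analytic_def)
qed

text \<open>Dividing a bounded analytic function by \<open>w - cnj z\<close> gives a function in the Hardy space: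
  on each horizontal line the square of its modulus is dominated by a multiple of the integrable function
  \<open>\<bar>w - cnj z\<bar>\<^sup>-\<^sup>2\<close>.\<close>

lemma bounded_over_linear_hardy:
  assumes V: "V holomorphic_on upper_half_plane" and B: "\<And>w. 0 < Im w \<Longrightarrow> norm (V w) \<le> B"
    and v: "AE x in lebesgue. nt_limit V x (v x)" and z: "0 < Im z"
  shows "hardy_boundary (\<lambda>w. V w / (w - cnj z)) (\<lambda>x. v x * cauchy_kernel (cnj z) x)"
proof -
  have ne: "w - cnj z \<noteq> 0" if "0 \<le> Im w" for w using that z by (auto simp: complex_eq_iff)
  have hol: "(\<lambda>w. V w / (w - cnj z)) holomorphic_on upper_half_plane"
    using ne by (intro holomorphic_intros V) auto
  have slice: "(\<integral>\<^sup>+x. ennreal ((norm (V (Complex x y) / (Complex x y - cnj z)))\<^sup>2) \<partial>lebesgue)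
      \<le> ennreal (B\<^sup>2 * (pi / Im z))" if y: "0 < y" for y
  proof -
    let ?c = "cauchy_kernel (cnj z - \<i> * y)"
    have Im: "Im (cnj z - \<i> * y) \<noteq> 0" using z y by simp
    have "norm (V (Complex x y) / (Complex x y - cnj z)) \<le> B * norm (?c x)" for x
    proof -
      have "Complex x y - cnj z = complex_of_real x - (cnj z - \<i> * y)" by (simp add: complex_eq_iff)
      then have "B * norm (?c x) = B / norm (Complex x y - cnj z)"
        by (simp only: cauchy_kernel_def norm_divide norm_one) simp
      moreover have "norm (V (Complex x y) / (Complex x y - cnj z)) \<le> B / norm (Complex x y - cnj z)"
        using B[of "Complex x y"] y by (simp only: norm_divide) (simp add: divide_right_mono)
      ultimately show ?thesis by simp
    qed
    then have "(norm (V (Complex x y) / (Complex x y - cnj z)))\<^sup>2 \<le> B\<^sup>2 * (norm (?c x))\<^sup>2" for x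
      by (metis norm_ge_zero power_mono power_mult_distrib)
    then have "(\<integral>\<^sup>+x. ennreal ((norm (V (Complex x y) / (Complex x y - cnj z)))\<^sup>2) \<partial>lebesgue)
        \<le> (\<integral>\<^sup>+x. ennreal (B\<^sup>2 * (norm (?c x))\<^sup>2) \<partial>lebesgue)"
      by (intro nn_integral_mono ennreal_leI)
    also have "\<dots> = ennreal (\<integral>x. B\<^sup>2 * (norm (?c x))\<^sup>2 \<partial>lebesgue)"
      using L2_integrable[OF cauchy_kernel_L2(1)[OF Im]] by (intro nn_integral_eq_integral) auto
    also have "(\<integral>x. B\<^sup>2 * (norm (?c x))\<^sup>2 \<partial>lebesgue) = B\<^sup>2 * (pi / (Im z + y))"
      using cauchy_kernel_L2(2)[OF Im] z y by (simp add: l2_norm_squared add.commute)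
    also have "ennreal \<dots> \<le> ennreal (B\<^sup>2 * (pi / Im z))"
      using z y by (intro ennreal_leI mult_left_mono divide_left_mono) auto
    finally show ?thesis .
  qed
  have "(SUP y\<in>{0<..}. \<integral>\<^sup>+x. ennreal ((norm (V (Complex x y) / (Complex x y - cnj z)))\<^sup>2) \<partial>lebesgue)
      \<le> ennreal (B\<^sup>2 * (pi / Im z))"
    using slice by (intro SUP_least) auto
  then have "(\<lambda>w. V w / (w - cnj z)) \<in> hardy_analytic"
    using hol by (auto simp: hardy_analytic_def intro: le_less_trans)
  moreover have "(\<lambda>x. v x * cauchy_kernel (cnj z) x) \<in> L2"
  proof (rule L2_mult_bounded)
    show "v \<in> borel_measurable lebesgue" by (rule nt_limit_boundary_measurable[OF V v])
    show "cauchy_kernel (cnj z) \<in> L2" using z by (intro cauchy_kernel_L2) simp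
    show "AE x in lebesgue. norm (v x) \<le> B"
      using v
    proof eventually_elim
      case (elim x)
      show ?case
        by (rule LIMSEQ_le_const2[OF tendsto_norm[OF nt_limit_cone_sequence[OF elim vertical_cone_sequence]]])
          (auto intro!: exI[of _ 0] B)
    qed
  qed
  moreover have "AE x in lebesgue. nt_limit (\<lambda>w. V w / (w - cnj z)) x (v x * cauchy_kernel (cnj z) x)"
    using v
  proof eventually_elim
    case (elim x)
    have "isCont (\<lambda>w. 1 / (w - cnj z)) (complex_of_real x)"
      using ne[of "complex_of_real x"] by (intro continuous_intros) auto
    from nt_limit_mult[OF elim nt_limit_continuous[OF this]]
    show ?case by (simp add: cauchy_kernel_def)
  qed
  ultimately show ?thesis by (simp add: hardy_boundary_def)
qed

text \<open>The point \<open>z\<close> may lie in the half-plane or on its boundary, so that kernels at boundary points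
  are treated as limits of the others.\<close>

definition kernel_on_line :: "(complex \<Rightarrow> complex) \<Rightarrow> complex \<Rightarrow> real \<Rightarrow> complex" where
  "kernel_on_line U z = (\<lambda>x. model_kernel U z (complex_of_real x))"

lemma boundary_kernel_eq: "boundary_kernel U t = kernel_on_line U (complex_of_real t)"
  by (simp add: boundary_kernel_def kernel_on_line_def)

text \<open>The bound in the half-plane is a hypothesis here; for the symbol of a Clark measure it follows
  from the Herglotz representation.\<close>

locale unimodular_symbol =
  fixes U :: "complex \<Rightarrow> complex"
  assumes hol: "U holomorphic_on upper_half_plane"
    and norm_le_1: "\<And>z. 0 < Im z \<Longrightarrow> norm (U z) \<le> 1"
    and boundary: "AE x in lebesgue. \<exists>l. nt_limit U x l \<and> norm l = 1"
begin

abbreviation u :: "real \<Rightarrow> complex" where "u x \<equiv> hp_ext U (complex_of_real x)"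

lemma u_boundary: "AE x in lebesgue. nt_limit U x (u x) \<and> norm (u x) = 1"
  using boundary by eventually_elim (metis hp_ext_of_real)

lemma cauchy_kernel_hardy:
  assumes "0 < Im z"
  shows "hardy_boundary (\<lambda>w. 1 / (w - cnj z)) (cauchy_kernel (cnj z))"
    and "hardy_boundary (\<lambda>w. U w / (w - cnj z)) (\<lambda>x. u x * cauchy_kernel (cnj z) x)"
proof -
  have "AE x in lebesgue. nt_limit (\<lambda>w. 1) x 1"
    using nt_limit_continuous[where F = "\<lambda>w. 1"] by simp
  from bounded_over_linear_hardy[OF holomorphic_on_const _ this assms, of 1]
  show "hardy_boundary (\<lambda>w. 1 / (w - cnj z)) (cauchy_kernel (cnj z))" by simp
  have "AE x in lebesgue. nt_limit U x (u x)"
    using u_boundary by (auto elim: eventually_mono)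
  from bounded_over_linear_hardy[OF hol norm_le_1 this assms]
  show "hardy_boundary (\<lambda>w. U w / (w - cnj z)) (\<lambda>x. u x * cauchy_kernel (cnj z) x)" by simp
qed

lemma kernel_on_line_eq:
  assumes "0 < Im z"
  shows "kernel_on_line U z =
     (\<lambda>x. \<i> / (2 * pi) * (cauchy_kernel (cnj z) x - cnj (U z) * (u x * cauchy_kernel (cnj z) x)))"
  using assms by (simp add: kernel_on_line_def model_kernel_def cauchy_kernel_def fun_eq_iff diff_divide_distrib)

lemma kernel_hardy:
  assumes z: "0 < Im z"
  shows "hardy_boundary (model_kernel U z) (kernel_on_line U z)"
proof -
  let ?V = "\<lambda>w. \<i> / (2 * pi) * (1 - cnj (U z) * U w)"
  have "hardy_boundary (\<lambda>w. ?V w / (w - cnj z)) (\<lambda>x. (\<i> / (2 * pi) * (1 - cnj (U z) * u x)) * cauchy_kernel (cnj z) x)"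
  proof (rule bounded_over_linear_hardy[OF _ _ _ z])
    show "?V holomorphic_on upper_half_plane" by (intro holomorphic_intros hol)
    show "norm (?V w) \<le> 1 / (2 * pi) * (1 + 1 * 1)" if "0 < Im w" for w
      unfolding norm_mult using norm_le_1[OF z] norm_le_1[OF that]
      by (intro mult_mono order_trans[OF norm_triangle_ineq4] add_mono) (auto simp: norm_mult norm_divide intro!: mult_le_one)
    show "AE x in lebesgue. nt_limit ?V x (\<i> / (2 * pi) * (1 - cnj (U z) * u x))"
      using u_boundary
      by eventually_elim (intro nt_limit_mult nt_limit_diff nt_limit_continuous continuous_const, simp)
  qed
  also have "(\<lambda>x. (\<i> / (2 * pi) * (1 - cnj (U z) * u x)) * cauchy_kernel (cnj z) x) = kernel_on_line U z"
    by (simp add: kernel_on_line_eq[OF z] fun_eq_iff algebra_simps)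
  finally show ?thesis
    by (rule hardy_boundary_cong) (use z in \<open>simp add: model_kernel_def\<close>)
qed

lemma kernel_L2: "0 < Im z \<Longrightarrow> kernel_on_line U z \<in> L2"
  using kernel_hardy by (simp add: hardy_boundary_def)

text \<open>The kernel splits into the Szego kernel, which reproduces Hardy functions by Cauchy's
  formula, and a multiple of a function in \<open>U H\<^sup>2\<close>.\<close>

lemma kernel_reproducing:
  assumes f: "hardy_boundary F f" and z: "0 < Im z"
    and orth: "l2_inner f (\<lambda>x. u x * cauchy_kernel (cnj z) x) = 0"
  shows "l2_inner f (kernel_on_line U z) = F z"
proof -
  have L2: "f \<in> L2" "cauchy_kernel (cnj z) \<in> L2" "(\<lambda>x. u x * cauchy_kernel (cnj z) x) \<in> L2"
    using f cauchy_kernel_hardy[OF z] by (auto simp: hardy_boundary_def)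
  have "l2_inner f (kernel_on_line U z) = cnj (\<i> / (2 * pi)) *
      (l2_inner f (cauchy_kernel (cnj z)) - cnj (cnj (U z)) * l2_inner f (\<lambda>x. u x * cauchy_kernel (cnj z) x))"
    unfolding kernel_on_line_eq[OF z] l2_inner_cmult_right
    by (subst l2_inner_diff_right) (auto intro: L2 L2_cmult simp: l2_inner_cmult_right)
  also have "\<dots> = F z"
    using hardy_cauchy[OF f, of z] z orth by (simp add: field_simps)
  finally show ?thesis .
qed

text \<open>Expanding both kernels, all terms are values of Cauchy's formula, since \<open>\<bar>U\<bar> = 1\<close> on the
  boundary removes \<open>U\<close> from the term that contains it twice. What has to be seen is that the first
  kernel is orthogonal to the part of the second one in \<open>U H\<^sup>2\<close>.\<close>

lemma kernel_inner:
  assumes z: "0 < Im z" and \<zeta>: "0 < Im \<zeta>"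
  shows "l2_inner (kernel_on_line U z) (kernel_on_line U \<zeta>) = model_kernel U z \<zeta>"
proof (rule kernel_reproducing[OF kernel_hardy[OF z] \<zeta>])
  let ?c = "cauchy_kernel (cnj z)" and ?d = "cauchy_kernel (cnj \<zeta>)"
  have L2: "?c \<in> L2" "(\<lambda>x. u x * ?c x) \<in> L2" "?d \<in> L2" "(\<lambda>x. u x * ?d x) \<in> L2"
    using cauchy_kernel_hardy[OF z] cauchy_kernel_hardy[OF \<zeta>] by (auto simp: hardy_boundary_def)
  have "l2_inner (\<lambda>x. u x * ?d x) ?c = 2 * pi * \<i> * (U z / (z - cnj \<zeta>))"
    using hardy_cauchy[OF cauchy_kernel_hardy(2)[OF \<zeta>], of z] z by simp
  then have 1: "l2_inner ?c (\<lambda>x. u x * ?d x) = cnj (2 * pi * \<i> * (U z / (z - cnj \<zeta>)))"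
    by (metis l2_inner_cnj)
  have "l2_inner (\<lambda>x. u x * ?c x) (\<lambda>x. u x * ?d x) = l2_inner ?c ?d"
    unfolding l2_inner_def
  proof (rule integral_cong_AE)
    show "(\<lambda>x. u x * ?c x * cnj (u x * ?d x)) \<in> borel_measurable lebesgue"
      by (intro borel_measurable_integrable integrable_L2_mult(1) L2)
    show "(\<lambda>x. ?c x * cnj (?d x)) \<in> borel_measurable lebesgue"
      by (intro borel_measurable_integrable integrable_L2_mult(1) L2)
    show "AE x in lebesgue. u x * ?c x * cnj (u x * ?d x) = ?c x * cnj (?d x)"
      using u_boundary
    proof eventually_elim
      case (elim x)
      have "u x * cnj (u x) = 1" using elim by (metis complex_norm_square mult_1 of_real_1 one_power2)
      then show ?case by (simp add: algebra_simps)
    qed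
  qed
  also have "\<dots> = cnj (2 * pi * \<i> * (1 / (z - cnj \<zeta>)))"
    using hardy_cauchy[OF cauchy_kernel_hardy(1)[OF \<zeta>], of z] z by (metis l2_inner_cnj less_irrefl)
  finally have 2: "l2_inner (\<lambda>x. u x * ?c x) (\<lambda>x. u x * ?d x) = cnj (2 * pi * \<i> * (1 / (z - cnj \<zeta>)))" .
  have "l2_inner (kernel_on_line U z) (\<lambda>x. u x * ?d x) = \<i> / (2 * pi) *
      (l2_inner ?c (\<lambda>x. u x * ?d x) - cnj (U z) * l2_inner (\<lambda>x. u x * ?c x) (\<lambda>x. u x * ?d x))"
    unfolding kernel_on_line_eq[OF z] l2_inner_cmult
    by (subst l2_inner_diff) (auto intro: L2 L2_cmult simp: l2_inner_cmult)
  then show "l2_inner (kernel_on_line U z) (\<lambda>x. u x * ?d x) = 0"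
    by (simp add: 1 2)
qed

lemma kernel_norm:
  assumes z: "0 < Im z"
  shows "(l2_norm (kernel_on_line U z))\<^sup>2 = (1 - (norm (U z))\<^sup>2) / (4 * pi * Im z)"
proof -
  have d: "z - cnj z = 2 * \<i> * complex_of_real (Im z)" by (simp add: complex_eq_iff)
  have "complex_of_real ((l2_norm (kernel_on_line U z))\<^sup>2) = model_kernel U z z"
    using kernel_inner[OF z z] by (simp add: l2_inner_self)
  also have "\<dots> = complex_of_real ((1 - (norm (U z))\<^sup>2) / (4 * pi * Im z))"
    unfolding model_kernel_def d using z
    by (simp add: mult.commute[of "cnj _"] flip: complex_norm_square)
  finally show ?thesis unfolding of_real_eq_iff .
qed

end

section \<open>Clark measures\<close>

lemma Re_herglotz:
  assumes "norm \<alpha> = 1" "v \<noteq> \<alpha>"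
  shows "Re ((\<alpha> + v) / (\<alpha> - v)) * (norm (\<alpha> - v))\<^sup>2 = 1 - (norm v)\<^sup>2"
proof -
  have n: "(norm (\<alpha> - v))\<^sup>2 \<noteq> 0" using assms by simp
  have "Re ((\<alpha> + v) / (\<alpha> - v)) = Re ((\<alpha> + v) * cnj (\<alpha> - v)) / (norm (\<alpha> - v))\<^sup>2"
    by (simp add: complex_div_cnj[of "\<alpha> + v"] flip: of_real_power)
  also have "Re ((\<alpha> + v) * cnj (\<alpha> - v)) = (norm \<alpha>)\<^sup>2 - (norm v)\<^sup>2"
    unfolding cmod_power2 by (simp add: power2_eq_square algebra_simps)
  finally show ?thesis using n assms by simp
qed

lemma norm_complex_minus_i: "(norm (complex_of_real x - \<i>))\<^sup>2 = 1 + x\<^sup>2"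
  by (simp add: cmod_power2)

text \<open>Distances to real points from \<open>z\<close> and from \<open>\<i>\<close> are comparable. This reduces every
  domination under the Clark integral to the integrability of \<open>1 / (1 + x\<^sup>2)\<close>.\<close>

lemma norm_minus_i_le:
  assumes "0 < Im z"
  shows "norm (complex_of_real x - \<i>) \<le> (1 + norm (z - \<i>) / Im z) * norm (complex_of_real x - z)"
proof -
  have "norm (complex_of_real x - \<i>) \<le> norm (complex_of_real x - z) + norm (z - \<i>)"
    using norm_triangle_ineq[of "complex_of_real x - z" "z - \<i>"] by simp
  also have "norm (z - \<i>) \<le> norm (z - \<i>) / Im z * norm (complex_of_real x - z)"
    using mult_left_mono[OF Im_le_norm_real_minus[of z x], of "norm (z - \<i>) / Im z"] assms by simp
  finally show ?thesis by (simp add: algebra_simps)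
qed

text \<open>The image lies in a vertical line, so it is not open, and the open mapping theorem applies.\<close>

lemma constant_Re_imp_constant:
  assumes f: "f holomorphic_on S" and S: "open S" "connected S" and re: "\<And>z. z \<in> S \<Longrightarrow> Re (f z) = r"
  shows "f constant_on S"
proof (rule ccontr)
  assume nc: "\<not> f constant_on S"
  then obtain z where z: "z \<in> S" by (auto simp: constant_on_def)
  have "open (f ` S)" by (rule open_mapping_thm[OF f S S(1) subset_refl nc])
  then obtain e where e: "e > 0" "ball (f z) e \<subseteq> f ` S" using z openE by blast
  have "f z + complex_of_real (e / 2) \<in> ball (f z) e" using e by (simp add: dist_norm)
  then obtain w where "w \<in> S" "f w = f z + complex_of_real (e / 2)" using e by force
  then show False using re[of w] re[of z] z e by simp
qed

locale clark_symbol =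
  fixes U :: "complex \<Rightarrow> complex" and \<alpha> :: complex and \<sigma> :: "real measure"
  assumes hol: "U holomorphic_on upper_half_plane"
    and alpha: "norm \<alpha> = 1"
    and clark: "clark_measure U \<alpha> 0 \<sigma>"
    and atoms_nonempty: "atoms \<sigma> \<noteq> {}"
    and boundary: "AE x in lebesgue. \<exists>l. nt_limit U x l \<and> norm l = 1"
begin

lemma sets_sigma [measurable_cong]: "sets \<sigma> = sets borel"
  using clark by (simp add: clark_measure_def)

lemma space_sigma [simp]: "space \<sigma> = UNIV"
  using sets_eq_imp_space_eq[OF sets_sigma] by simp

lemma alpha_cnj: "cnj \<alpha> * \<alpha> = 1"
  using alpha complex_norm_square[of \<alpha>] by (simp add: mult.commute)

lemma integrable_sigma: "0 < Im z \<Longrightarrow> integrable \<sigma> (\<lambda>x. 1 / (norm (complex_of_real x - z))\<^sup>2)"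
  and herglotz: "0 < Im z \<Longrightarrow> Re ((\<alpha> + U z) / (\<alpha> - U z)) =
     Im z / pi * (\<integral>x. 1 / (norm (complex_of_real x - z))\<^sup>2 \<partial>\<sigma>)"
  using clark by (auto simp: clark_measure_def)

text \<open>The measure charges a point, so its Poisson integral is strictly positive. As the Cayley
  transform of \<open>U / \<alpha>\<close> thus has positive real part, \<open>U\<close> maps into the open unit disc.\<close>

lemma herglotz_pos:
  assumes "0 < Im z"
  shows "0 < Re ((\<alpha> + U z) / (\<alpha> - U z))"
proof -
  let ?g = "\<lambda>x. 1 / (norm (complex_of_real x - z))\<^sup>2"
  have "(\<integral>x. ?g x \<partial>\<sigma>) \<noteq> 0"
  proof
    assume "(\<integral>x. ?g x \<partial>\<sigma>) = 0"
    then have "AE x in \<sigma>. ?g x = 0"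
      using integrable_sigma[OF assms] by (subst (asm) integral_nonneg_eq_0_iff_AE) auto
    moreover have "?g x \<noteq> 0" for x using assms real_minus_nonzero[of z x] by simp
    ultimately have "emeasure \<sigma> (space \<sigma>) = 0" by (simp add: AE_iff_measurable[OF _ refl] eventually_False)
    moreover obtain t where "emeasure \<sigma> {t} \<noteq> 0" using atoms_nonempty by (auto simp: atoms_def)
    ultimately show False
      using emeasure_mono[of "{t}" "space \<sigma>" \<sigma>] by simp
  qed
  moreover have "0 \<le> (\<integral>x. ?g x \<partial>\<sigma>)" by simp
  ultimately have "0 < (\<integral>x. ?g x \<partial>\<sigma>)" by linarith
  then show ?thesis using assms by (simp add: herglotz)
qed

lemma U_neq_alpha: "0 < Im z \<Longrightarrow> U z \<noteq> \<alpha>"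
  using herglotz_pos[of z] by auto

lemma norm_U_less: "0 < Im z \<Longrightarrow> norm (U z) < 1"
proof -
  assume z: "0 < Im z"
  have "0 < Re ((\<alpha> + U z) / (\<alpha> - U z)) * (norm (\<alpha> - U z))\<^sup>2"
    using herglotz_pos[OF z] U_neq_alpha[OF z] by simp
  then have "(norm (U z))\<^sup>2 < 1\<^sup>2" using Re_herglotz[OF alpha U_neq_alpha[OF z]] by simp
  then show "norm (U z) < 1" by (rule power2_less_imp_less) simp
qed

sublocale unimodular_symbol U
  using hol norm_U_less boundary by unfold_locales (auto intro: less_imp_le)

text \<open>An analytic function whose real part is, up to a constant, the Poisson integral of the Clark
  measure. Subtracting the value at \<open>\<i>\<close> makes the integrand decay like \<open>1 / x\<^sup>2\<close>.\<close>

definition W :: "complex \<Rightarrow> complex" where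
  "W z = 1 / (pi * \<i>) * (\<integral>x. 1 / (complex_of_real x - z) - 1 / (complex_of_real x - \<i>) \<partial>\<sigma>)"

lemma integrable_i: "integrable \<sigma> (\<lambda>x. 1 / (norm (complex_of_real x - \<i>))\<^sup>2)"
  using integrable_sigma[of \<i>] by simp

lemma difference_eq:
  assumes "0 < Im z" "0 < Im w"
  shows "1 / (complex_of_real x - z) - 1 / (complex_of_real x - w) =
     (z - w) / ((complex_of_real x - z) * (complex_of_real x - w))"
  using real_minus_nonzero[of z x] real_minus_nonzero[of w x] assms by (simp add: divide_simps)

lemma inverse_norm_le:
  assumes "0 < d" "d \<le> Im z" "norm (z - \<i>) \<le> K"
  shows "1 / norm (complex_of_real x - z) \<le> (1 + K / d) * (1 / norm (complex_of_real x - \<i>))"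
proof -
  have Im: "0 < Im z" using assms by linarith
  have p: "0 < norm (complex_of_real x - z)" "0 < norm (complex_of_real x - \<i>)"
    using real_minus_nonzero[of z x] real_minus_nonzero[of \<i> x] Im by auto
  have "1 + norm (z - \<i>) / Im z \<le> 1 + K / d"
    using assms norm_ge_zero[of "z - \<i>"] by (intro add_left_mono frac_le) linarith+
  then have "norm (complex_of_real x - \<i>) \<le> (1 + K / d) * norm (complex_of_real x - z)"
    using norm_minus_i_le[OF Im, of x] p mult_right_mono[of "1 + norm (z - \<i>) / Im z" "1 + K / d" "norm (complex_of_real x - z)"]
    by linarith
  then show ?thesis using p by (simp add: field_simps)
qed

text \<open>A majorant that is locally uniform in \<open>z\<close> and \<open>w\<close>, for differentiating the Herglotz integral.\<close>

lemma product_bound: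
  assumes "0 < d" "d \<le> Im z" "norm (z - \<i>) \<le> K" "d \<le> Im w" "norm (w - \<i>) \<le> K"
  shows "norm (1 / ((complex_of_real x - z) * (complex_of_real x - w)))
     \<le> (1 + K / d)\<^sup>2 * (1 / (norm (complex_of_real x - \<i>))\<^sup>2)"
proof -
  have "0 \<le> K" using assms(3) norm_ge_zero order_trans by blast
  then have "1 / norm (complex_of_real x - z) * (1 / norm (complex_of_real x - w))
     \<le> ((1 + K / d) * (1 / norm (complex_of_real x - \<i>))) * ((1 + K / d) * (1 / norm (complex_of_real x - \<i>)))"
    using assms by (intro mult_mono inverse_norm_le) auto
  then show ?thesis by (simp add: norm_divide norm_mult power2_eq_square mult_ac)
qed

lemma measurable_kernels [measurable]:
  "(\<lambda>x. 1 / ((complex_of_real x - z) * (complex_of_real x - w))) \<in> borel_measurable \<sigma>"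
  "(\<lambda>x. 1 / (complex_of_real x - z)) \<in> borel_measurable \<sigma>"
  by measurable

lemma integrable_product:
  assumes "0 < Im z" "0 < Im w"
  shows "integrable \<sigma> (\<lambda>x. 1 / ((complex_of_real x - z) * (complex_of_real x - w)))"
proof -
  define d where "d = min (Im z) (Im w)"
  define K where "K = max (norm (z - \<i>)) (norm (w - \<i>))"
  have "integrable \<sigma> (\<lambda>x. (1 + K / d)\<^sup>2 * (1 / (norm (complex_of_real x - \<i>))\<^sup>2))"
    using integrable_i by (rule integrable_mult_right)
  then show ?thesis
  proof (rule Bochner_Integration.integrable_bound)
    show "AE x in \<sigma>. norm (1 / ((complex_of_real x - z) * (complex_of_real x - w)))
        \<le> norm ((1 + K / d)\<^sup>2 * (1 / (norm (complex_of_real x - \<i>))\<^sup>2))"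
      using assms by (intro AE_I2 order_trans[OF product_bound[of d z K w]]) (auto simp: d_def K_def)
  qed measurable
qed

lemma integrable_difference:
  assumes "0 < Im z" "0 < Im w"
  shows "integrable \<sigma> (\<lambda>x. 1 / (complex_of_real x - z) - 1 / (complex_of_real x - w))"
  using integrable_mult_right[OF integrable_product[OF assms], of "z - w"]
  by (simp add: difference_eq[OF assms])

lemma W_diff:
  assumes "0 < Im z" "0 < Im w"
  shows "W z - W w = (z - w) / (pi * \<i>) * (\<integral>x. 1 / ((complex_of_real x - z) * (complex_of_real x - w)) \<partial>\<sigma>)"
proof -
  have "W z - W w = 1 / (pi * \<i>) *
     (\<integral>x. (1 / (complex_of_real x - z) - 1 / (complex_of_real x - \<i>))
        - (1 / (complex_of_real x - w) - 1 / (complex_of_real x - \<i>)) \<partial>\<sigma>)"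
    unfolding W_def right_diff_distrib[symmetric]
    using integrable_difference[OF assms(1), of \<i>] integrable_difference[OF assms(2), of \<i>]
    by (subst Bochner_Integration.integral_diff) auto
  also have "\<dots> = 1 / (pi * \<i>) * (\<integral>x. (z - w) * (1 / ((complex_of_real x - z) * (complex_of_real x - w))) \<partial>\<sigma>)"
    using difference_eq[OF assms] by simp
  also have "\<dots> = (z - w) / (pi * \<i>) * (\<integral>x. 1 / ((complex_of_real x - z) * (complex_of_real x - w)) \<partial>\<sigma>)"
    unfolding integral_mult_right_zero by simp
  finally show ?thesis .
qed

lemma W_holomorphic: "W holomorphic_on upper_half_plane"
proof (rule holomorphic_onI)
  fix z assume "z \<in> upper_half_plane"
  then have z: "0 < Im z" by simp
  \<comment> \<open>near \<open>z\<close> and away from the real line, so that \<open>product_bound\<close> holds with fixed constants\<close>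
  let ?S = "{w. Im z / 2 < Im w} \<inter> ball z 1"
  have S: "open ?S" "z \<in> ?S" by (intro open_Int open_halfspace_Im_gt open_ball) (use z in auto)
  let ?D = "1 / (pi * \<i>) * (\<integral>x. 1 / ((complex_of_real x - z) * (complex_of_real x - z)) \<partial>\<sigma>)"
  have "((\<lambda>y. (W y - W z) / (y - z)) \<longlongrightarrow> ?D) (at z within ?S)"
    unfolding tendsto_at_iff_sequentially o_def
  proof (intro allI impI)
    fix y :: "nat \<Rightarrow> complex" assume y: "\<forall>i. y i \<in> ?S - {z}" and lim: "y \<longlonglongrightarrow> z"
    define K where "K = norm (z - \<i>) + 1"
    have yb: "Im z / 2 \<le> Im (y i)" "norm (y i - \<i>) \<le> K" "y i \<noteq> z" "0 < Im (y i)" for i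
    proof -
      have "Im z / 2 < Im (y i)" "dist z (y i) < 1" "y i \<noteq> z" using y[rule_format, of i] by auto
      then show "Im z / 2 \<le> Im (y i)" "y i \<noteq> z" "0 < Im (y i)" using z by auto
      show "norm (y i - \<i>) \<le> K"
        using \<open>dist z (y i) < 1\<close> norm_triangle_ineq[of "y i - z" "z - \<i>"]
        by (simp add: K_def dist_norm norm_minus_commute)
    qed
    have "(\<lambda>i. \<integral>x. 1 / ((complex_of_real x - y i) * (complex_of_real x - z)) \<partial>\<sigma>) \<longlonglongrightarrow>
        (\<integral>x. 1 / ((complex_of_real x - z) * (complex_of_real x - z)) \<partial>\<sigma>)"
    proof (rule integral_dominated_convergence)
      show "integrable \<sigma> (\<lambda>x. (1 + K / (Im z / 2))\<^sup>2 * (1 / (norm (complex_of_real x - \<i>))\<^sup>2))"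
        using integrable_i by (rule integrable_mult_right)
      show "AE x in \<sigma>. norm (1 / ((complex_of_real x - y i) * (complex_of_real x - z)))
          \<le> (1 + K / (Im z / 2))\<^sup>2 * (1 / (norm (complex_of_real x - \<i>))\<^sup>2)" for i
        by (intro AE_I2 product_bound yb) (use z in \<open>auto simp: K_def\<close>)
      show "AE x in \<sigma>. (\<lambda>i. 1 / ((complex_of_real x - y i) * (complex_of_real x - z)))
          \<longlonglongrightarrow> 1 / ((complex_of_real x - z) * (complex_of_real x - z))"
        by (intro AE_I2 tendsto_intros lim) (use z in \<open>auto simp: complex_eq_iff\<close>)
    qed measurable
    then have "(\<lambda>i. 1 / (pi * \<i>) * (\<integral>x. 1 / ((complex_of_real x - y i) * (complex_of_real x - z)) \<partial>\<sigma>)) \<longlonglongrightarrow> ?D"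
      by (intro tendsto_intros)
    moreover have "1 / (pi * \<i>) * (\<integral>x. 1 / ((complex_of_real x - y i) * (complex_of_real x - z)) \<partial>\<sigma>)
        = (W (y i) - W z) / (y i - z)" for i
      using yb(3)[of i] by (simp add: W_diff[OF yb(4) z])
    ultimately show "(\<lambda>i. (W (y i) - W z) / (y i - z)) \<longlonglongrightarrow> ?D" by simp
  qed
  then have "(W has_field_derivative ?D) (at z)"
    by (simp only: at_within_open[OF S(2) S(1)] has_field_derivative_iff)
  then show "W field_differentiable at z within upper_half_plane"
    by (auto simp: field_differentiable_def intro: has_field_derivative_at_within)
qed

lemma Re_W:
  assumes z: "0 < Im z"
  shows "Re (W z) = Re ((\<alpha> + U z) / (\<alpha> - U z)) - Re ((\<alpha> + U \<i>) / (\<alpha> - U \<i>))"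
proof -
  let ?h = "\<lambda>x. 1 / (complex_of_real x - z) - 1 / (complex_of_real x - \<i>)"
  have "W z = - \<i> / pi * (\<integral>x. ?h x \<partial>\<sigma>)" by (simp add: W_def field_simps)
  then have "Re (W z) = Im (\<integral>x. ?h x \<partial>\<sigma>) / pi" by simp
  also have "Im (\<integral>x. ?h x \<partial>\<sigma>) = (\<integral>x. Im (?h x) \<partial>\<sigma>)"
    by (rule integral_Im[OF integrable_difference[OF z], symmetric]) simp
  also have "\<dots> = (\<integral>x. Im z * (1 / (norm (complex_of_real x - z))\<^sup>2) - 1 / (norm (complex_of_real x - \<i>))\<^sup>2 \<partial>\<sigma>)"
    by (intro Bochner_Integration.integral_cong refl) (simp add: Im_divide cmod_power2)
  also have "\<dots> = Im z * (\<integral>x. 1 / (norm (complex_of_real x - z))\<^sup>2 \<partial>\<sigma>) - (\<integral>x. 1 / (norm (complex_of_real x - \<i>))\<^sup>2 \<partial>\<sigma>)"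
    using integrable_sigma[OF z] integrable_i
    by (simp only: Bochner_Integration.integral_diff integrable_mult_right integral_mult_right_zero)
  finally show ?thesis using z by (simp add: herglotz diff_divide_distrib)
qed

text \<open>Both functions are analytic with the same real part up to a constant.\<close>

lemma herglotz_eq_W:
  "\<exists>k. \<forall>z. 0 < Im z \<longrightarrow> (\<alpha> + U z) / (\<alpha> - U z) = W z + k"
proof -
  have "(\<lambda>z. (\<alpha> + U z) / (\<alpha> - U z) - W z) constant_on upper_half_plane"
  proof (rule constant_Re_imp_constant)
    show "(\<lambda>z. (\<alpha> + U z) / (\<alpha> - U z) - W z) holomorphic_on upper_half_plane"
      by (intro holomorphic_intros hol W_holomorphic) (metis U_neq_alpha eq_iff_diff_eq_0 uhp_iff)
    show "Re ((\<alpha> + U z) / (\<alpha> - U z) - W z) = Re ((\<alpha> + U \<i>) / (\<alpha> - U \<i>))" if "z \<in> upper_half_plane" for z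
      using Re_W[of z] that by simp
  qed (use uhp_open uhp_convex convex_connected in auto)
  then show ?thesis
    unfolding constant_on_def by (metis uhp_iff diff_add_cancel add.commute)
qed

lemma emeasure_singleton_finite: "emeasure \<sigma> {t} < \<infinity>"
proof -
  have "integrable \<sigma> (\<lambda>x. (1 + t\<^sup>2) * (1 / (norm (complex_of_real x - \<i>))\<^sup>2))"
    using integrable_i by (rule integrable_mult_right)
  then have "integrable \<sigma> (indicator {t} :: real \<Rightarrow> real)"
  proof (rule Bochner_Integration.integrable_bound)
    show "AE x in \<sigma>. norm (indicator {t} x :: real) \<le> norm ((1 + t\<^sup>2) * (1 / (norm (complex_of_real x - \<i>))\<^sup>2))"
      by (intro AE_I2) (auto simp: indicator_def norm_complex_minus_i abs_of_nonneg add_nonneg_eq_0_iff)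
  qed simp
  then show ?thesis by (simp add: integrable_indicator_iff)
qed

abbreviation mass :: "real \<Rightarrow> real" where "mass t \<equiv> measure \<sigma> {t}"

lemma mass_pos: "t \<in> atoms \<sigma> \<Longrightarrow> 0 < mass t"
  using emeasure_singleton_finite[of t]
  by (simp add: atoms_def measure_def enn2real_positive_iff zero_less_iff_neq_zero)

lemma cone_norm_le:
  assumes "cone_sequence \<kappa> t \<zeta>"
  shows "norm (\<zeta> j - complex_of_real t) \<le> (\<kappa> + 1) * Im (\<zeta> j)"
proof -
  have "norm (\<zeta> j - complex_of_real t) \<le> \<bar>Re (\<zeta> j - complex_of_real t)\<bar> + \<bar>Im (\<zeta> j - complex_of_real t)\<bar>"
    by (rule cmod_le)
  also have "\<dots> \<le> \<kappa> * Im (\<zeta> j) + Im (\<zeta> j)"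
    using assms by (intro add_mono) (auto simp: cone_sequence_def less_imp_le)
  finally show ?thesis by (simp add: algebra_simps)
qed

text \<open>An atom at \<open>t\<close> makes \<open>W\<close> blow up like \<open>1 / (\<zeta> - t)\<close>: in the integral for
  \<open>(\<zeta> - t) W \<zeta>\<close> the integrand tends, up to the factor \<open>1 / (pi i)\<close>, to \<open>-1\<close> at \<open>t\<close> and to \<open>0\<close>
  elsewhere, and within a cone it is dominated.\<close>

lemma W_atom:
  assumes \<zeta>: "cone_sequence \<kappa> t \<zeta>"
  shows "(\<lambda>j. (\<zeta> j - complex_of_real t) * W (\<zeta> j)) \<longlonglongrightarrow> \<i> * complex_of_real (mass t) / pi"
proof -
  have Im: "\<And>j. 0 < Im (\<zeta> j)" and lim: "\<zeta> \<longlonglongrightarrow> complex_of_real t" and \<kappa>: "0 < \<kappa>"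
    using \<zeta> by (auto simp: cone_sequence_def)
  \<comment> \<open>The domination combines \<open>\<bar>\<zeta> - t\<bar> \<le> (\<kappa> + 1) \<bar>x - \<zeta>\<bar>\<close>, valid in the cone, with the triangle inequality
    for \<open>\<bar>x - \<i>\<bar>\<close>; \<open>K\<close> bounds the distances of the \<open>\<zeta> j\<close> from \<open>\<i>\<close>.\<close>
  let ?h = "\<lambda>j x. (\<zeta> j - complex_of_real t) * (1 / (complex_of_real x - \<zeta> j) - 1 / (complex_of_real x - \<i>))"
  have "(\<lambda>j. \<zeta> j - \<i>) \<longlonglongrightarrow> complex_of_real t - \<i>" by (intro tendsto_intros lim)
  then have "Bseq (\<lambda>j. \<zeta> j - \<i>)" by (intro convergent_imp_Bseq convergentI)
  then obtain K where K: "\<And>j. norm (\<zeta> j - \<i>) \<le> K"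
    unfolding Bseq_def by blast
  have K0: "0 \<le> K" using K[of 0] norm_ge_zero order_trans by blast
  have "(\<lambda>j. \<integral>x. ?h j x \<partial>\<sigma>) \<longlonglongrightarrow> (\<integral>x. - complex_of_real (indicator {t} x) \<partial>\<sigma>)"
  proof (rule integral_dominated_convergence[where w = "\<lambda>x. (\<kappa> + 2) * (2 * K + norm (complex_of_real t - \<i>)) * K * (1 / (norm (complex_of_real x - \<i>))\<^sup>2)"])
    show "integrable \<sigma> (\<lambda>x. (\<kappa> + 2) * (2 * K + norm (complex_of_real t - \<i>)) * K * (1 / (norm (complex_of_real x - \<i>))\<^sup>2))"
      using integrable_i by (rule integrable_mult_right)
    show "AE x in \<sigma>. norm (?h j x) \<le> (\<kappa> + 2) * (2 * K + norm (complex_of_real t - \<i>)) * K * (1 / (norm (complex_of_real x - \<i>))\<^sup>2)" for j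
    proof (rule AE_I2)
      fix x
      let ?p = "norm (complex_of_real x - \<zeta> j)" and ?q = "norm (complex_of_real x - \<i>)"
      let ?r = "norm (\<zeta> j - complex_of_real t)"
      have p: "0 < ?p" "0 < ?q" using real_minus_nonzero[of "\<zeta> j" x] real_minus_nonzero[of \<i> x] Im[of j] by auto
      have rp: "?r \<le> (\<kappa> + 1) * ?p"
        using cone_norm_le[OF \<zeta>, of j] mult_left_mono[OF Im_le_norm_real_minus[of "\<zeta> j" x], of "\<kappa> + 1"] \<kappa> Im[of j]
        by linarith
      have rK: "?r \<le> K + norm (complex_of_real t - \<i>)"
        using norm_triangle_ineq4[of "\<zeta> j - \<i>" "complex_of_real t - \<i>"] K[of j] by simp
      have "?q \<le> ?p + norm (\<zeta> j - \<i>)"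
        using norm_triangle_ineq[of "complex_of_real x - \<zeta> j" "\<zeta> j - \<i>"] by simp
      then have "?r * ?q \<le> ?r * (?p + K)" using K[of j] by (intro mult_left_mono) auto
      also have "\<dots> = ?r * ?p + ?r * K" by (simp add: algebra_simps)
      also have "\<dots> \<le> (K + norm (complex_of_real t - \<i>)) * ?p + ((\<kappa> + 1) * ?p) * K"
        using rK rp K0 by (intro add_mono mult_right_mono) auto
      also have "\<dots> \<le> ((\<kappa> + 2) * (2 * K + norm (complex_of_real t - \<i>))) * ?p"
      proof -
        have "0 \<le> \<kappa> * norm (complex_of_real t - \<i>)" "0 \<le> K * \<kappa>" using \<kappa> K0 by auto
        then have "(K + norm (complex_of_real t - \<i>)) + (\<kappa> + 1) * K \<le> (\<kappa> + 2) * (2 * K + norm (complex_of_real t - \<i>))"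
          using K0 by (simp add: algebra_simps)
        from mult_right_mono[OF this, of ?p] show ?thesis by (simp add: algebra_simps)
      qed
      finally have main: "?r / ?p \<le> (\<kappa> + 2) * (2 * K + norm (complex_of_real t - \<i>)) / ?q"
        using p by (simp add: field_simps)
      have "norm (?h j x) = ?r / ?p * norm (\<zeta> j - \<i>) / ?q"
        unfolding difference_eq[OF Im, of \<i>, simplified] by (simp add: norm_mult norm_divide)
      also have "\<dots> \<le> (\<kappa> + 2) * (2 * K + norm (complex_of_real t - \<i>)) / ?q * K / ?q"
        using main K[of j] K0 \<kappa> p by (intro divide_right_mono mult_mono) auto
      finally show "norm (?h j x) \<le> (\<kappa> + 2) * (2 * K + norm (complex_of_real t - \<i>)) * K * (1 / ?q\<^sup>2)"
        by (simp add: power2_eq_square)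
    qed
    show "AE x in \<sigma>. (\<lambda>j. ?h j x) \<longlonglongrightarrow> - complex_of_real (indicator {t} x)"
    proof (rule AE_I2)
      fix x
      have 1: "(\<lambda>j. (\<zeta> j - complex_of_real t) * (1 / (complex_of_real x - \<i>))) \<longlonglongrightarrow>
          (complex_of_real t - complex_of_real t) * (1 / (complex_of_real x - \<i>))"
        by (intro tendsto_intros lim)
      have 2: "(\<lambda>j. (\<zeta> j - complex_of_real t) * (1 / (complex_of_real x - \<zeta> j))) \<longlonglongrightarrow> - complex_of_real (indicator {t} x)"
      proof (cases "x = t")
        case True
        have "(\<zeta> j - complex_of_real t) * (1 / (complex_of_real x - \<zeta> j)) = - 1" for j
          using real_minus_nonzero[of "\<zeta> j" t] Im[of j] True by (simp add: field_simps)
        then show ?thesis using True by simp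
      next
        case False
        have "(\<lambda>j. (\<zeta> j - complex_of_real t) * (1 / (complex_of_real x - \<zeta> j))) \<longlonglongrightarrow>
          (complex_of_real t - complex_of_real t) * (1 / (complex_of_real x - complex_of_real t))"
          using False by (intro tendsto_intros lim) auto
        then show ?thesis using False by simp
      qed
      show "(\<lambda>j. ?h j x) \<longlonglongrightarrow> - complex_of_real (indicator {t} x)"
        using tendsto_diff[OF 2 1] by (simp add: right_diff_distrib)
    qed
  qed measurable
  then have "(\<lambda>j. 1 / (pi * \<i>) * (\<integral>x. ?h j x \<partial>\<sigma>)) \<longlonglongrightarrow> 1 / (pi * \<i>) * (\<integral>x. - complex_of_real (indicator {t} x) \<partial>\<sigma>)"
    by (intro tendsto_intros)
  moreover have "1 / (pi * \<i>) * (\<integral>x. ?h j x \<partial>\<sigma>) = (\<zeta> j - complex_of_real t) * W (\<zeta> j)" for j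
    unfolding integral_mult_right_zero W_def by simp
  moreover have "1 / (pi * \<i>) * (\<integral>x. - complex_of_real (indicator {t} x) \<partial>\<sigma>) = \<i> * complex_of_real (mass t) / pi"
    by (simp add: field_simps)
  ultimately show ?thesis by simp
qed

text \<open>Solving \<open>(\<alpha> + U) / (\<alpha> - U) = W + k\<close> for \<open>U\<close> gives \<open>\<alpha> - U = 2 \<alpha> / (W + k + 1)\<close>, so the
  blow-up of \<open>W\<close> at an atom makes \<open>\<alpha> - U\<close> vanish there to first order. The limit is the negative of
  the angular derivative.\<close>

lemma U_quotient_limit:
  assumes t: "t \<in> atoms \<sigma>" and \<zeta>: "cone_sequence \<kappa> t \<zeta>"
  shows "(\<lambda>j. (\<alpha> - U (\<zeta> j)) / (\<zeta> j - complex_of_real t)) \<longlonglongrightarrow> 2 * pi * \<alpha> / (\<i> * mass t)"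
proof -
  have Im: "\<And>j. 0 < Im (\<zeta> j)" and lim: "\<zeta> \<longlonglongrightarrow> complex_of_real t"
    using \<zeta> by (auto simp: cone_sequence_def)
  obtain k where k: "\<And>z. 0 < Im z \<Longrightarrow> (\<alpha> + U z) / (\<alpha> - U z) = W z + k" using herglotz_eq_W by blast
  have "(\<lambda>j. (\<zeta> j - complex_of_real t) * W (\<zeta> j) + (\<zeta> j - complex_of_real t) * (k + 1)) \<longlonglongrightarrow>
      \<i> * complex_of_real (mass t) / pi + (complex_of_real t - complex_of_real t) * (k + 1)"
    by (intro tendsto_intros W_atom[OF \<zeta>] lim)
  moreover have "(\<zeta> j - complex_of_real t) * W (\<zeta> j) + (\<zeta> j - complex_of_real t) * (k + 1) =
      (\<zeta> j - complex_of_real t) * (W (\<zeta> j) + k + 1)" for j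
    by (simp add: algebra_simps)
  ultimately have "(\<lambda>j. (\<zeta> j - complex_of_real t) * (W (\<zeta> j) + k + 1)) \<longlonglongrightarrow> \<i> * complex_of_real (mass t) / pi"
    by simp
  then have "(\<lambda>j. 2 * \<alpha> / ((\<zeta> j - complex_of_real t) * (W (\<zeta> j) + k + 1))) \<longlonglongrightarrow>
      2 * \<alpha> / (\<i> * complex_of_real (mass t) / pi)"
    using mass_pos[OF t] by (intro tendsto_intros) auto
  moreover have "2 * \<alpha> / ((\<zeta> j - complex_of_real t) * (W (\<zeta> j) + k + 1)) =
      (\<alpha> - U (\<zeta> j)) / (\<zeta> j - complex_of_real t)" for j
  proof -
    have n: "\<alpha> - U (\<zeta> j) \<noteq> 0" using U_neq_alpha[OF Im[of j]] by auto
    have "W (\<zeta> j) + k + 1 = (\<alpha> + U (\<zeta> j)) / (\<alpha> - U (\<zeta> j)) + (\<alpha> - U (\<zeta> j)) / (\<alpha> - U (\<zeta> j))"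
      using n k[OF Im[of j]] by simp
    also have "\<dots> = 2 * \<alpha> / (\<alpha> - U (\<zeta> j))"
      unfolding add_divide_distrib[symmetric] by simp
    finally have eq: "W (\<zeta> j) + k + 1 = 2 * \<alpha> / (\<alpha> - U (\<zeta> j))" .
    have "\<alpha> \<noteq> 0" using alpha by auto
    moreover have "\<zeta> j - complex_of_real t \<noteq> 0" using Im[of j] by (auto simp: complex_eq_iff)
    ultimately show ?thesis unfolding eq using n by (simp add: divide_simps)
  qed
  ultimately show ?thesis by (simp add: field_simps)
qed

lemma U_nt_limit:
  assumes t: "t \<in> atoms \<sigma>"
  shows "nt_limit U t \<alpha>"
proof (rule nt_limitI)
  fix \<kappa> \<zeta> assume \<zeta>: "cone_sequence \<kappa> t \<zeta>"
  have Im: "\<And>j. 0 < Im (\<zeta> j)" and lim: "\<zeta> \<longlonglongrightarrow> complex_of_real t"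
    using \<zeta> by (auto simp: cone_sequence_def)
  have "(\<lambda>j. \<alpha> - (\<zeta> j - complex_of_real t) * ((\<alpha> - U (\<zeta> j)) / (\<zeta> j - complex_of_real t))) \<longlonglongrightarrow>
      \<alpha> - (complex_of_real t - complex_of_real t) * (2 * pi * \<alpha> / (\<i> * mass t))"
    by (intro tendsto_intros U_quotient_limit[OF t \<zeta>] lim)
  moreover have "\<zeta> j - complex_of_real t \<noteq> 0" for j using Im[of j] by (auto simp: complex_eq_iff)
  ultimately show "(\<lambda>j. U (\<zeta> j)) \<longlonglongrightarrow> \<alpha>" by simp
qed

lemma U_at_atom: "t \<in> atoms \<sigma> \<Longrightarrow> hp_ext U (complex_of_real t) = \<alpha>"
  by (rule hp_ext_of_real[OF U_nt_limit])

lemma kernel_at_atom: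
  assumes "t \<in> atoms \<sigma>" "0 < Im z"
  shows "model_kernel U (complex_of_real t) z =
     \<i> / (2 * pi) * cnj \<alpha> * ((\<alpha> - U z) / (z - complex_of_real t))"
proof -
  have "1 - cnj \<alpha> * U z = cnj \<alpha> * (\<alpha> - U z)" using alpha_cnj by (simp add: algebra_simps)
  then show ?thesis using assms by (simp add: model_kernel_def U_at_atom)
qed

text \<open>If \<open>s = t\<close> the value is read off from the angular derivative; otherwise the numerator \<open>\<alpha> - U\<close>
  tends to \<open>0\<close> while the denominator does not.\<close>

lemma kernel_at_atom_limit:
  assumes s: "s \<in> atoms \<sigma>" and t: "t \<in> atoms \<sigma>" and \<zeta>: "cone_sequence \<kappa> t \<zeta>"
  shows "(\<lambda>j. model_kernel U (complex_of_real s) (\<zeta> j)) \<longlonglongrightarrow> (if s = t then 1 / complex_of_real (mass t) else 0)"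
proof -
  have Im: "\<And>j. 0 < Im (\<zeta> j)" and lim: "\<zeta> \<longlonglongrightarrow> complex_of_real t"
    using \<zeta> by (auto simp: cone_sequence_def)
  have "(\<lambda>j. \<i> / (2 * pi) * cnj \<alpha> * ((\<alpha> - U (\<zeta> j)) / (\<zeta> j - complex_of_real s))) \<longlonglongrightarrow>
     (if s = t then 1 / complex_of_real (mass t) else 0)"
  proof (cases "s = t")
    case True
    have "(\<lambda>j. \<i> / (2 * pi) * cnj \<alpha> * ((\<alpha> - U (\<zeta> j)) / (\<zeta> j - complex_of_real t))) \<longlonglongrightarrow>
       \<i> / (2 * pi) * cnj \<alpha> * (2 * pi * \<alpha> / (\<i> * mass t))"
      by (intro tendsto_intros U_quotient_limit[OF t \<zeta>])
    also have "\<i> / (2 * pi) * cnj \<alpha> * (2 * pi * \<alpha> / (\<i> * mass t)) = (cnj \<alpha> * \<alpha>) / mass t"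
      by (simp add: field_simps)
    finally show ?thesis using True by (simp add: alpha_cnj)
  next
    case False
    have "(\<lambda>j. \<i> / (2 * pi) * cnj \<alpha> * ((\<alpha> - U (\<zeta> j)) / (\<zeta> j - complex_of_real s))) \<longlonglongrightarrow>
       \<i> / (2 * pi) * cnj \<alpha> * ((\<alpha> - \<alpha>) / (complex_of_real t - complex_of_real s))"
      using False by (intro tendsto_intros nt_limit_cone_sequence[OF U_nt_limit[OF t] \<zeta>] lim) auto
    then show ?thesis using False by simp
  qed
  then show ?thesis by (simp add: kernel_at_atom[OF s Im])
qed

text \<open>The squared norm is \<open>(1 - \<bar>U\<bar>\<^sup>2) / (4 pi Im z)\<close>. Its numerator is at most \<open>2 \<bar>\<alpha> - U\<bar>\<close>, which is of
  the order of \<open>\<bar>z - t\<bar>\<close>, hence of \<open>Im z\<close> inside a cone.\<close>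

lemma kernel_norm_bounded:
  assumes t: "t \<in> atoms \<sigma>" and \<zeta>: "cone_sequence \<kappa> t \<zeta>"
  shows "\<exists>C. \<forall>j. (l2_norm (kernel_on_line U (\<zeta> j)))\<^sup>2 \<le> C"
proof -
  have Im: "\<And>j. 0 < Im (\<zeta> j)" and \<kappa>: "0 < \<kappa>"
    using \<zeta> by (auto simp: cone_sequence_def)
  have "Bseq (\<lambda>j. (\<alpha> - U (\<zeta> j)) / (\<zeta> j - complex_of_real t))"
    by (intro convergent_imp_Bseq convergentI[OF U_quotient_limit[OF t \<zeta>]])
  then obtain B where B: "\<And>j. norm ((\<alpha> - U (\<zeta> j)) / (\<zeta> j - complex_of_real t)) \<le> B"
    unfolding Bseq_def by blast
  have B0: "0 \<le> B" using B[of 0] norm_ge_zero order_trans by blast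
  have "(l2_norm (kernel_on_line U (\<zeta> j)))\<^sup>2 \<le> 2 * (B * (\<kappa> + 1)) / (4 * pi)" for j
  proof -
    let ?n = "norm (U (\<zeta> j))"
    have n: "0 \<le> ?n" "?n \<le> 1" using norm_U_less[OF Im[of j]] by auto
    have "1 - ?n\<^sup>2 = (1 - ?n) * (1 + ?n)" by (simp add: power2_eq_square algebra_simps)
    also have "\<dots> \<le> norm (\<alpha> - U (\<zeta> j)) * 2"
      using n norm_triangle_ineq2[of \<alpha> "U (\<zeta> j)"] alpha by (intro mult_mono) auto
    also have "norm (\<alpha> - U (\<zeta> j)) \<le> B * norm (\<zeta> j - complex_of_real t)"
    proof -
      have "0 < norm (\<zeta> j - complex_of_real t)" using Im[of j] by (auto simp: complex_eq_iff)
      then show ?thesis using B[of j] by (simp add: norm_divide divide_le_eq)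
    qed
    also have "\<dots> \<le> B * ((\<kappa> + 1) * Im (\<zeta> j))"
      by (intro mult_left_mono cone_norm_le[OF \<zeta>] B0)
    finally have "1 - ?n\<^sup>2 \<le> 2 * (B * (\<kappa> + 1)) * Im (\<zeta> j)" by (simp add: mult_ac)
    then have "(1 - ?n\<^sup>2) / (4 * pi * Im (\<zeta> j)) \<le> 2 * (B * (\<kappa> + 1)) * Im (\<zeta> j) / (4 * pi * Im (\<zeta> j))"
      using Im[of j] by (intro divide_right_mono) auto
    then show ?thesis using Im[of j] by (simp add: kernel_norm)
  qed
  then show ?thesis by blast
qed

text \<open>As the point moves to an atom inside a cone, the kernels stay bounded in norm and converge
  pointwise, hence weakly. All facts about kernels at atoms are limits of facts about kernels in
  the half-plane.\<close>

lemma kernel_weak_limit: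
  assumes t: "t \<in> atoms \<sigma>" and \<zeta>: "cone_sequence \<kappa> t \<zeta>"
  shows "kernel_on_line U (complex_of_real t) \<in> L2"
    and "\<phi> \<in> L2 \<Longrightarrow> (\<lambda>j. l2_inner (kernel_on_line U (\<zeta> j)) \<phi>) \<longlonglongrightarrow> l2_inner (kernel_on_line U (complex_of_real t)) \<phi>"
proof -
  have Im: "\<And>j. 0 < Im (\<zeta> j)" and lim: "\<zeta> \<longlonglongrightarrow> complex_of_real t"
    using \<zeta> by (auto simp: cone_sequence_def)
  obtain C where C: "\<And>j. (l2_norm (kernel_on_line U (\<zeta> j)))\<^sup>2 \<le> C" using kernel_norm_bounded[OF t \<zeta>] by blast
  have ae: "AE x in lebesgue. (\<lambda>j. kernel_on_line U (\<zeta> j) x) \<longlonglongrightarrow> kernel_on_line U (complex_of_real t) x"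
    using AE_completion[OF AE_lborel_singleton[of t]]
  proof eventually_elim
    case (elim x)
    have "(\<lambda>j. \<i> / (2 * pi) * ((1 - cnj (U (\<zeta> j)) * u x) / (complex_of_real x - cnj (\<zeta> j)))) \<longlonglongrightarrow>
       \<i> / (2 * pi) * ((1 - cnj \<alpha> * u x) / (complex_of_real x - cnj (complex_of_real t)))"
      using elim by (intro tendsto_intros lim nt_limit_cone_sequence[OF U_nt_limit[OF t] \<zeta>]) auto
    then show ?case
      by (simp add: kernel_on_line_def model_kernel_def Im U_at_atom[OF t])
  qed
  show "kernel_on_line U (complex_of_real t) \<in> L2"
    by (rule L2_fatou(1)[OF kernel_L2[OF Im] C ae])
  show "(\<lambda>j. l2_inner (kernel_on_line U (\<zeta> j)) \<phi>) \<longlonglongrightarrow> l2_inner (kernel_on_line U (complex_of_real t)) \<phi>"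
    if "\<phi> \<in> L2" by (rule L2_weak_limit[OF kernel_L2[OF Im] C ae that])
qed

lemma atom_kernel_L2: "t \<in> atoms \<sigma> \<Longrightarrow> kernel_on_line U (complex_of_real t) \<in> L2"
  using kernel_weak_limit(1) vertical_cone_sequence by blast

lemma reproducing_imp_nt_limit:
  assumes f: "f \<in> L2" and F: "\<And>z. 0 < Im z \<Longrightarrow> l2_inner f (kernel_on_line U z) = F z"
    and t: "t \<in> atoms \<sigma>"
  shows "nt_limit F t (l2_inner f (kernel_on_line U (complex_of_real t)))"
proof (rule nt_limitI)
  fix \<kappa> \<zeta> assume \<zeta>: "cone_sequence \<kappa> t \<zeta>"
  then have Im: "0 < Im (\<zeta> j)" for j by (auto simp: cone_sequence_def)
  have "(\<lambda>j. cnj (l2_inner (kernel_on_line U (\<zeta> j)) f)) \<longlonglongrightarrow> cnj (l2_inner (kernel_on_line U (complex_of_real t)) f)"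
    by (intro tendsto_cnj kernel_weak_limit(2)[OF t \<zeta> f])
  then show "(\<lambda>j. F (\<zeta> j)) \<longlonglongrightarrow> l2_inner f (kernel_on_line U (complex_of_real t))"
    by (simp add: l2_inner_cnj F Im)
qed

lemma model_kernel_atom_limit:
  assumes t: "t \<in> atoms \<sigma>" and \<zeta>: "cone_sequence \<kappa> t \<zeta>" and z: "0 < Im z"
  shows "(\<lambda>j. model_kernel U (\<zeta> j) z) \<longlonglongrightarrow> model_kernel U (complex_of_real t) z"
proof -
  have Im: "\<And>j. 0 < Im (\<zeta> j)" and lim: "\<zeta> \<longlonglongrightarrow> complex_of_real t"
    using \<zeta> by (auto simp: cone_sequence_def)
  have "z - cnj (complex_of_real t) \<noteq> 0" using z by (auto simp: complex_eq_iff)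
  then have "(\<lambda>j. \<i> / (2 * pi) * ((1 - cnj (U (\<zeta> j)) * U z) / (z - cnj (\<zeta> j)))) \<longlonglongrightarrow>
     \<i> / (2 * pi) * ((1 - cnj \<alpha> * U z) / (z - cnj (complex_of_real t)))"
    by (intro tendsto_intros lim nt_limit_cone_sequence[OF U_nt_limit[OF t] \<zeta>])
  then show ?thesis using z by (simp add: model_kernel_def Im U_at_atom[OF t])
qed

lemma atom_kernel_inner:
  assumes t: "t \<in> atoms \<sigma>" and z: "0 < Im z"
  shows "l2_inner (kernel_on_line U (complex_of_real t)) (kernel_on_line U z) = model_kernel U (complex_of_real t) z"
proof -
  let ?\<zeta> = "\<lambda>j. Complex t (inverse (real (Suc j)))"
  have "(\<lambda>j. model_kernel U (?\<zeta> j) z) \<longlonglongrightarrow> l2_inner (kernel_on_line U (complex_of_real t)) (kernel_on_line U z)"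
    using kernel_weak_limit(2)[OF t vertical_cone_sequence kernel_L2[OF z]] by (simp add: kernel_inner z)
  moreover have "(\<lambda>j. model_kernel U (?\<zeta> j) z) \<longlonglongrightarrow> model_kernel U (complex_of_real t) z"
    by (rule model_kernel_atom_limit[OF t vertical_cone_sequence z])
  ultimately show ?thesis by (rule LIMSEQ_unique)
qed

lemma atom_kernel_poisson:
  assumes t: "t \<in> atoms \<sigma>" and z: "0 < Im z"
  shows "l2_inner (kernel_on_line U (complex_of_real t)) (\<lambda>x. complex_of_real (poisson_kernel z x)) =
     model_kernel U (complex_of_real t) z"
proof -
  let ?\<zeta> = "\<lambda>j. Complex t (inverse (real (Suc j)))"
  have "(\<lambda>j. model_kernel U (?\<zeta> j) z) \<longlonglongrightarrow>
      l2_inner (kernel_on_line U (complex_of_real t)) (\<lambda>x. complex_of_real (poisson_kernel z x))"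
    using kernel_weak_limit(2)[OF t vertical_cone_sequence poisson_kernel_L2[OF z]]
    by (simp add: hardy_poisson[OF kernel_hardy z])
  moreover have "(\<lambda>j. model_kernel U (?\<zeta> j) z) \<longlonglongrightarrow> model_kernel U (complex_of_real t) z"
    by (rule model_kernel_atom_limit[OF t vertical_cone_sequence z])
  ultimately show ?thesis by (rule LIMSEQ_unique)
qed

lemma atom_kernels_orthogonal:
  assumes s: "s \<in> atoms \<sigma>" and t: "t \<in> atoms \<sigma>"
  shows "l2_inner (kernel_on_line U (complex_of_real s)) (kernel_on_line U (complex_of_real t)) =
     (if s = t then 1 / complex_of_real (mass t) else 0)"
proof -
  have "nt_limit (model_kernel U (complex_of_real s)) t
      (l2_inner (kernel_on_line U (complex_of_real s)) (kernel_on_line U (complex_of_real t)))"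
    by (rule reproducing_imp_nt_limit[OF atom_kernel_L2[OF s] atom_kernel_inner[OF s] t])
  from nt_limit_cone_sequence[OF this vertical_cone_sequence]
  show ?thesis using kernel_at_atom_limit[OF s t vertical_cone_sequence] by (rule LIMSEQ_unique)
qed

lemma atom_kernel_norm:
  assumes "t \<in> atoms \<sigma>"
  shows "(l2_norm (kernel_on_line U (complex_of_real t)))\<^sup>2 = 1 / mass t"
proof -
  have "complex_of_real ((l2_norm (kernel_on_line U (complex_of_real t)))\<^sup>2) = complex_of_real (1 / mass t)"
    using atom_kernels_orthogonal[OF assms assms] by (simp add: l2_inner_self)
  then show ?thesis unfolding of_real_eq_iff .
qed

end

section \<open>Completeness of the kernels at the atoms\<close>

text \<open>The atoms are enumerated as \<open>e\<^sub>0, e\<^sub>1, \<dots>\<close>. Almost everywhere \<open>g\<close> is the limit of its restrictions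
  to finitely many of them, so dominated convergence applies.\<close>

lemma purely_atomic_has_sum:
  fixes x :: "int \<Rightarrow> real" and g :: "real \<Rightarrow> real"
  assumes sets: "sets \<sigma> = sets borel" and atomic: "purely_atomic \<sigma>"
    and x: "inj x" "range x = atoms \<sigma>" and g: "integrable \<sigma> g" "\<And>t. 0 \<le> g t"
  shows "((\<lambda>n. measure \<sigma> {x n} * g (x n)) has_sum (\<integral>t. g t \<partial>\<sigma>)) UNIV"
proof -
  define e where "e = (\<lambda>i. x (int_decode i))"
  have e: "inj e" "range e = range x"
    using x(1) bij_int_decode by (auto simp: e_def inj_def bij_def image_comp[symmetric] o_def image_iff surj_def) metis+
  have space: "space \<sigma> = UNIV" using sets_eq_imp_space_eq[OF sets] by simp
  have countable_sets: "A \<in> sets \<sigma>" if "countable A" for A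
    using that sets by (simp add: sets.countable)
  have "countable (range x)" by simp
  then have B: "UNIV - range x \<in> sets \<sigma>" using countable_sets[of "range x"] sets.compl_sets space by metis
  then have "emeasure \<sigma> (UNIV - range x) = (\<Sum>\<^sub>\<infinity>t\<in>(UNIV - range x) \<inter> atoms \<sigma>. emeasure \<sigma> {t})"
    using atomic by (simp add: purely_atomic_def)
  also have "(UNIV - range x) \<inter> atoms \<sigma> = {}" using x(2) by auto
  finally have "UNIV - range x \<in> null_sets \<sigma>" using B by (simp add: null_sets_def)
  then have ae: "AE t in \<sigma>. t \<in> range e"
    by (rule AE_I') (auto simp: e(2))
  define s where "s = (\<lambda>k t. g t * indicator (e ` {..<k}) t)"
  have [measurable]: "g \<in> borel_measurable \<sigma>" using g(1) by simp
  have s_measurable: "s k \<in> borel_measurable \<sigma>" for k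
    unfolding s_def using countable_sets[of "e ` {..<k}"] by simp
  have "(\<lambda>k. \<integral>t. s k t \<partial>\<sigma>) \<longlonglongrightarrow> (\<integral>t. g t \<partial>\<sigma>)"
  proof (rule integral_dominated_convergence[where w = g])
    show "AE t in \<sigma>. (\<lambda>k. s k t) \<longlonglongrightarrow> g t"
      using ae
    proof eventually_elim
      case (elim t)
      then obtain i where i: "t = e i" by auto
      show ?case
      proof (rule tendsto_eventually)
        show "\<forall>\<^sub>F k in sequentially. s k t = g t"
          using eventually_gt_at_top[of i] by eventually_elim (auto simp: s_def i)
      qed
    qed
    show "AE t in \<sigma>. norm (s k t) \<le> g t" for k
      using g(2) by (intro AE_I2) (auto simp: s_def indicator_def)
  qed (use g s_measurable in auto)
  moreover have "(\<integral>t. s k t \<partial>\<sigma>) = (\<Sum>i<k. measure \<sigma> {e i} * g (e i))" for k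
  proof (induction k)
    case (Suc k)
    have int: "integrable \<sigma> (s k)"
      by (rule Bochner_Integration.integrable_bound[OF g(1) s_measurable]) (auto simp: s_def indicator_def)
    have "s (Suc k) = (\<lambda>t. s k t + g (e k) * indicator {e k} t)"
      using e(1) by (auto simp: s_def fun_eq_iff lessThan_Suc indicator_def inj_eq)
    moreover have "integrable \<sigma> (\<lambda>t. g (e k) * indicator {e k} t)"
      by (rule Bochner_Integration.integrable_bound[OF g(1)])
        (use countable_sets[of "{e k}"] g(2) in \<open>auto simp: indicator_def\<close>)
    ultimately show ?case using int Suc by (simp add: space mult.commute)
  qed (simp add: s_def)
  ultimately have "(\<lambda>i. measure \<sigma> {e i} * g (e i)) sums (\<integral>t. g t \<partial>\<sigma>)"
    by (simp add: sums_def)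
  then have "((\<lambda>i. measure \<sigma> {e i} * g (e i)) has_sum (\<integral>t. g t \<partial>\<sigma>)) UNIV"
    by (rule sums_nonneg_imp_has_sum) (simp add: g(2))
  then show ?thesis
    unfolding e_def using has_sum_reindex_bij_betw[OF bij_int_decode, of "\<lambda>n. measure \<sigma> {x n} * g (x n)"] by simp
qed

locale atomic_clark_symbol = clark_symbol U \<alpha> \<sigma> for U \<alpha> \<sigma> +
  fixes x :: "int \<Rightarrow> real"
  assumes atomic: "purely_atomic \<sigma>" and x: "inj x" "range x = atoms \<sigma>"
begin

lemma x_atom: "x n \<in> atoms \<sigma>"
  using x(2) by blast

abbreviation a :: "int \<Rightarrow> real" where "a n \<equiv> mass (x n)"
abbreviation e :: "int \<Rightarrow> real \<Rightarrow> complex" where "e n \<equiv> boundary_kernel U (x n)"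

lemma e_L2: "e n \<in> L2"
  by (simp add: boundary_kernel_eq atom_kernel_L2[OF x_atom])

lemma orthogonal: "orthogonal_family a e"
  using x(1) unfolding orthogonal_family_def
  by (simp add: boundary_kernel_eq atom_kernels_orthogonal[OF x_atom x_atom] atom_kernel_L2[OF x_atom]
      mass_pos[OF x_atom] inj_eq)

text \<open>For the kernel at a point of the half-plane, Parseval's identity is the Herglotz
  representation.\<close>

lemma kernel_parseval:
  assumes z: "0 < Im z"
  shows "((\<lambda>n. a n * (norm (l2_inner (kernel_on_line U z) (e n)))\<^sup>2) has_sum
     (l2_norm (kernel_on_line U z))\<^sup>2) UNIV"
proof -
  let ?I = "\<integral>t. 1 / (norm (complex_of_real t - z))\<^sup>2 \<partial>\<sigma>"
  let ?q = "(norm (\<alpha> - U z))\<^sup>2 / (4 * pi\<^sup>2)"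
  have "((\<lambda>n. ?q * (a n * (1 / (norm (complex_of_real (x n) - z))\<^sup>2))) has_sum ?q * ?I) UNIV"
    by (intro has_sum_cmult_right purely_atomic_has_sum sets_sigma atomic x integrable_sigma z) simp
  moreover have "?q * (a n * (1 / (norm (complex_of_real (x n) - z))\<^sup>2)) =
      a n * (norm (l2_inner (kernel_on_line U z) (e n)))\<^sup>2" for n
  proof -
    have "norm (l2_inner (kernel_on_line U z) (e n)) = norm (model_kernel U (complex_of_real (x n)) z)"
      by (subst l2_inner_cnj[symmetric]) (simp add: boundary_kernel_eq atom_kernel_inner[OF x_atom z])
    also have "\<dots> = 1 / (2 * pi) * (norm (\<alpha> - U z) / norm (complex_of_real (x n) - z))"
      by (simp add: kernel_at_atom[OF x_atom z] norm_mult norm_divide alpha norm_minus_commute)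
    finally show ?thesis by (simp add: power_mult_distrib power_divide)
  qed
  moreover have "?q * ?I = (l2_norm (kernel_on_line U z))\<^sup>2"
  proof -
    have "Im z / pi * ?I * (norm (\<alpha> - U z))\<^sup>2 = 1 - (norm (U z))\<^sup>2"
      using Re_herglotz[OF alpha U_neq_alpha[OF z]] herglotz[OF z] by simp
    then have "(l2_norm (kernel_on_line U z))\<^sup>2 = (Im z / pi * ?I * (norm (\<alpha> - U z))\<^sup>2) / (4 * pi * Im z)"
      by (simp add: kernel_norm[OF z])
    also have "\<dots> = ?q * ?I" using z by (simp add: field_simps power2_eq_square)
    finally show ?thesis by simp
  qed
  ultimately show ?thesis by simp
qed

lemma kernel_slice_continuous:
  assumes "0 < y"
  shows "continuous_on UNIV (\<lambda>t. model_kernel U (complex_of_real (x n)) (Complex t y))"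
proof -
  have "continuous_on UNIV (\<lambda>t. \<i> / (2 * pi) * cnj \<alpha> * ((\<alpha> - U (Complex t y)) / (Complex t y - complex_of_real (x n))))"
    using assms by (intro continuous_intros continuous_on_compose2[OF holomorphic_on_imp_continuous_on[OF hol]])
      (auto simp: complex_eq_iff)
  then show ?thesis using assms by (simp add: kernel_at_atom[OF x_atom])
qed

text \<open>Parseval's identity for every function reproduced by the kernels. Bessel's inequality is
  one half. For the other, the expansion converges to \<open>F\<close> at every point of the half-plane;
  the partial sums are Poisson integrals of their boundary functions, so Fatou's lemma bounds
  first the horizontal means of \<open>\<bar>F\<bar>\<^sup>2\<close>, and then the norm of the boundary function \<open>f\<close>.\<close>

lemma reproduced_parseval:
  assumes Ff: "hardy_boundary F f" and rep: "\<And>z. 0 < Im z \<Longrightarrow> l2_inner f (kernel_on_line U z) = F z"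
  shows "((\<lambda>n. a n * (norm (l2_inner f (e n)))\<^sup>2) has_sum (l2_norm f)\<^sup>2) UNIV"
proof -
  have F: "F \<in> hardy_analytic" and f: "f \<in> L2" and lim: "AE x in lebesgue. nt_limit F x (f x)"
    using Ff by (auto simp: hardy_boundary_def)
  define A where "A = (\<Sum>\<^sub>\<infinity>n. a n * (norm (l2_inner f (e n)))\<^sup>2)"
  have summable: "(\<lambda>n. a n * (norm (l2_inner f (e n)))\<^sup>2) summable_on UNIV" and Af: "A \<le> (l2_norm f)\<^sup>2"
    unfolding A_def using bessel_summable[OF orthogonal f] by auto
  define S where "S = (\<lambda>N. int_decode ` {..<N::nat})"
  have S: "finite (S N)" for N by (simp add: S_def)
  have partial_le: "(\<Sum>n\<in>S N. a n * (norm (l2_inner f (e n)))\<^sup>2) \<le> A" for N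
    unfolding A_def by (rule finite_sum_le_infsum[OF summable S]) auto
  have expansion: "(\<lambda>N. \<Sum>n\<in>S N. complex_of_real (a n) * l2_inner f (e n) * model_kernel U (complex_of_real (x n)) z) \<longlonglongrightarrow> F z"
    if z: "0 < Im z" for z
  proof -
    let ?t = "\<lambda>n. complex_of_real (a n) * l2_inner f (e n) * model_kernel U (complex_of_real (x n)) z"
    have "(?t has_sum F z) UNIV"
      using parseval_imp_inner_expansion[OF orthogonal f kernel_L2[OF z] kernel_parseval[OF z]]
      by (simp add: rep[OF z] boundary_kernel_eq atom_kernel_inner[OF x_atom z])
    then have "((\<lambda>i. ?t (int_decode i)) has_sum F z) UNIV"
      by (simp add: has_sum_reindex_bij_betw[OF bij_int_decode, of ?t])
    then have "(\<lambda>i. ?t (int_decode i)) sums F z" by (rule has_sum_imp_sums)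
    moreover have "(\<Sum>n\<in>S N. ?t n) = (\<Sum>i<N. ?t (int_decode i))" for N
      unfolding S_def by (rule sum.reindex_cong[OF inj_on_subset[OF bij_is_inj[OF bij_int_decode]]]) auto
    ultimately show ?thesis by (simp add: sums_def)
  qed
  have slice: "(l2_norm (\<lambda>t. F (Complex t y)))\<^sup>2 \<le> A" if y: "0 < y" for y
  proof -
    define h where "h = (\<lambda>N t. \<Sum>n\<in>S N. complex_of_real (a n) * l2_inner f (e n)
        * model_kernel U (complex_of_real (x n)) (Complex t y))"
    let ?P = "\<lambda>N. partial_expansion a e f (S N)"
    have h: "h N t = l2_inner (?P N) (\<lambda>s. complex_of_real (poisson_kernel (Complex t y) s))" for N t
      using y by (subst l2_inner_partial_expansion[OF orthogonal poisson_kernel_L2])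
        (auto simp: h_def boundary_kernel_eq atom_kernel_poisson[OF x_atom])
    have le: "(\<integral>\<^sup>+t. ennreal ((norm (h N t))\<^sup>2) \<partial>lebesgue) \<le> ennreal A" for N
    proof -
      have "(\<integral>\<^sup>+t. ennreal ((norm (h N t))\<^sup>2) \<partial>lebesgue) \<le> ennreal ((l2_norm (?P N))\<^sup>2)"
        unfolding h by (rule poisson_contraction[OF partial_expansion_L2[OF orthogonal] y])
      also have "\<dots> \<le> ennreal A"
        unfolding l2_norm_partial_expansion_and_rest(1)[OF orthogonal f S] by (rule ennreal_leI[OF partial_le])
      finally show ?thesis .
    qed
    have A0: "0 \<le> A" using partial_le[of 0] by (simp add: S_def)
    have hL2: "h N \<in> L2" for N
    proof -
      have "h N \<in> borel_measurable lebesgue"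
        unfolding h_def using y by (intro continuous_imp_lebesgue_measurable continuous_intros kernel_slice_continuous)
      then show ?thesis using le[of N] by (auto simp: L2_iff_nn_integral intro: le_less_trans)
    qed
    show ?thesis
    proof (rule L2_fatou(2)[OF hL2])
      show "(l2_norm (h N))\<^sup>2 \<le> A" for N
        using le[of N] A0 by (simp add: nn_integral_L2[OF hL2])
      show "AE t in lebesgue. (\<lambda>N. h N t) \<longlonglongrightarrow> F (Complex t y)"
        unfolding h_def using y by (intro AE_I2 expansion) simp
    qed
  qed
  have "(l2_norm f)\<^sup>2 \<le> A"
  proof (rule L2_fatou(2))
    obtain M where "\<And>y. 0 < y \<Longrightarrow> (\<lambda>t. F (Complex t y)) \<in> L2" using hardy_slices[OF F] by metis
    then show "(\<lambda>t. F (Complex t (inverse (real (Suc j))))) \<in> L2" for j by simp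
    show "(l2_norm (\<lambda>t. F (Complex t (inverse (real (Suc j))))))\<^sup>2 \<le> A" for j by (rule slice) simp
    show "AE t in lebesgue. (\<lambda>j. F (Complex t (inverse (real (Suc j))))) \<longlonglongrightarrow> f t"
      using lim by eventually_elim (rule nt_limit_cone_sequence[OF _ vertical_cone_sequence])
  qed
  then have "A = (l2_norm f)\<^sup>2" using Af by simp
  then show ?thesis using has_sum_infsum[OF summable] unfolding A_def[symmetric] by simp
qed

end

section \<open>Multiplication by exponentials\<close>

lemma hardy_boundary_mult:
  assumes Ff: "hardy_boundary F f" and E: "E holomorphic_on UNIV" and le: "\<And>z. 0 \<le> Im z \<Longrightarrow> norm (E z) \<le> 1"
  shows "hardy_boundary (\<lambda>z. E z * F z) (\<lambda>t. E (complex_of_real t) * f t)"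
proof -
  have F: "F \<in> hardy_analytic" and f: "f \<in> L2" and lim: "AE x in lebesgue. nt_limit F x (f x)"
    using Ff by (auto simp: hardy_boundary_def)
  have cont: "continuous_on UNIV E" by (rule holomorphic_on_imp_continuous_on[OF E])
  have "(SUP y\<in>{0<..}. \<integral>\<^sup>+t. ennreal ((norm (E (Complex t y) * F (Complex t y)))\<^sup>2) \<partial>lebesgue)
      \<le> (SUP y\<in>{0<..}. \<integral>\<^sup>+t. ennreal ((norm (F (Complex t y)))\<^sup>2) \<partial>lebesgue)"
  proof (rule SUP_least)
    fix y :: real assume y: "y \<in> {0<..}"
    then have "norm (E (Complex t y) * F (Complex t y)) \<le> norm (F (Complex t y))" for t
      using le[of "Complex t y"] by (simp add: norm_mult mult_left_le_one_le)
    then have "(\<integral>\<^sup>+t. ennreal ((norm (E (Complex t y) * F (Complex t y)))\<^sup>2) \<partial>lebesgue)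
        \<le> (\<integral>\<^sup>+t. ennreal ((norm (F (Complex t y)))\<^sup>2) \<partial>lebesgue)"
      by (intro nn_integral_mono ennreal_leI power_mono) auto
    also have "\<dots> \<le> (SUP y\<in>{0<..}. \<integral>\<^sup>+t. ennreal ((norm (F (Complex t y)))\<^sup>2) \<partial>lebesgue)"
      using y by (rule SUP_upper)
    finally show "(\<integral>\<^sup>+t. ennreal ((norm (E (Complex t y) * F (Complex t y)))\<^sup>2) \<partial>lebesgue)
      \<le> (SUP y\<in>{0<..}. \<integral>\<^sup>+t. ennreal ((norm (F (Complex t y)))\<^sup>2) \<partial>lebesgue)" .
  qed
  then have "(\<lambda>z. E z * F z) \<in> hardy_analytic"
    using F holomorphic_on_mult[OF holomorphic_on_subset[OF E]]
    by (simp add: hardy_analytic_def) (meson le_less_trans)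
  moreover have "(\<lambda>t. E (complex_of_real t) * f t) \<in> L2"
    using le by (intro L2_mult_bounded[OF f, where C = 1] AE_I2 continuous_imp_lebesgue_measurable
        continuous_on_compose2[OF cont] continuous_intros) auto
  moreover have "AE t in lebesgue. nt_limit (\<lambda>z. E z * F z) t (E (complex_of_real t) * f t)"
    using lim
  proof eventually_elim
    case (elim t)
    have "isCont E (complex_of_real t)" using cont by (simp add: continuous_on_eq_continuous_at)
    from nt_limit_mult[OF nt_limit_continuous[OF this] elim] show ?case .
  qed
  ultimately show ?thesis by (simp add: hardy_boundary_def)
qed

lemma norm_exp_inner: "norm (exp_inner c z) = exp (- (c * Im z))"
  by (simp add: exp_inner_def)

lemma exp_inner_holomorphic: "exp_inner c holomorphic_on S"
  unfolding exp_inner_def[abs_def] by (intro holomorphic_intros)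

lemma exp_inner_le: "0 \<le> c \<Longrightarrow> 0 \<le> Im z \<Longrightarrow> norm (exp_inner c z) \<le> 1"
  by (simp add: norm_exp_inner)

lemma exp_inner_isCont: "isCont (exp_inner c) z"
  unfolding exp_inner_def[abs_def] by (intro continuous_intros)

lemma exp_inner_add: "exp_inner (a + b) z = exp_inner a z * exp_inner b z"
  by (simp add: exp_inner_def exp_add[symmetric] algebra_simps)

lemma exp_inner_cnj: "cnj (exp_inner c (complex_of_real t)) = exp_inner (- c) (complex_of_real t)"
  by (simp add: exp_inner_def exp_cnj)

lemma exp_inner_unimodular: "norm (exp_inner c (complex_of_real t)) = 1"
  by (simp add: norm_exp_inner)

lemma exp_inner_nt_limit: "nt_limit (exp_inner c) t (exp_inner c (complex_of_real t))"
  by (rule nt_limit_continuous[OF exp_inner_isCont])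

section \<open>Averages of exponentials\<close>

text \<open>The exponential sums below are Riemann sums of \<open>\<integral> exp (- i s d t) ds\<close> over the unit interval,
  which equals \<open>sinc (d t / 2)\<close> up to a unimodular factor; for \<open>d = c / m\<close> its power
  \<open>m\<close> multiplies the kernel in the sampling function.\<close>

definition exp_average :: "nat \<Rightarrow> real \<Rightarrow> real \<Rightarrow> complex" where
  "exp_average N d t = (\<Sum>l<N. exp_inner (- (real l / real N * d)) (complex_of_real t)) / of_nat N"

text \<open>The average is a geometric sum \<open>(exp w - 1) / (N (exp (w / N) - 1))\<close> with \<open>w = - i d t\<close>, whose
  denominator tends to \<open>w\<close> by the derivative of \<open>exp\<close> at \<open>0\<close>.\<close>

lemma exp_average_limit:
  "(\<lambda>N. exp_average (Suc N) d t) \<longlonglongrightarrow>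
     exp (- (\<i> * complex_of_real (d * t) / 2)) * complex_of_real (sinc (d * t / 2))"
proof (cases "d * t = 0")
  case True
  then have "exp_average (Suc N) d t = 1" for N
    by (auto simp: exp_average_def exp_inner_def simp del: of_nat_Suc sum.lessThan_Suc)
  then show ?thesis using True by auto
next
  case False
  define w where "w = - \<i> * complex_of_real (d * t)"
  have w: "w \<noteq> 0" using False by (simp add: w_def)
  define q where "q = (\<lambda>N. (exp (w / of_nat (Suc N)) - 1) * of_nat (Suc N))"
  have "((\<lambda>h. (exp (0 + h) - exp 0) / h) \<longlongrightarrow> exp (0::complex)) (at 0)"
    using DERIV_exp[of "0::complex"] by (simp add: DERIV_def)
  moreover have "filterlim (\<lambda>N. w / of_nat (Suc N)) (at (0::complex)) sequentially"
  proof -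
    have "(\<lambda>N. w * (1 / of_nat (Suc N))) \<longlonglongrightarrow> w * 0"
      by (intro tendsto_mult tendsto_const lim_1_over_n[THEN LIMSEQ_Suc])
    then show ?thesis using w unfolding filterlim_at by (auto simp del: of_nat_Suc)
  qed
  ultimately have "(\<lambda>N. (exp (0 + w / of_nat (Suc N)) - exp 0) / (w / of_nat (Suc N))) \<longlonglongrightarrow> exp 0"
    by (rule filterlim_compose)
  then have "(\<lambda>N. w * ((exp (0 + w / of_nat (Suc N)) - exp 0) / (w / of_nat (Suc N)))) \<longlonglongrightarrow> w * exp 0"
    by (intro tendsto_intros)
  moreover have "w * ((exp (0 + w / of_nat (Suc N)) - exp 0) / (w / of_nat (Suc N))) = q N" for N
    using w by (simp add: q_def del: of_nat_Suc)
  ultimately have q: "q \<longlonglongrightarrow> w" by simp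
  then have lim: "(\<lambda>N. (exp w - 1) / q N) \<longlonglongrightarrow> (exp w - 1) / w"
    using w by (intro tendsto_intros)
  have "\<forall>\<^sub>F N in sequentially. q N \<noteq> 0"
    using q w by (rule tendsto_imp_eventually_ne)
  then have "\<forall>\<^sub>F N in sequentially. (exp w - 1) / q N = exp_average (Suc N) d t"
  proof eventually_elim
    case (elim N)
    let ?z = "exp (w / of_nat (Suc N))"
    have z: "?z \<noteq> 1" using elim by (auto simp: q_def)
    have "exp_inner (- (real l / real (Suc N) * d)) (complex_of_real t) = ?z ^ l" for l
      unfolding exp_inner_def exp_of_nat_mult[symmetric] by (simp add: w_def field_simps)
    then have "(\<Sum>l<Suc N. exp_inner (- (real l / real (Suc N) * d)) (complex_of_real t)) = (?z ^ Suc N - 1) / (?z - 1)"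
      using z by (simp only: geometric_sum[OF z])
    also have "?z ^ Suc N = exp w"
      unfolding exp_of_nat_mult[symmetric] by (simp del: of_nat_Suc)
    finally show ?case by (simp add: exp_average_def q_def del: of_nat_Suc sum.lessThan_Suc)
  qed
  from Lim_transform_eventually[OF lim this]
  have "(\<lambda>N. exp_average (Suc N) d t) \<longlonglongrightarrow> (exp w - 1) / w" .
  also have "(exp w - 1) / w = exp (- (\<i> * complex_of_real (d * t) / 2)) * complex_of_real (sinc (d * t / 2))"
  proof -
    define D where "D = complex_of_real (d * t)"
    have D: "D \<noteq> 0" "w = - \<i> * D" "complex_of_real (d * t / 2) = D / 2"
      using False by (simp_all add: D_def w_def)
    have 1: "exp w = exp (w / 2) * exp (w / 2)" and 2: "exp (w / 2) * exp (- w / 2) = 1"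
      by (simp_all flip: exp_add)
    have "exp w - 1 = exp (w / 2) * (exp (w / 2) - exp (- w / 2))"
      unfolding right_diff_distrib 2 1 ..
    also have "exp (w / 2) - exp (- w / 2) = - 2 * \<i> * sin (D / 2)"
      unfolding sin_exp_eq by (simp add: D(2) field_simps)
    finally have "(exp w - 1) / w = exp (w / 2) * (sin (D / 2) / (D / 2))"
      using D(1) unfolding D(2) by (simp add: divide_simps)
    also have "sin (D / 2) / (D / 2) = complex_of_real (sinc (d * t / 2))"
      using False unfolding D(3)[symmetric] sin_of_real by simp
    also have "w / 2 = - (\<i> * complex_of_real (d * t) / 2)" by (simp add: w_def)
    finally show ?thesis .
  qed
  finally show ?thesis .
qed

lemma l2_norm_triangle:
  assumes f: "f \<in> L2" and g: "g \<in> L2"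
  shows "l2_norm (\<lambda>t. f t + g t) \<le> l2_norm f + l2_norm g"
proof (rule power2_le_imp_le)
  have h: "(\<lambda>t. f t + g t) \<in> L2" by (rule L2_add[OF f g])
  have "complex_of_real ((l2_norm (\<lambda>t. f t + g t))\<^sup>2) = l2_inner f (\<lambda>t. f t + g t) + l2_inner g (\<lambda>t. f t + g t)"
    unfolding l2_inner_self[symmetric] by (rule l2_inner_add[OF f g h])
  then have "(l2_norm (\<lambda>t. f t + g t))\<^sup>2 = norm (l2_inner f (\<lambda>t. f t + g t) + l2_inner g (\<lambda>t. f t + g t))"
    by (metis norm_of_real abs_of_nonneg zero_le_power2)
  also have "\<dots> \<le> (l2_norm f + l2_norm g) * l2_norm (\<lambda>t. f t + g t)"
    using l2_cauchy_schwarz[OF f h] l2_cauchy_schwarz[OF g h]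
      norm_triangle_ineq[of "l2_inner f (\<lambda>t. f t + g t)" "l2_inner g (\<lambda>t. f t + g t)"]
    unfolding distrib_right by linarith
  finally have *: "(l2_norm (\<lambda>t. f t + g t))\<^sup>2 \<le> (l2_norm f + l2_norm g) * l2_norm (\<lambda>t. f t + g t)" .
  show "(l2_norm (\<lambda>t. f t + g t))\<^sup>2 \<le> (l2_norm f + l2_norm g)\<^sup>2"
  proof (cases "l2_norm (\<lambda>t. f t + g t) = 0")
    case False
    then have "l2_norm (\<lambda>t. f t + g t) \<le> l2_norm f + l2_norm g"
      using * l2_norm_nonneg[of "\<lambda>t. f t + g t"] by (simp add: power2_eq_square)
    then show ?thesis by (intro power_mono l2_norm_nonneg)
  qed simp
qed (simp add: l2_norm_nonneg)

lemma l2_norm_sum_le: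
  "(\<And>i. i \<in> S \<Longrightarrow> g i \<in> L2) \<Longrightarrow> l2_norm (\<lambda>t. \<Sum>i\<in>S. g i t) \<le> (\<Sum>i\<in>S. l2_norm (g i))"
proof (induction S rule: infinite_finite_induct)
  case (insert i S)
  have "l2_norm (\<lambda>t. g i t + (\<Sum>i\<in>S. g i t)) \<le> l2_norm (g i) + l2_norm (\<lambda>t. \<Sum>i\<in>S. g i t)"
    using insert.prems by (intro l2_norm_triangle L2_sum) auto
  then show ?case using insert by fastforce
qed (auto simp: l2_norm_def)

lemma l2_norm_cmult: "l2_norm (\<lambda>t. c * f t) = norm c * l2_norm f"
  by (simp add: l2_norm_def norm_mult power_mult_distrib real_sqrt_mult)

lemma l2_norm_unimodular:
  assumes "\<And>t. norm (b t) = 1"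
  shows "l2_norm (\<lambda>t. b t * f t) = l2_norm f"
  by (simp add: l2_norm_def norm_mult assms)

abbreviation averaged_factor :: "nat \<Rightarrow> real \<Rightarrow> nat \<Rightarrow> real \<Rightarrow> real \<Rightarrow> complex" where
  "averaged_factor N d j \<tau> s \<equiv> exp_inner (- \<tau>) (complex_of_real s) * exp_average N d s ^ j"

lemma norm_exp_average_le: "norm (exp_average N d t) \<le> 1"
proof -
  have "norm (\<Sum>l<N. exp_inner (- (real l / real N * d)) (complex_of_real t)) \<le> (\<Sum>l<N. 1)"
    by (rule order_trans[OF norm_sum]) (simp add: exp_inner_unimodular)
  then show ?thesis by (cases "N = 0") (simp_all add: exp_average_def norm_divide)
qed

lemma exp_average_term_L2:
  assumes k: "k \<in> L2" and N: "0 < N"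
  shows "(\<lambda>t. w * averaged_factor N d j \<tau> (t - s) * k t) \<in> L2"
proof (rule L2_mult_bounded[OF k, where C = "norm w * (1 * 1 ^ j)"])
  have "continuous_on UNIV (\<lambda>t. w * averaged_factor N d j \<tau> (t - s))"
    unfolding exp_average_def exp_inner_def using N by (intro continuous_intros) auto
  then show "(\<lambda>t. w * averaged_factor N d j \<tau> (t - s)) \<in> borel_measurable lebesgue"
    by (rule continuous_imp_lebesgue_measurable)
  show "AE t in lebesgue. norm (w * averaged_factor N d j \<tau> (t - s))
      \<le> norm w * (1 * 1 ^ j)"
    unfolding norm_mult norm_power exp_inner_unimodular
    by (intro AE_I2 mult_left_mono power_mono norm_exp_average_le) auto
qed

text \<open>A finite sum \<open>\<Sum>\<^sub>n w\<^sub>n b (t - x\<^sub>n) k\<^sub>n t\<close> with \<open>b\<close> an average of exponentials is an average of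
  modulations of sums with exponentials. If all of those are within \<open>r\<close> of \<open>f\<close>, then so is the
  average, since balls in \<open>L\<^sup>2\<close> are convex. Iterating this reaches powers of averages; each step uses up a
  frequency range of length \<open>d\<close>.\<close>

lemma averaged_approximation:
  fixes w :: "'i \<Rightarrow> complex" and x :: "'i \<Rightarrow> real" and k :: "'i \<Rightarrow> real \<Rightarrow> complex"
  assumes f: "f \<in> L2" and k: "\<And>n. k n \<in> L2" and d: "0 \<le> d" and N: "0 < N"
    and base: "\<And>\<tau>. 0 \<le> \<tau> \<Longrightarrow> \<tau> \<le> c \<Longrightarrow>
      l2_norm (\<lambda>t. f t - (\<Sum>n\<in>S. w n * exp_inner (- \<tau>) (complex_of_real (t - x n)) * k n t)) \<le> r"
    and \<tau>: "0 \<le> \<tau>" "\<tau> + real j * d \<le> c"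
  shows "l2_norm (\<lambda>t. f t - (\<Sum>n\<in>S. w n * averaged_factor N d j \<tau> (t - x n) * k n t)) \<le> r"
  using \<tau>
proof (induction j arbitrary: \<tau>)
  case 0
  then show ?case using base[of \<tau>] by simp
next
  case (Suc j)
  define G where "G = (\<lambda>\<tau> t. f t - (\<Sum>n\<in>S. w n * averaged_factor N d j \<tau> (t - x n) * k n t))"
  define \<theta> where "\<theta> = (\<lambda>l. \<tau> + real l / real N * d)"
  have GL2: "G \<tau> \<in> L2" for \<tau>
    unfolding G_def by (intro L2_diff[OF f] L2_sum exp_average_term_L2 k N)
  have "(\<lambda>t. f t - (\<Sum>n\<in>S. w n * averaged_factor N d (Suc j) \<tau> (t - x n) * k n t))
     = (\<lambda>t. 1 / of_nat N * (\<Sum>l<N. G (\<theta> l) t))"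
  proof
    fix t
    have "(\<Sum>l<N. G (\<theta> l) t) = of_nat N * f t -
        (\<Sum>n\<in>S. \<Sum>l<N. w n * averaged_factor N d j (\<theta> l) (t - x n) * k n t)"
      unfolding G_def sum_subtractf by (subst sum.swap) simp
    also have "(\<Sum>n\<in>S. \<Sum>l<N. w n * averaged_factor N d j (\<theta> l) (t - x n) * k n t)
       = of_nat N * (\<Sum>n\<in>S. w n * averaged_factor N d (Suc j) \<tau> (t - x n) * k n t)"
      unfolding sum_distrib_left
    proof (rule sum.cong[OF refl])
      fix n
      let ?s = "complex_of_real (t - x n)"
      have e: "exp_inner (- \<theta> l) ?s = exp_inner (- \<tau>) ?s * exp_inner (- (real l / real N * d)) ?s" for l
        unfolding exp_inner_add[symmetric] by (simp add: \<theta>_def)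
      have "(\<Sum>l<N. w n * (exp_inner (- \<theta> l) ?s * exp_average N d (t - x n) ^ j) * k n t) =
          w n * exp_inner (- \<tau>) ?s * exp_average N d (t - x n) ^ j * k n t
            * (\<Sum>l<N. exp_inner (- (real l / real N * d)) ?s)"
        unfolding e sum_distrib_left by (simp add: mult_ac)
      also have "(\<Sum>l<N. exp_inner (- (real l / real N * d)) ?s) = of_nat N * exp_average N d (t - x n)"
        using N by (simp add: exp_average_def)
      finally show "(\<Sum>l<N. w n * (exp_inner (- \<theta> l) ?s * exp_average N d (t - x n) ^ j) * k n t) =
          of_nat N * (w n * (exp_inner (- \<tau>) ?s * exp_average N d (t - x n) ^ Suc j) * k n t)"
        by (simp add: mult_ac)
    qed
    finally show "f t - (\<Sum>n\<in>S. w n * averaged_factor N d (Suc j) \<tau> (t - x n) * k n t)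
     = 1 / of_nat N * (\<Sum>l<N. G (\<theta> l) t)"
      using N by (simp add: field_simps)
  qed
  then have "l2_norm (\<lambda>t. f t - (\<Sum>n\<in>S. w n * averaged_factor N d (Suc j) \<tau> (t - x n) * k n t))
     = 1 / real N * l2_norm (\<lambda>t. \<Sum>l<N. G (\<theta> l) t)"
    using N by (simp only: l2_norm_cmult) (simp add: norm_divide)
  also have "\<dots> \<le> 1 / real N * (\<Sum>l<N. l2_norm (G (\<theta> l)))"
    by (intro mult_left_mono l2_norm_sum_le GL2) simp
  also have "\<dots> \<le> 1 / real N * (\<Sum>l<N. r)"
  proof (intro mult_left_mono sum_mono)
    fix l assume "l \<in> {..<N}"
    then have "real l / real N * d \<le> 1 * d" using d N by (intro mult_right_mono) auto
    then show "l2_norm (G (\<theta> l)) \<le> r"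
      unfolding G_def using Suc.prems d by (intro Suc.IH) (auto simp: \<theta>_def algebra_simps)
  qed simp
  also have "\<dots> = r" using N by simp
  finally show ?case .
qed

lemma sampling_function_eq:
  assumes "1 \<le> m"
  shows "sampling_function U c m s t =
     (exp (- (\<i> * complex_of_real (c / real m * (t - s)) / 2)) * complex_of_real (sinc (c / real m * (t - s) / 2))) ^ m
       * (1 / complex_of_real ((l2_norm (boundary_kernel U s))\<^sup>2)) * boundary_kernel U s t"
proof -
  define q where "q = c / real m * (t - s)"
  have q: "c * (t - s) = q * real m" "c * (t - s) / (2 * real m) = q / 2"
    using assms by (simp_all add: q_def)
  have "exp (- (\<i> * complex_of_real q / 2)) ^ m = exp (- (\<i> * complex_of_real (q * real m) / 2))"
    unfolding exp_of_nat_mult[symmetric] by (simp add: mult_ac)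
  then show ?thesis
    unfolding sampling_function_def q(2) power_mult_distrib q_def[symmetric] of_real_power
    unfolding q(1) by simp
qed

lemma abs_sinc_le: "\<bar>sinc y\<bar> \<le> 1" "y \<noteq> 0 \<Longrightarrow> \<bar>sinc y\<bar> \<le> 1 / \<bar>y\<bar>"
  using abs_sin_x_le_abs_x[of y] abs_sin_le_one[of y] by (auto simp: divide_le_eq divide_right_mono)

lemma sampling_function_L2:
  assumes k: "boundary_kernel U s \<in> L2" and m: "1 \<le> m"
  shows "sampling_function U c m s \<in> L2"
proof -
  let ?b = "\<lambda>t. (exp (- (\<i> * complex_of_real (c / real m * (t - s)) / 2)) * complex_of_real (sinc (c / real m * (t - s) / 2))) ^ m
       * (1 / complex_of_real ((l2_norm (boundary_kernel U s))\<^sup>2))"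
  have exp_1: "norm (exp (- (\<i> * complex_of_real q / 2))) = 1" for q by simp
  have sinc_le: "norm (complex_of_real (sinc y)) \<le> 1" for y
    using abs_sinc_le(1)[of y] by (simp only: norm_of_real)
  have "(\<lambda>t. ?b t * boundary_kernel U s t) \<in> L2"
  proof (rule L2_mult_bounded[OF k, where C = "(1 * 1) ^ m * norm (1 / complex_of_real ((l2_norm (boundary_kernel U s))\<^sup>2))"])
    show "?b \<in> borel_measurable lebesgue"
      by (intro continuous_imp_lebesgue_measurable continuous_intros) auto
    show "AE t in lebesgue. norm (?b t) \<le> (1 * 1) ^ m * norm (1 / complex_of_real ((l2_norm (boundary_kernel U s))\<^sup>2))"
      unfolding norm_mult norm_power
      by (intro AE_I2 mult_right_mono power_mono mult_mono sinc_le eq_refl[OF exp_1]) auto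
  qed
  also have "(\<lambda>t. ?b t * boundary_kernel U s t) = sampling_function U c m s"
    by (intro ext sampling_function_eq[OF m, symmetric])
  finally show ?thesis .
qed

section \<open>The sampling expansion\<close>

locale sampling_setting = atomic_clark_symbol U \<alpha> \<sigma> x for U \<alpha> \<sigma> x +
  fixes c :: real and \<Theta> :: "complex \<Rightarrow> complex"
  assumes c: "0 < c" and inner: "inner_function \<Theta>" and U_eq: "U = (\<lambda>z. exp_inner c z * \<Theta> z)"
begin

abbreviation theta :: "real \<Rightarrow> complex" where "theta t \<equiv> hp_ext \<Theta> (complex_of_real t)"

lemma theta_boundary:
  "AE t in lebesgue. nt_limit \<Theta> t (theta t) \<and> norm (theta t) = 1"
proof -
  have "AE t in lebesgue. \<exists>l. nt_limit \<Theta> t l \<and> norm l = 1"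
    using inner by (simp add: inner_function_def)
  then show ?thesis by eventually_elim (metis hp_ext_of_real)
qed

lemma u_eq: "AE t in lebesgue. u t = exp_inner c (complex_of_real t) * theta t"
  using theta_boundary
proof eventually_elim
  case (elim t)
  then have "nt_limit U t (exp_inner c (complex_of_real t) * theta t)"
    unfolding U_eq by (intro nt_limit_mult exp_inner_nt_limit) simp
  then show ?case by (rule hp_ext_of_real)
qed

text \<open>Modulating a function of the smaller model space by a frequency between \<open>0\<close> and \<open>c\<close>
  keeps it in the larger one: against \<open>U g\<close> the frequency left over, \<open>c - \<tau> \<ge> 0\<close>, can be moved
  to the Hardy function \<open>g\<close>.\<close>

lemma modulation_reproduced:
  assumes Ff: "hardy_boundary F f" and f: "f \<in> model_space \<Theta>" and \<tau>: "0 \<le> \<tau>" "\<tau> \<le> c" and z: "0 < Im z"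
  shows "l2_inner (\<lambda>t. exp_inner \<tau> (complex_of_real t) * f t) (kernel_on_line U z) = exp_inner \<tau> z * F z"
proof (rule kernel_reproducing[OF _ z])
  show hb: "hardy_boundary (\<lambda>z. exp_inner \<tau> z * F z) (\<lambda>t. exp_inner \<tau> (complex_of_real t) * f t)"
    using \<tau> by (intro hardy_boundary_mult[OF Ff] exp_inner_holomorphic exp_inner_le)
  let ?ck = "cauchy_kernel (cnj z)"
  let ?g = "\<lambda>t. exp_inner (c - \<tau>) (complex_of_real t) * ?ck t"
  have "hardy_boundary (\<lambda>w. exp_inner (c - \<tau>) w * (1 / (w - cnj z))) ?g"
    using \<tau> by (intro hardy_boundary_mult cauchy_kernel_hardy(1) z exp_inner_holomorphic exp_inner_le) auto
  then have g: "?g \<in> H2" "?g \<in> L2" by (auto simp: H2_def hardy_boundary_def)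
  have fL2: "f \<in> L2" using Ff by (simp add: hardy_boundary_def)
  have hL2: "(\<lambda>t. theta t * ?g t) \<in> L2"
  proof (rule L2_mult_bounded[OF g(2)])
    show "(\<lambda>t. theta t) \<in> borel_measurable lebesgue"
      using inner theta_boundary by (intro nt_limit_boundary_measurable[of \<Theta>])
        (auto simp: inner_function_def elim: eventually_mono)
    show "AE t in lebesgue. norm (theta t) \<le> 1"
      using theta_boundary by eventually_elim simp
  qed
  have uL2: "(\<lambda>t. u t * ?ck t) \<in> L2"
    using cauchy_kernel_hardy(2)[OF z] by (simp add: hardy_boundary_def)
  have "l2_inner (\<lambda>t. exp_inner \<tau> (complex_of_real t) * f t) (\<lambda>t. u t * ?ck t) =
      l2_inner f (\<lambda>t. theta t * ?g t)"
    unfolding l2_inner_def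
  proof (rule integral_cong_AE)
    show "(\<lambda>t. exp_inner \<tau> (complex_of_real t) * f t * cnj (u t * ?ck t)) \<in> borel_measurable lebesgue"
      using hb uL2 by (intro borel_measurable_integrable integrable_L2_mult(1)) (auto simp: hardy_boundary_def)
    show "(\<lambda>t. f t * cnj (theta t * ?g t)) \<in> borel_measurable lebesgue"
      by (intro borel_measurable_integrable integrable_L2_mult(1) fL2 hL2)
    show "AE t in lebesgue. exp_inner \<tau> (complex_of_real t) * f t * cnj (u t * ?ck t) =
        f t * cnj (theta t * ?g t)"
      using u_eq
    proof eventually_elim
      case (elim t)
      have "exp_inner \<tau> (complex_of_real t) * exp_inner (- c) (complex_of_real t) = exp_inner (- (c - \<tau>)) (complex_of_real t)"
        unfolding exp_inner_add[symmetric] by simp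
      then show ?case by (simp add: elim exp_inner_cnj mult_ac)
    qed
  qed
  also have "\<dots> = 0" using f g by (simp add: model_space_def)
  finally show "l2_inner (\<lambda>t. exp_inner \<tau> (complex_of_real t) * f t) (\<lambda>t. u t * ?ck t) = 0" .
qed

context
  fixes F f
  assumes Ff: "hardy_boundary F f" and f: "f \<in> model_space \<Theta>"
begin

abbreviation sample :: "int \<Rightarrow> complex" where "sample n \<equiv> hp_ext F (complex_of_real (x n))"

lemma f_L2: "f \<in> L2"
  using Ff by (simp add: hardy_boundary_def)

lemma modulation_L2: "(\<lambda>t. exp_inner \<tau> (complex_of_real t) * f t) \<in> L2"
  by (rule L2_mult_bounded[OF f_L2, where C = 1])
    (auto intro!: continuous_imp_lebesgue_measurable continuous_at_imp_continuous_on
      isCont_o2[OF _ exp_inner_isCont] simp: exp_inner_unimodular)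

text \<open>Evaluation at a node is a non-tangential limit, and the modulating factor is continuous there.\<close>

lemma modulation_sample:
  assumes \<tau>: "0 \<le> \<tau>" "\<tau> \<le> c"
  shows "l2_inner (\<lambda>t. exp_inner \<tau> (complex_of_real t) * f t) (e n) = exp_inner \<tau> (complex_of_real (x n)) * sample n"
proof -
  have nt: "nt_limit (\<lambda>z. exp_inner \<tau> z * F z) (x n) (l2_inner (\<lambda>t. exp_inner \<tau> (complex_of_real t) * f t) (e n))"
    if "0 \<le> \<tau>" "\<tau> \<le> c" for \<tau>
    unfolding boundary_kernel_eq
    by (rule reproducing_imp_nt_limit[OF modulation_L2 modulation_reproduced[OF Ff f that] x_atom])
  have "nt_limit F (x n) (l2_inner (\<lambda>t. exp_inner 0 (complex_of_real t) * f t) (e n))"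
    using nt[of 0] c by (simp add: exp_inner_def)
  then have "nt_limit F (x n) (sample n)" using hp_ext_of_real by metis
  from nt_limit_unique[OF nt[OF \<tau>] nt_limit_mult[OF exp_inner_nt_limit this]] show ?thesis .
qed

lemma modulation_norm: "l2_norm (\<lambda>t. exp_inner \<tau> (complex_of_real t) * f t) = l2_norm f"
  by (rule l2_norm_unimodular[OF exp_inner_unimodular])

lemma sample_parseval: "((\<lambda>n. a n * (norm (sample n))\<^sup>2) has_sum (l2_norm f)\<^sup>2) UNIV"
proof -
  let ?f = "\<lambda>t. exp_inner 0 (complex_of_real t) * f t"
  have "((\<lambda>n. a n * (norm (l2_inner ?f (e n)))\<^sup>2) has_sum (l2_norm ?f)\<^sup>2) UNIV"
  proof (rule reproduced_parseval)
    show "hardy_boundary (\<lambda>z. exp_inner 0 z * F z) ?f"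
      by (intro hardy_boundary_mult[OF Ff] exp_inner_holomorphic exp_inner_le) simp
  qed (use modulation_reproduced[OF Ff f, of 0] c in auto)
  then show ?thesis
    using c by (simp add: modulation_sample modulation_norm norm_mult exp_inner_unimodular)
qed

text \<open>Multiplication by the unimodular function \<open>exp (- i \<tau> t)\<close> carries the expansion of the
  modulated function to one of \<open>f\<close>. The coefficients differ from those of \<open>f\<close> only by unimodular
  factors, so the error is the same for all \<open>\<tau>\<close>.\<close>

lemma modulated_approximation:
  assumes \<tau>: "0 \<le> \<tau>" "\<tau> \<le> c" and S: "finite S"
  shows "l2_norm (\<lambda>t. f t - (\<Sum>n\<in>S. complex_of_real (a n) * sample n * exp_inner (- \<tau>) (complex_of_real (t - x n)) * e n t))
     = sqrt ((l2_norm f)\<^sup>2 - (\<Sum>n\<in>S. a n * (norm (sample n))\<^sup>2))"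
proof -
  let ?f = "\<lambda>t. exp_inner \<tau> (complex_of_real t) * f t"
  have inv: "exp_inner (- \<tau>) z * exp_inner \<tau> z = 1" for z
    unfolding exp_inner_add[symmetric] by (simp add: exp_inner_def)
  have split: "exp_inner (- \<tau>) (complex_of_real (t - s)) =
      exp_inner (- \<tau>) (complex_of_real t) * exp_inner \<tau> (complex_of_real s)" for t s
    by (simp add: exp_inner_def exp_add[symmetric] algebra_simps)
  have "f t - (\<Sum>n\<in>S. complex_of_real (a n) * sample n * exp_inner (- \<tau>) (complex_of_real (t - x n)) * e n t)
     = exp_inner (- \<tau>) (complex_of_real t) * (?f t - partial_expansion a e ?f S t)" for t
  proof -
    have "exp_inner (- \<tau>) (complex_of_real t) * ?f t = f t"
      using inv[of "complex_of_real t"] by (simp add: mult.assoc[symmetric])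
    moreover have "exp_inner (- \<tau>) (complex_of_real t) * partial_expansion a e ?f S t =
        (\<Sum>n\<in>S. complex_of_real (a n) * sample n * exp_inner (- \<tau>) (complex_of_real (t - x n)) * e n t)"
      unfolding partial_expansion_def modulation_sample[OF \<tau>] split sum_distrib_left
      by (intro sum.cong) (auto simp: mult_ac)
    ultimately show ?thesis by (simp add: right_diff_distrib)
  qed
  then have "l2_norm (\<lambda>t. f t - (\<Sum>n\<in>S. complex_of_real (a n) * sample n * exp_inner (- \<tau>) (complex_of_real (t - x n)) * e n t))
     = l2_norm (\<lambda>t. ?f t - partial_expansion a e ?f S t)"
    by (simp add: l2_norm_unimodular[OF exp_inner_unimodular])
  also have "\<dots> = sqrt ((l2_norm ?f)\<^sup>2 - (\<Sum>n\<in>S. a n * (norm (l2_inner ?f (e n)))\<^sup>2))"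
    by (rule real_sqrt_unique[OF l2_norm_partial_expansion_and_rest(2)[OF orthogonal modulation_L2 S]
        l2_norm_nonneg, symmetric])
  finally show ?thesis
    by (simp add: modulation_sample[OF \<tau>] modulation_norm norm_mult exp_inner_unimodular)
qed

text \<open>With \<open>d = c / m\<close> the \<open>m\<close> averages use up exactly the frequencies from \<open>0\<close> to \<open>c\<close>. The bound
  for Riemann sums holds with the same right-hand side for each number of terms, so by Fatou's lemma
  it holds for their limit.\<close>

lemma sampling_approximation:
  assumes m: "1 \<le> m" and S: "finite S"
  shows "l2_norm (\<lambda>t. f t - (\<Sum>n\<in>S. sample n * sampling_function U c m (x n) t))
     \<le> sqrt ((l2_norm f)\<^sup>2 - (\<Sum>n\<in>S. a n * (norm (sample n))\<^sup>2))" (is "_ \<le> ?r")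
proof -
  define h where "h = (\<lambda>N t. f t - (\<Sum>n\<in>S. complex_of_real (a n) * sample n *
      averaged_factor (Suc N) (c / real m) m 0 (t - x n) * e n t))"
  have r0: "0 \<le> ?r"
    unfolding modulated_approximation[OF order_refl less_imp_le[OF c] S, symmetric] by (rule l2_norm_nonneg)
  have le: "l2_norm (h N) \<le> ?r" for N
    unfolding h_def
  proof (rule averaged_approximation[OF f_L2 e_L2])
    show "l2_norm (\<lambda>t. f t - (\<Sum>n\<in>S. complex_of_real (a n) * sample n * exp_inner (- \<tau>) (complex_of_real (t - x n)) * e n t))
       \<le> ?r" if "0 \<le> \<tau>" "\<tau> \<le> c" for \<tau>
      using modulated_approximation[OF that S] by simp
  qed (use c m in auto)
  have hL2: "h N \<in> L2" for N
    unfolding h_def by (intro L2_diff f_L2 L2_sum exp_average_term_L2 e_L2) simp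
  have "(l2_norm (\<lambda>t. f t - (\<Sum>n\<in>S. sample n * sampling_function U c m (x n) t)))\<^sup>2 \<le> ?r\<^sup>2"
  proof (rule L2_fatou(2)[OF hL2])
    show "(l2_norm (h N))\<^sup>2 \<le> ?r\<^sup>2" for N
      using le by (intro power_mono l2_norm_nonneg)
    show "AE t in lebesgue. (\<lambda>N. h N t) \<longlonglongrightarrow> f t - (\<Sum>n\<in>S. sample n * sampling_function U c m (x n) t)"
    proof (rule AE_I2)
      fix t
      have "1 / complex_of_real ((l2_norm (e n))\<^sup>2) = complex_of_real (a n)" for n
        unfolding boundary_kernel_eq atom_kernel_norm[OF x_atom] by simp
      then have eq: "sample n * sampling_function U c m (x n) t = complex_of_real (a n) * sample n *
          (1 * (exp (- (\<i> * complex_of_real (c / real m * (t - x n)) / 2)) *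
            complex_of_real (sinc (c / real m * (t - x n) / 2))) ^ m) * e n t" for n
        unfolding sampling_function_eq[OF m] by (simp only: mult_ac mult_1)
      have "exp_inner (- 0) w = 1" for w by (simp add: exp_inner_def)
      then show "(\<lambda>N. h N t) \<longlonglongrightarrow> f t - (\<Sum>n\<in>S. sample n * sampling_function U c m (x n) t)"
        unfolding h_def eq by (simp only:) (intro tendsto_intros exp_average_limit)
    qed
  qed
  then show ?thesis using r0 by (rule power2_le_imp_le)
qed

lemma sampling_expansion:
  assumes m: "1 \<le> m"
  shows "has_l2_sum (\<lambda>n t. sample n * sampling_function U c m (x n) t) f"
  unfolding has_l2_sum_def
proof (intro conjI allI f_L2)
  show "(\<lambda>t. sample n * sampling_function U c m (x n) t) \<in> L2" for n
    by (intro L2_cmult sampling_function_L2[OF e_L2 m, unfolded fun_eq_iff])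
  have "((\<lambda>S. sqrt ((l2_norm f)\<^sup>2 - (\<Sum>n\<in>S. a n * (norm (sample n))\<^sup>2))) \<longlongrightarrow>
      sqrt ((l2_norm f)\<^sup>2 - (l2_norm f)\<^sup>2)) (finite_subsets_at_top UNIV)"
    using sample_parseval unfolding has_sum_def by (intro tendsto_intros)
  then have lim: "((\<lambda>S. sqrt ((l2_norm f)\<^sup>2 - (\<Sum>n\<in>S. a n * (norm (sample n))\<^sup>2))) \<longlongrightarrow> 0) (finite_subsets_at_top UNIV)"
    by simp
  show "((\<lambda>S. l2_norm (\<lambda>t. f t - (\<Sum>n\<in>S. sample n * sampling_function U c m (x n) t))) \<longlongrightarrow> 0)
      (finite_subsets_at_top UNIV)"
  proof (rule Lim_null_comparison[OF _ lim])
    show "\<forall>\<^sub>F S in finite_subsets_at_top UNIV.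
        norm (l2_norm (\<lambda>t. f t - (\<Sum>n\<in>S. sample n * sampling_function U c m (x n) t)))
          \<le> sqrt ((l2_norm f)\<^sup>2 - (\<Sum>n\<in>S. a n * (norm (sample n))\<^sup>2))"
      using sampling_approximation[OF m] l2_norm_nonneg
      by (intro eventually_finite_subsets_at_top_weakI) simp
  qed
qed

end

text \<open>Each of the \<open>N + 1\<close> sinc factors contributes a factor of order \<open>1 / \<bar>t\<bar>\<close>, and the kernel is
  bounded away from its node.\<close>

lemma sampling_function_decay:
  "\<exists>C R. R > 0 \<and> (AE t in lebesgue. R \<le> \<bar>t\<bar> \<longrightarrow>
     norm (sampling_function U c (Suc N) (x n) t) \<le> C / \<bar>t\<bar> ^ N)"
proof -
  let ?m = "real (Suc N)" and ?s = "x n"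
  let ?Q = "(l2_norm (e n))\<^sup>2"
  \<comment> \<open>For \<open>\<bar>t\<bar> \<ge> 2 \<bar>s\<bar> + 1\<close> the distance \<open>\<bar>t - s\<bar>\<close> is at least \<open>\<bar>t\<bar> / 2\<close>, so a sinc factor is at most \<open>D / \<bar>t\<bar>\<close>.\<close>
  define D where "D = 4 * ?m / c"
  have "AE t in lebesgue. 2 * \<bar>?s\<bar> + 1 \<le> \<bar>t\<bar> \<longrightarrow>
      norm (sampling_function U c (Suc N) ?s t) \<le> (D ^ Suc N * (2 / pi / ?Q)) / \<bar>t\<bar> ^ N"
    using u_boundary
  proof eventually_elim
    case (elim t)
    show ?case
    proof
      assume t: "2 * \<bar>?s\<bar> + 1 \<le> \<bar>t\<bar>"
      then have t1: "1 \<le> \<bar>t\<bar>" and ts: "\<bar>t\<bar> / 2 \<le> \<bar>t - ?s\<bar>" "t \<noteq> ?s"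
        using abs_triangle_ineq[of "t - ?s" ?s] by auto
      define y where "y = c * (t - ?s) / (2 * ?m)"
      have y: "y \<noteq> 0" using c ts by (simp add: y_def)
      have "\<bar>sinc y\<bar> \<le> 1 / \<bar>y\<bar>" by (rule abs_sinc_le(2)[OF y])
      also have "1 / \<bar>y\<bar> = 2 * ?m / c / \<bar>t - ?s\<bar>"
        using c by (simp add: y_def abs_mult)
      also have "\<dots> \<le> 2 * ?m / c / (\<bar>t\<bar> / 2)"
        using c ts t1 by (intro divide_left_mono) auto
      also have "\<dots> = D / \<bar>t\<bar>" by (simp add: D_def)
      finally have "\<bar>sinc y\<bar> ^ Suc N \<le> (D / \<bar>t\<bar>) ^ Suc N" by (intro power_mono) auto
      also have "\<dots> = D ^ Suc N / \<bar>t\<bar> ^ Suc N" by (rule power_divide)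
      also have "\<dots> \<le> D ^ Suc N / \<bar>t\<bar> ^ N"
      proof (rule divide_left_mono)
        show "\<bar>t\<bar> ^ N \<le> \<bar>t\<bar> ^ Suc N" by (rule power_increasing) (use t1 in auto)
        show "0 \<le> D ^ Suc N" using c by (simp add: D_def)
        show "0 < \<bar>t\<bar> ^ Suc N * \<bar>t\<bar> ^ N" using t1 by (intro mult_pos_pos zero_less_power) auto
      qed
      finally have sinc: "\<bar>sinc y\<bar> ^ Suc N \<le> D ^ Suc N / \<bar>t\<bar> ^ N" .
      have "norm (1 - cnj \<alpha> * u t) \<le> norm (1::complex) + norm (cnj \<alpha> * u t)"
        by (rule norm_triangle_ineq4)
      then have "norm (1 - cnj \<alpha> * u t) \<le> 2"
        using elim alpha by (simp add: norm_mult)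
      moreover have "norm (complex_of_real t - complex_of_real ?s) = \<bar>t - ?s\<bar>"
        by (metis norm_of_real of_real_diff)
      then have "norm (e n t) = 1 / (2 * pi) * (norm (1 - cnj \<alpha> * u t) / \<bar>t - ?s\<bar>)"
        by (simp add: boundary_kernel_def model_kernel_def U_at_atom[OF x_atom] norm_mult norm_divide)
      moreover have "norm (1 - cnj \<alpha> * u t) / \<bar>t - ?s\<bar> \<le> 2 / (1 / 2)"
        by (rule frac_le) (use calculation(1) ts t1 in auto)
      ultimately have "norm (e n t) \<le> 1 / (2 * pi) * (2 / (1 / 2))"
        by (simp only:) (intro mult_left_mono, simp_all)
      then have kern: "norm (e n t) / ?Q \<le> 2 / pi / ?Q"
        by (intro divide_right_mono) (auto simp: field_simps)
      have "norm (sampling_function U c (Suc N) ?s t) = \<bar>sinc y\<bar> ^ Suc N * (norm (e n t) / ?Q)"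
        unfolding sampling_function_def y_def[symmetric]
        by (simp add: norm_mult norm_divide norm_power power_abs del: of_real_power power_Suc)
      also have "\<dots> \<le> D ^ Suc N / \<bar>t\<bar> ^ N * (2 / pi / ?Q)"
        using sinc kern c by (intro mult_mono) (auto simp: D_def)
      finally show "norm (sampling_function U c (Suc N) ?s t) \<le> (D ^ Suc N * (2 / pi / ?Q)) / \<bar>t\<bar> ^ N"
        by (simp add: mult_ac)
    qed
  qed
  then show ?thesis by (intro exI[of _ "D ^ Suc N * (2 / pi / ?Q)"] exI[of _ "2 * \<bar>?s\<bar> + 1"]) auto
qed

end

theorem theorem3p2:
  fixes c :: real and \<Theta> U :: "complex \<Rightarrow> complex" and \<alpha> :: complex
    and \<sigma> :: "real measure" and x :: "int \<Rightarrow> real"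
  assumes c: "c > 0"
    and inner: "inner_function \<Theta>"
    and U: "U = (\<lambda>z. exp_inner c z * \<Theta> z)"
    and alpha: "norm \<alpha> = 1"
    and clark: "clark_measure U \<alpha> 0 \<sigma>"
    and atomic: "purely_atomic \<sigma>"
    and x: "inj x" "range x = atoms \<sigma>"
  shows
    "(\<forall>m\<ge>1. \<forall>F f. hardy_boundary F f \<longrightarrow> f \<in> model_space \<Theta> \<longrightarrow>
        has_l2_sum (\<lambda>n t. hp_ext F (complex_of_real (x n)) * sampling_function U c m (x n) t) f)
     \<and> (\<forall>N::nat. \<exists>m\<ge>1. \<forall>n. \<exists>C R. R > 0 \<and>
          (AE t in lebesgue. R \<le> \<bar>t\<bar> \<longrightarrow> norm (sampling_function U c m (x n) t) \<le> C / \<bar>t\<bar> ^ N))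
     \<and> (\<forall>F f. hardy_boundary F f \<longrightarrow> f \<in> model_space \<Theta> \<longrightarrow>
          ((\<lambda>n. (norm (hp_ext F (complex_of_real (x n))))\<^sup>2 /
                 (l2_norm (boundary_kernel U (x n)))\<^sup>2) has_sum (l2_norm f)\<^sup>2) UNIV)"
proof -
  have hol: "U holomorphic_on upper_half_plane"
    using inner unfolding U inner_function_def by (intro holomorphic_intros exp_inner_holomorphic) auto
  have boundary: "AE t in lebesgue. \<exists>l. nt_limit U t l \<and> norm l = 1"
  proof -
    have "AE t in lebesgue. \<exists>l. nt_limit \<Theta> t l \<and> norm l = 1"
      using inner by (simp add: inner_function_def)
    then show ?thesis
    proof eventually_elim
      case (elim t)
      then obtain l where l: "nt_limit \<Theta> t l" "norm l = 1" by blast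
      have "nt_limit U t (exp_inner c (complex_of_real t) * l)"
        unfolding U by (intro nt_limit_mult exp_inner_nt_limit l)
      moreover have "norm (exp_inner c (complex_of_real t) * l) = 1"
        by (simp add: norm_mult l exp_inner_unimodular)
      ultimately show ?case by blast
    qed
  qed
  interpret sampling_setting U \<alpha> \<sigma> x c \<Theta>
  proof unfold_locales
    show "atoms \<sigma> \<noteq> {}" using x(2) by auto
  qed (use hol boundary assms in auto)
  show ?thesis
  proof (intro conjI allI impI)
    fix m :: nat and F f assume "1 \<le> m" "hardy_boundary F f" "f \<in> model_space \<Theta>"
    then show "has_l2_sum (\<lambda>n t. hp_ext F (complex_of_real (x n)) * sampling_function U c m (x n) t) f"
      using sampling_expansion by blast
  next
    fix N :: nat
    show "\<exists>m\<ge>1. \<forall>n. \<exists>C R. R > 0 \<and>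
        (AE t in lebesgue. R \<le> \<bar>t\<bar> \<longrightarrow> norm (sampling_function U c m (x n) t) \<le> C / \<bar>t\<bar> ^ N)"
      using sampling_function_decay by (intro exI[of _ "Suc N"]) simp
  next
    fix F f assume "hardy_boundary F f" "f \<in> model_space \<Theta>"
    from sample_parseval[OF this]
    show "((\<lambda>n. (norm (hp_ext F (complex_of_real (x n))))\<^sup>2 /
        (l2_norm (boundary_kernel U (x n)))\<^sup>2) has_sum (l2_norm f)\<^sup>2) UNIV"
      by (simp add: boundary_kernel_eq atom_kernel_norm[OF x_atom] mult.commute)
  qed
qed

end
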